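(* Let $c>0$. For $M,N\ge1$ let $Y^{(M,N)}$ be an $N\times N$ complex Wishart matrix with randomly permuted rows, i.e. $Y^{(M,N)}=U^{(N)}W^{(M,N)}$ with $U^{(N)},W^{(M,N)}$ as in the context. Then $Y^{(M,N)}$ converges in $*$-distribution to an R-diagonal random variable as $M,N\to\infty$ with $M/N\to c$. That is, there exist a tracial non-commutative $*$-probability space $(\mathcal A,\varphi)$ and an R-diagonal element $Y\in\mathcal A$ such that for every pair of strictly increasing sequences of positive integers $(M_q)_{q\ge1},(N_q)_{q\ge1}$ with $\lim_{q\to\infty}M_q/N_q=c$, every $n\ge1$ and all $\varepsilon_1,\dots,\varepsilon_n\in\{1,*\}$, $$\lim_{q\to\infty}\mathbb E\left(\mathrm{tr}^{(N_q)}\left[(Y^{(M_q,N_q)})^{\varepsilon_1}\cdots(Y^{(M_q,N_q)})^{\varepsilon_n}\right]\right)=\varphi\left(Y^{\varepsilon_1}\cdots Y^{\varepsilon_n}\right).$$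
   Context: For $M,N\ge1$: $W^{(M,N)}=\frac1N(G^{(M,N)})^*G^{(M,N)}$, where $G^{(M,N)}$ is an $M\times N$ random matrix whose entries are independent complex standard Gaussian random variables (real and imaginary parts independent real Gaussians of mean $0$ and variance $1/2$); $W^{(M,N)}$ is called a complex Wishart matrix. $U^{(N)}$ is a random permutation matrix uniformly distributed on the $N!$ permutation matrices of size $N$, and $U^{(N)}$ and $W^{(M,N)}$ are independent. $\mathrm{tr}^{(N)}A=\frac1N\sum_{i=1}^NA_{ii}$ and $\mathbb E$ is expectation. A tracial non-commutative $*$-probability space is a unital $*$-algebra $\mathcal A$ with a unital, tracial, positive linear functional $\varphi$. The non-crossing (free) cumulants $k_n:\mathcal A^n\to\mathbb C$ are the multilinear functionals determined by $\varphi(A_1\cdots A_n)=\sum_{\pi\in NC(n)}\prod_{V\in\pi}k_{|V|}(A_i: i\in V)$, summing over non-crossing partitions, with arguments in increasing order of index. An element $Y\in\mathcal A$ is R-diagonal if $k_n(Y^{\varepsilon_1},\dots,Y^{\varepsilon_n})=0$ for all $n\ge1$ and $\varepsilon_1,\dots,\varepsilon_n\in\{1,*\}$, except possibly when $n$ is even and $(\varepsilon_1,\dots,\varepsilon_n)$ is alternating, i.e. equal to $(1,*,1,*,\dots,1,* )$ or $( *,1,*,1,\dots,*,1)$. *)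

theory Defs
  imports
    "HOL-Probability.Probability"
    "Jordan_Normal_Form.Schur_Decomposition"
    "Jordan_Normal_Form.VS_Connect"
begin

section \<open>Tracial non-commutative *-probability spaces\<close>

datatype star_exp = Plain | Star

record 'a star_alg = "(complex, 'a) module" +
  star :: "'a \<Rightarrow> 'a"

locale unital_star_algebra =
  Module.module "class_ring :: complex ring" A + Ring.ring A
  for A :: "'a star_alg" (structure) +
  assumes smult_mult_left:
    "\<lbrakk>x \<in> carrier A; y \<in> carrier A\<rbrakk> \<Longrightarrow> (a \<odot> x) \<otimes> y = a \<odot> (x \<otimes> y)"
    and smult_mult_right:
    "\<lbrakk>x \<in> carrier A; y \<in> carrier A\<rbrakk> \<Longrightarrow> x \<otimes> (a \<odot> y) = a \<odot> (x \<otimes> y)"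
    and star_closed: "x \<in> carrier A \<Longrightarrow> star A x \<in> carrier A"
    and star_star: "x \<in> carrier A \<Longrightarrow> star A (star A x) = x"
    and star_add:
    "\<lbrakk>x \<in> carrier A; y \<in> carrier A\<rbrakk> \<Longrightarrow> star A (x \<oplus> y) = star A x \<oplus> star A y"
    and star_smult: "x \<in> carrier A \<Longrightarrow> star A (a \<odot> x) = cnj a \<odot> star A x"
    and star_mult:
    "\<lbrakk>x \<in> carrier A; y \<in> carrier A\<rbrakk> \<Longrightarrow> star A (x \<otimes> y) = star A y \<otimes> star A x"

locale tracial_star_probability_space = unital_star_algebra A
  for A :: "'a star_alg" (structure) +
  fixes \<phi> :: "'a \<Rightarrow> complex"
  assumes \<phi>_add: "\<lbrakk>x \<in> carrier A; y \<in> carrier A\<rbrakk> \<Longrightarrow> \<phi> (x \<oplus> y) = \<phi> x + \<phi> y"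
    and \<phi>_smult: "x \<in> carrier A \<Longrightarrow> \<phi> (a \<odot> x) = a * \<phi> x"
    and \<phi>_one: "\<phi> \<one> = 1"
    and \<phi>_tracial: "\<lbrakk>x \<in> carrier A; y \<in> carrier A\<rbrakk> \<Longrightarrow> \<phi> (x \<otimes> y) = \<phi> (y \<otimes> x)"
    and \<phi>_positive: "x \<in> carrier A \<Longrightarrow> \<phi> (star A x \<otimes> x) \<in> \<real>\<^sub>\<ge>\<^sub>0"

definition alg_prod :: "('a, 'b) monoid_scheme \<Rightarrow> 'a list \<Rightarrow> 'a" where
  "alg_prod A xs = foldr (\<lambda>x y. x \<otimes>\<^bsub>A\<^esub> y) xs \<one>\<^bsub>A\<^esub>"

fun star_power :: "'a star_alg \<Rightarrow> 'a \<Rightarrow> star_exp \<Rightarrow> 'a" where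
  "star_power A Y Plain = Y"
| "star_power A Y Star = star A Y"


section \<open>Free cumulants and R-diagonal elements\<close>

definition noncrossing :: "nat set set \<Rightarrow> bool" where
  "noncrossing \<pi> \<longleftrightarrow>
     (\<forall>V\<in>\<pi>. \<forall>V'\<in>\<pi>. \<forall>a b c d. a < b \<and> b < c \<and> c < d \<and>
        a \<in> V \<and> c \<in> V \<and> b \<in> V' \<and> d \<in> V' \<longrightarrow> V = V')"

definition NC :: "nat \<Rightarrow> nat set set set" where
  "NC n = {\<pi>. partition_on {..<n} \<pi> \<and> noncrossing \<pi>}"

lemma finite_NC: "finite (NC n)"
proof -
  have "NC n \<subseteq> Pow (Pow {..<n})"
    by (auto simp: NC_def partition_on_def)
  then show ?thesis
    by (rule finite_subset) simp
qed

lemma one_block_in_NC: "n > 0 \<Longrightarrow> {{..<n}} \<in> NC n"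
  by (auto simp: NC_def noncrossing_def partition_on_def)

lemma NC_block_proper:
  assumes "\<pi> \<in> NC n - {{{..<n}}}" "V \<in> \<pi>"
  shows "V \<subset> {..<n}"
proof -
  have p: "partition_on {..<n} \<pi>" and ne: "\<pi> \<noteq> {{..<n}}"
    using assms(1) by (auto simp: NC_def)
  have sub: "V \<subseteq> {..<n}"
    using p assms(2) by (auto simp: partition_on_def)
  moreover have "V \<noteq> {..<n}"
  proof
    assume V: "V = {..<n}"
    have "V' = V" if "V' \<in> \<pi>" for V'
    proof (rule ccontr)
      assume "V' \<noteq> V"
      then have "V' \<inter> V = {}"
        using p that assms(2) by (auto simp: partition_on_def disjoint_def)
      moreover have "V' \<subseteq> V" "V' \<noteq> {}"
        using p that V by (auto simp: partition_on_def)
      ultimately show False by blast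
    qed
    then show False
      using ne V assms(2) by blast
  qed
  ultimately show ?thesis by blast
qed

lemma length_nths_less:
  assumes "\<pi> \<in> NC (length xs) - {{{..<length xs}}}" "V \<in> \<pi>"
  shows "length (nths xs V) < length xs"
proof -
  have "V \<subset> {..<length xs}"
    using NC_block_proper[OF assms] .
  moreover have "{i. i < length xs \<and> i \<in> V} \<subseteq> V" by auto
  ultimately have "{i. i < length xs \<and> i \<in> V} \<subset> {..<length xs}" by auto
  then have "card {i. i < length xs \<and> i \<in> V} < card {..<length xs}"
    by (intro psubset_card_mono) auto
  then show ?thesis
    by (simp add: length_nths)
qed

text \<open>The moment-cumulant formula solved for the term of the one-block partition; the formula
  itself, and the fact that it determines the cumulants, are proved below. The list
  \<^term>\<open>nths xs V\<close> has the entries of \<^term>\<open>xs\<close> with index in \<^term>\<open>V\<close>, in increasing order.\<close>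

function free_cumulant :: "'a star_alg \<Rightarrow> ('a \<Rightarrow> complex) \<Rightarrow> 'a list \<Rightarrow> complex" where
  "free_cumulant A \<phi> xs =
     \<phi> (alg_prod A xs) -
     (\<Sum>\<pi>\<in>NC (length xs) - {{{..<length xs}}}. \<Prod>V\<in>\<pi>. free_cumulant A \<phi> (nths xs V))"
  by auto
termination
  by (relation "Wellfounded.measure (\<lambda>(A, \<phi>, xs). length xs)") (auto intro: length_nths_less)

declare free_cumulant.simps [simp del]

lemma sum_NC_split:
  assumes "xs \<noteq> []"
  shows "(\<Sum>\<pi>\<in>NC (length xs). \<Prod>V\<in>\<pi>. k (nths xs V)) =
     k xs + (\<Sum>\<pi>\<in>NC (length xs) - {{{..<length xs}}}. \<Prod>V\<in>\<pi>. (k (nths xs V) :: complex))"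
  using assms
  by (subst sum.remove[OF finite_NC one_block_in_NC]) (auto simp: nths_all)

lemma moment_cumulant_formula:
  assumes "xs \<noteq> []"
  shows "\<phi> (alg_prod A xs) =
     (\<Sum>\<pi>\<in>NC (length xs). \<Prod>V\<in>\<pi>. free_cumulant A \<phi> (nths xs V))"
  using sum_NC_split[OF assms, of "free_cumulant A \<phi>"] free_cumulant.simps[of A \<phi> xs] by simp

lemma free_cumulant_unique:
  assumes k: "\<And>xs. set xs \<subseteq> carrier A \<Longrightarrow> xs \<noteq> [] \<Longrightarrow>
      \<phi> (alg_prod A xs) = (\<Sum>\<pi>\<in>NC (length xs). \<Prod>V\<in>\<pi>. k (nths xs V))"
    and xs: "set xs \<subseteq> carrier A" "xs \<noteq> []"
  shows "k xs = free_cumulant A \<phi> xs"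
  using xs
proof (induction xs rule: length_induct)
  case (1 xs)
  have "k (nths xs V) = free_cumulant A \<phi> (nths xs V)"
    if \<pi>: "\<pi> \<in> NC (length xs) - {{{..<length xs}}}" and V: "V \<in> \<pi>" for \<pi> V
  proof -
    have "V \<subset> {..<length xs}" "V \<noteq> {}"
      using NC_block_proper[OF \<pi> V] \<pi> V by (auto simp: NC_def partition_on_def)
    then have "set (nths xs V) \<noteq> {}"
      by (auto simp: set_nths)
    then have "nths xs V \<noteq> []" by auto
    moreover have "set (nths xs V) \<subseteq> carrier A"
      using "1.prems"(1) set_nths_subset[of xs V] by blast
    ultimately show ?thesis
      using "1.IH" length_nths_less[OF \<pi> V] by blast
  qed
  then have "(\<Sum>\<pi>\<in>NC (length xs) - {{{..<length xs}}}. \<Prod>V\<in>\<pi>. k (nths xs V)) =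
    (\<Sum>\<pi>\<in>NC (length xs) - {{{..<length xs}}}. \<Prod>V\<in>\<pi>. free_cumulant A \<phi> (nths xs V))"
    by (intro sum.cong prod.cong) auto
  then show ?case
    using k[OF "1.prems"] sum_NC_split[OF "1.prems"(2), of k] free_cumulant.simps[of A \<phi> xs]
    by simp
qed

definition alternating :: "star_exp list \<Rightarrow> bool" where
  "alternating es \<longleftrightarrow>
     (\<exists>m. es = concat (replicate m [Plain, Star]) \<or> es = concat (replicate m [Star, Plain]))"

definition R_diagonal :: "'a star_alg \<Rightarrow> ('a \<Rightarrow> complex) \<Rightarrow> 'a \<Rightarrow> bool" where
  "R_diagonal A \<phi> Y \<longleftrightarrow> Y \<in> carrier A \<and>
     (\<forall>es. es \<noteq> [] \<and> \<not> alternating es \<longrightarrow> free_cumulant A \<phi> (map (star_power A Y) es) = 0)"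


section \<open>Random matrices\<close>

definition norm_trace :: "complex mat \<Rightarrow> complex" where
  "norm_trace A = (1 / of_nat (dim_row A)) * (\<Sum>i<dim_row A. A $$ (i, i))"

fun mat_star_power :: "complex mat \<Rightarrow> star_exp \<Rightarrow> complex mat" where
  "mat_star_power A Plain = A"
| "mat_star_power A Star = mat_adjoint A"

definition mat_word :: "nat \<Rightarrow> complex mat \<Rightarrow> star_exp list \<Rightarrow> complex mat" where
  "mat_word N A es = foldr (*) (map (mat_star_power A) es) (1\<^sub>m N)"

definition standard_complex_gaussian :: "'w measure \<Rightarrow> ('w \<Rightarrow> complex) \<Rightarrow> bool" where
  "standard_complex_gaussian P Z \<longleftrightarrow>
     prob_space.indep_var P borel (\<lambda>\<omega>. Re (Z \<omega>)) borel (\<lambda>\<omega>. Im (Z \<omega>)) \<and>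
     distributed P lborel (\<lambda>\<omega>. Re (Z \<omega>)) (normal_density 0 (sqrt (1/2))) \<and>
     distributed P lborel (\<lambda>\<omega>. Im (Z \<omega>)) (normal_density 0 (sqrt (1/2)))"

definition complex_gaussian_matrix ::
    "'w measure \<Rightarrow> nat \<Rightarrow> nat \<Rightarrow> ('w \<Rightarrow> complex mat) \<Rightarrow> bool" where
  "complex_gaussian_matrix P M N G \<longleftrightarrow>
     (\<forall>\<omega>\<in>space P. G \<omega> \<in> carrier_mat M N) \<and>
     prob_space.indep_vars P (\<lambda>_. borel) (\<lambda>ij \<omega>. G \<omega> $$ ij) ({..<M} \<times> {..<N}) \<and>
     (\<forall>i<M. \<forall>j<N. standard_complex_gaussian P (\<lambda>\<omega>. G \<omega> $$ (i, j)))"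

definition wishart :: "nat \<Rightarrow> complex mat \<Rightarrow> complex mat" where
  "wishart N G = (1 / of_nat N) \<cdot>\<^sub>m (mat_adjoint G * G)"

definition permutation_matrices :: "nat \<Rightarrow> complex mat set" where
  "permutation_matrices N =
     {Matrix.mat N N (\<lambda>(i, j). if i = \<sigma> j then 1 else 0) |\<sigma>. \<sigma> permutes {..<N}}"

definition uniform_permutation_matrix :: "'w measure \<Rightarrow> nat \<Rightarrow> ('w \<Rightarrow> complex mat) \<Rightarrow> bool" where
  "uniform_permutation_matrix P N U \<longleftrightarrow>
     U \<in> measurable P (count_space (permutation_matrices N)) \<and>
     distr P (count_space (permutation_matrices N)) U =
       uniform_count_measure (permutation_matrices N)"

text \<open>The type of matrices carries no canonical sigma-algebra, so a random matrix is seen as the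
  random vector of its entries.\<close>

definition indep_random_matrices ::
    "'w measure \<Rightarrow> nat \<Rightarrow> nat \<Rightarrow> ('w \<Rightarrow> complex mat) \<Rightarrow> ('w \<Rightarrow> complex mat) \<Rightarrow> bool" where
  "indep_random_matrices P m n A B \<longleftrightarrow>
     prob_space.indep_var P
       (PiM ({..<m} \<times> {..<n}) (\<lambda>_. borel)) (\<lambda>\<omega>. \<lambda>ij\<in>{..<m} \<times> {..<n}. A \<omega> $$ ij)
       (PiM ({..<m} \<times> {..<n}) (\<lambda>_. borel)) (\<lambda>\<omega>. \<lambda>ij\<in>{..<m} \<times> {..<n}. B \<omega> $$ ij)"

text \<open>The matrices of a model may live on a different probability space for each pair of sizes.\<close>

definition permuted_wishart_model ::
    "(nat \<Rightarrow> nat \<Rightarrow> 'w measure) \<Rightarrow> (nat \<Rightarrow> nat \<Rightarrow> 'w \<Rightarrow> complex mat) \<Rightarrow>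
     (nat \<Rightarrow> nat \<Rightarrow> 'w \<Rightarrow> complex mat) \<Rightarrow> bool" where
  "permuted_wishart_model P G U \<longleftrightarrow>
     (\<forall>M\<ge>1. \<forall>N\<ge>1.
        prob_space (P M N) \<and>
        complex_gaussian_matrix (P M N) M N (G M N) \<and>
        uniform_permutation_matrix (P M N) N (U M N) \<and>
        indep_random_matrices (P M N) N N (U M N) (\<lambda>\<omega>. wishart N (G M N \<omega>)))"

end

theory Submission
  imports Defs
begin

text \<open>For a fixed permutation matrix \<open>u\<close>, Gaussian integration by parts gives a Schwinger--Dyson equation
  for the expected products of normalised traces of words in \<open>u\<close>, its inverse and the Wishart matrix \<open>w\<close>;
  each of its terms has one \<open>w\<close> less. The expected normalised trace of a nonzero power of a uniform
  permutation matrix tends to \<open>0\<close>. Hence the products of traces factorise in the limit, and the limit \<open>\<tau>\<close>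
  is given by a recursion that eliminates the first \<open>w\<close> of a word. Induction along this recursion shows
  that \<open>\<tau> \<otimes> \<tau>\<close> vanishes on the derivation that cuts a word to the left of each \<open>u\<close> and, with the
  opposite sign, to the right of each inverse of \<open>u\<close>; this expresses the invariance of \<open>u\<close> under
  multiplication by a free Haar unitary.

  For the *-moments of \<open>Y = u w\<close> this is a quadratic identity over the cuts before \<open>Y\<close> and after its adjoint.
  Expand it over non-crossing partitions, with a base point between two cyclically adjacent equal letters.
  A partition contributes the signed number of cuts that split it. Each cut at an alternating block is
  cancelled by the one on the other side of the same gap, so if all shorter non-alternating cumulants
  vanish, only the one-block partition survives, and its cumulant is \<open>0\<close>. Traciality and positivity pass to
  the limit from the matrices.\<close>

section \<open>Words in a Haar unitary and a free Poisson element\<close>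

text \<open>The derivation is the first-order change of a word when \<open>u\<close> is replaced by
  \<open>(1 + t h) u\<close>. Multiplying on the left is what suits \<open>Y = u w\<close>: the
  marked sides are then the outer ends of \<open>u w\<close> and of its adjoint, so no cut falls
  inside a letter of a *-word and the identity involves *-moments of \<open>Y\<close> only. Freeness
  of \<open>u\<close> and \<open>w\<close> is never formulated.

  A permutation matrix is far from Haar distributed, and only the Gaussian part can be integrated by
  parts. After that the permutation enters through the numbers of fixed points of its powers alone.
  The equation for one trace contains products of two traces, so lists of words are carried
  throughout; the terms that join two traces have weight \<open>1 / N^2\<close>.

  The base point has to separate equal letters: such a gap carries exactly one cut, of sign 1
  between two \<open>Y\<close> and of sign -1 between two adjoints. Between an adjoint and a
  following \<open>Y\<close> there are two cuts of opposite sign, and between \<open>Y\<close> and a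
  following adjoint there is none, so there the one-block partition would drop out.\<close>

datatype letter = Perm | PermInv | Wish

text \<open>\<open>split_sum h x\<close> is the sum of \<open>h u v\<close> over all \<open>x = u @ Wish # v\<close>; \<open>cut_sum h x\<close> is the sum of \<open>h u v\<close>
  over all \<open>x = u @ v\<close> with \<open>v\<close> starting with \<open>Perm\<close>, minus the sum over those with \<open>u\<close> ending with
  \<open>PermInv\<close>. In the recursive form the exchange of the two sums is a simple induction.\<close>

primrec split_sum :: "(letter list \<Rightarrow> letter list \<Rightarrow> 'a::comm_monoid_add) \<Rightarrow> letter list \<Rightarrow> 'a" where
  "split_sum h [] = 0"
| "split_sum h (a # x) = (if a = Wish then h [] x else 0) + split_sum (\<lambda>u v. h (a # u) v) x"

primrec cut_sum :: "(letter list \<Rightarrow> letter list \<Rightarrow> complex) \<Rightarrow> letter list \<Rightarrow> complex" where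
  "cut_sum h [] = 0"
| "cut_sum h (a # x) = (case a of Perm \<Rightarrow> h [] (a # x) | PermInv \<Rightarrow> - h [a] x | Wish \<Rightarrow> 0)
     + cut_sum (\<lambda>u v. h (a # u) v) x"

text \<open>The premise hands \<open>y = u @ Wish # v\<close> to the function package: with this
  congruence rule the recursive calls of \<open>limit_trace\<close> under \<open>split_sum\<close>
  come with the fact that makes their arguments shorter.\<close>

lemma split_sum_cong [fundef_cong]:
  assumes "x = y" "\<And>u v. y = u @ Wish # v \<Longrightarrow> f u v = g u v"
  shows "split_sum f x = split_sum g y"
  unfolding assms(1) using assms(2)
proof (induction y arbitrary: f g)
  case (Cons a y)
  have "split_sum (\<lambda>u v. f (a # u) v) y = split_sum (\<lambda>u v. g (a # u) v) y"
    by (intro Cons.IH) (auto intro: Cons.prems)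
  then show ?case using Cons.prems[of "[]" y] by auto
qed simp

lemma cut_sum_cong:
  assumes "\<And>u v. x = u @ v \<Longrightarrow> f u v = g u v"
  shows "cut_sum f x = cut_sum g x"
  using assms
proof (induction x arbitrary: f g)
  case (Cons a x)
  have "cut_sum (\<lambda>u v. f (a # u) v) x = cut_sum (\<lambda>u v. g (a # u) v) x"
    by (intro Cons.IH) (auto intro: Cons.prems)
  moreover have "f [] (a # x) = g [] (a # x)" "f [a] x = g [a] x"
    by (auto intro: Cons.prems)
  ultimately show ?case by (auto split: letter.splits)
qed simp

lemma split_sum_zero [simp]: "split_sum (\<lambda>u v. 0) x = 0"
  by (induction x) auto

lemma split_sum_add:
  "split_sum (\<lambda>u v. f u v + g u v) x = split_sum f x + split_sum g x"
  by (induction x arbitrary: f g) (auto simp: add_ac)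

lemma split_sum_mult_left:
  "split_sum (\<lambda>u v. (k::complex) * f u v) x = k * split_sum f x"
  by (induction x arbitrary: f) (auto simp: algebra_simps)

lemma split_sum_mult_right:
  "split_sum f x * (k::complex) = split_sum (\<lambda>u v. f u v * k) x"
  by (induction x arbitrary: f) (auto simp: algebra_simps)

lemma mult_split_sum:
  "(k::complex) * split_sum (\<lambda>u v. f u * g u v) x = split_sum (\<lambda>u v. f u * (k * g u v)) x"
  by (simp add: mult.left_commute flip: split_sum_mult_left)

lemma cut_sum_zero [simp]: "cut_sum (\<lambda>u v. 0) x = 0"
  by (induction x) (auto split: letter.splits)

lemma cut_sum_add:
  "cut_sum (\<lambda>u v. f u v + g u v) x = cut_sum f x + cut_sum g x"
  by (induction x arbitrary: f g) (auto simp: algebra_simps split: letter.splits)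

lemma cut_sum_mult_left:
  "cut_sum (\<lambda>u v. k * f u v) x = k * cut_sum f x"
  by (induction x arbitrary: f) (auto simp: algebra_simps split: letter.splits)

lemma cut_sum_append:
  "cut_sum h (x @ y) = cut_sum (\<lambda>u v. h u (v @ y)) x + cut_sum (\<lambda>u v. h (x @ u) v) y"
  by (induction x arbitrary: h) (auto simp: add_ac split: letter.splits)

text \<open>Both sides run over the factorisations \<open>x = s @ Wish # t @ v\<close> with a cut
  between \<open>t\<close> and \<open>v\<close>. Choosing the cut and then a \<open>Wish\<close> to
  its left amounts to choosing the \<open>Wish\<close> and then a cut to its right, since
  \<open>Wish\<close> itself carries no cut.\<close>

lemma cut_sum_split_sum:
  "cut_sum (\<lambda>u v. split_sum (\<lambda>s t. h s t v) u) x = split_sum (\<lambda>s. cut_sum (h s)) x"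
proof (induction x arbitrary: h)
  case (Cons a x)
  show ?case
    using Cons.IH[of "\<lambda>s. h (a # s)"] by (auto simp: cut_sum_add split: letter.splits)
qed simp

lemma cut_sum_split_sum_right:
  "cut_sum (\<lambda>u v. split_sum (\<lambda>s t. h u v s t) y) x = split_sum (\<lambda>s t. cut_sum (\<lambda>u v. h u v s t) x) y"
  by (induction y arbitrary: h) (auto simp: cut_sum_add)

primrec exponent :: "letter list \<Rightarrow> int" where
  "exponent [] = 0"
| "exponent (a # x) = (case a of Perm \<Rightarrow> 1 | PermInv \<Rightarrow> - 1 | Wish \<Rightarrow> 0) + exponent x"

lemma exponent_append [simp]: "exponent (x @ y) = exponent x + exponent y"
  by (induction x) auto

lemma takeWhile_dropWhile_W:
  assumes "Wish \<in> set x"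
  shows "x = takeWhile (\<lambda>a. a \<noteq> Wish) x @ Wish # tl (dropWhile (\<lambda>a. a \<noteq> Wish) x)"
proof -
  have "dropWhile (\<lambda>a. a \<noteq> Wish) x \<noteq> []" using assms by auto
  then show ?thesis
    by (metis (mono_tags, lifting) hd_Cons_tl hd_dropWhile takeWhile_dropWhile_id)
qed

text \<open>This is the Schwinger--Dyson recursion for \<open>Wish # y @ p\<close> without its terms
  of order \<open>1 / N^2\<close>, written so that the prefix \<open>p\<close> stays in front.
  Rotating the word instead would hide the cut positions inside \<open>p\<close>. A word without
  \<open>Wish\<close> gets the moment of a Haar unitary.\<close>

function limit_trace :: "real \<Rightarrow> letter list \<Rightarrow> complex" where
  "limit_trace c x =
     (if Wish \<in> set x then
        let p = takeWhile (\<lambda>a. a \<noteq> Wish) x; y = tl (dropWhile (\<lambda>a. a \<noteq> Wish) x)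
        in of_real c * limit_trace c (p @ y)
             + split_sum (\<lambda>u v. limit_trace c u * limit_trace c (p @ Wish # v)) y
      else of_bool (exponent x = 0))"
  by auto
termination
proof (relation "Wellfounded.measure (\<lambda>(c, x). length x)", goal_cases)
  case (2 c x p y)
  then have "x = p @ Wish # y" using takeWhile_dropWhile_W by simp
  then show ?case by simp
next
  case (3 c x p y u v)
  then have "x = p @ Wish # y" using takeWhile_dropWhile_W by simp
  moreover have "y = u @ Wish # v" using 3 by simp
  ultimately show ?case by simp
next
  case (4 c x p y u v)
  then have "x = p @ Wish # y" using takeWhile_dropWhile_W by simp
  moreover have "y = u @ Wish # v" using 4 by simp
  ultimately show ?case by simp
qed auto

declare limit_trace.simps [simp del]

lemma limit_trace_unitary: "Wish \<notin> set x \<Longrightarrow> limit_trace c x = of_bool (exponent x = 0)"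
  by (simp add: limit_trace.simps)

lemma limit_trace_W:
  assumes "Wish \<notin> set p"
  shows "limit_trace c (p @ Wish # y) = of_real c * limit_trace c (p @ y)
    + split_sum (\<lambda>u v. limit_trace c u * limit_trace c (p @ Wish # v)) y"
proof -
  have "takeWhile (\<lambda>a. a \<noteq> Wish) (p @ Wish # y) = p" "dropWhile (\<lambda>a. a \<noteq> Wish) (p @ Wish # y) = Wish # y"
    using assms by (induction p) auto
  then show ?thesis by (subst limit_trace.simps) (simp add: Let_def)
qed

text \<open>Here \<open>a\<close> and \<open>b\<close> are the exponents to the left and to the
  right of \<open>x\<close>. The total exponent is 0, so a cut counts exactly when the partial
  exponent to its left is 0. Then \<open>Perm\<close> marks a step of the partial exponent from 0 up
  to 1 and \<open>PermInv\<close>, with negative sign, a step from 1 down to 0; the net number of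
  crossings telescopes.\<close>

lemma cut_sum_unitary:
  assumes "Wish \<notin> set x" and "a + b + exponent x = 0"
  shows "cut_sum (\<lambda>u v. of_bool (a + exponent u = 0) * of_bool (exponent v + b = 0)) x
    = of_bool (a + exponent x > 0) - of_bool (a > 0)"
  using assms
proof (induction x arbitrary: a)
  case (Cons z x)
  define e where "e = exponent [z]"
  have "cut_sum (\<lambda>u v. of_bool (a + e + exponent u = 0) * of_bool (exponent v + b = 0)) x
    = of_bool (a + e + exponent x > 0) - of_bool (a + e > 0)"
    using Cons.prems by (intro Cons.IH) (auto simp: e_def)
  then have "cut_sum (\<lambda>u v. of_bool (a + exponent (z # u) = 0) * of_bool (exponent v + b = 0)) x
    = of_bool (a + exponent (z # x) > 0) - of_bool (a + e > 0)"
    by (simp add: e_def add.assoc)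
  then have "cut_sum (\<lambda>u v. of_bool (a + exponent u = 0) * of_bool (exponent v + b = 0)) (z # x)
    = (case z of Perm \<Rightarrow> of_bool (a = 0) * of_bool (exponent (z # x) + b = 0)
        | PermInv \<Rightarrow> - (of_bool (a + e = 0) * of_bool (exponent x + b = 0)) | Wish \<Rightarrow> 0)
      + (of_bool (a + exponent (z # x) > 0) - of_bool (a + e > 0))"
    by (simp only: cut_sum.simps) (simp add: e_def)
  also have "\<dots> = of_bool (a + exponent (z # x) > 0) - of_bool (a > 0)"
    using Cons.prems by (cases z) (auto simp: e_def)
  finally show ?case .
qed simp

lemma cut_sum_unitary_zero:
  assumes "Wish \<notin> set x"
  shows "cut_sum (\<lambda>u v. limit_trace c u * limit_trace c v) x = 0"
proof -
  have *: "cut_sum (\<lambda>u v. limit_trace c u * limit_trace c v) x =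
      cut_sum (\<lambda>u v. of_bool (0 + exponent u = 0) * of_bool (exponent v + 0 = 0)) x"
    using assms by (intro cut_sum_cong) (auto simp: limit_trace_unitary)
  show ?thesis
  proof (cases "exponent x = 0")
    case True
    then show ?thesis unfolding * using assms by (subst cut_sum_unitary) auto
  next
    case False
    have "cut_sum (\<lambda>u v. of_bool (0 + exponent u = 0) * of_bool (exponent v + 0 = 0)) x
        = cut_sum (\<lambda>u v. 0) x"
      using False by (intro cut_sum_cong) auto
    then show ?thesis unfolding * by simp
  qed
qed

text \<open>The first \<open>Wish\<close> lies in exactly one of the two factors, and the recursion
  is applied to that factor. Cuts in \<open>p\<close> see all splittings of \<open>y\<close>, cuts
  in \<open>y\<close> only those to their left. After the sums are exchanged, both contributions
  combine into the same identity for \<open>p @ y\<close> and for all \<open>p @ Wish # t\<close>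
  with \<open>y = s @ Wish # t\<close>, which are shorter words.\<close>

theorem cut_sum_limit_trace: "cut_sum (\<lambda>u v. limit_trace c u * limit_trace c v) x = 0"
proof (induction x rule: length_induct)
  case (1 x)
  let ?t = "limit_trace c"
  show ?case
  proof (cases "Wish \<in> set x")
    case False
    then show ?thesis by (rule cut_sum_unitary_zero)
  next
    case True
    then obtain p y where x: "x = p @ Wish # y" and p: "Wish \<notin> set p"
      by (meson split_list_first)
    have "cut_sum (\<lambda>u v. ?t u * ?t (v @ Wish # y)) p =
       cut_sum (\<lambda>u v. of_real c * (?t u * ?t (v @ y))
          + split_sum (\<lambda>s t. ?t s * (?t u * ?t (v @ Wish # t))) y) p"
    proof (rule cut_sum_cong)
      fix u v assume "p = u @ v"
      then have "Wish \<notin> set v" using p by auto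
      then show "?t u * ?t (v @ Wish # y) = of_real c * (?t u * ?t (v @ y))
          + split_sum (\<lambda>s t. ?t s * (?t u * ?t (v @ Wish # t))) y"
        by (simp only: limit_trace_W[OF \<open>Wish \<notin> set v\<close>, of c y] distrib_left mult_split_sum
            mult.left_commute[of "?t u" "of_real c"])
    qed
    then have left: "cut_sum (\<lambda>u v. ?t u * ?t (v @ Wish # y)) p =
        of_real c * cut_sum (\<lambda>u v. ?t u * ?t (v @ y)) p
          + split_sum (\<lambda>s t. ?t s * cut_sum (\<lambda>u v. ?t u * ?t (v @ Wish # t)) p) y"
      by (simp only: cut_sum_add cut_sum_mult_left cut_sum_split_sum_right)
    have "cut_sum (\<lambda>u v. ?t (p @ Wish # u) * ?t v) y =
       cut_sum (\<lambda>u v. of_real c * (?t (p @ u) * ?t v)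
          + split_sum (\<lambda>s t. ?t s * (?t (p @ Wish # t) * ?t v)) u) y"
    proof (rule cut_sum_cong)
      fix u v
      show "?t (p @ Wish # u) * ?t v = of_real c * (?t (p @ u) * ?t v)
          + split_sum (\<lambda>s t. ?t s * (?t (p @ Wish # t) * ?t v)) u"
        by (simp only: limit_trace_W[OF p, of c u] distrib_right split_sum_mult_right mult.assoc)
    qed
    then have right: "cut_sum (\<lambda>u v. ?t (p @ Wish # u) * ?t v) y =
        of_real c * cut_sum (\<lambda>u v. ?t (p @ u) * ?t v) y
          + split_sum (\<lambda>s t. ?t s * cut_sum (\<lambda>u v. ?t (p @ Wish # u) * ?t v) t) y"
      by (simp only: cut_sum_add cut_sum_mult_left ext[OF cut_sum_mult_left]
          cut_sum_split_sum[of "\<lambda>s t v. ?t s * (?t (p @ Wish # t) * ?t v)"])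
    have IH1: "cut_sum (\<lambda>u v. ?t u * ?t v) (p @ y) = 0"
      using 1 x by simp
    have IH2: "split_sum (\<lambda>s t. ?t s * cut_sum (\<lambda>u v. ?t u * ?t v) (p @ Wish # t)) y
        = split_sum (\<lambda>s t. 0) y"
    proof (rule split_sum_cong[OF refl])
      fix s t assume "y = s @ Wish # t"
      then have "length (p @ Wish # t) < length x" by (simp add: x)
      then have "cut_sum (\<lambda>u v. ?t u * ?t v) (p @ Wish # t) = 0" using 1 by blast
      then show "?t s * cut_sum (\<lambda>u v. ?t u * ?t v) (p @ Wish # t) = 0" by simp
    qed
    have eq1: "cut_sum (\<lambda>u v. ?t u * ?t (v @ y)) p + cut_sum (\<lambda>u v. ?t (p @ u) * ?t v) y = 0"
      using IH1 by (simp only: cut_sum_append)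
    have eq2: "split_sum (\<lambda>s t. ?t s * cut_sum (\<lambda>u v. ?t u * ?t (v @ Wish # t)) p) y
        + split_sum (\<lambda>s t. ?t s * cut_sum (\<lambda>u v. ?t (p @ Wish # u) * ?t v) t) y = 0"
      using IH2 by (simp add: cut_sum_append split_sum_add distrib_left)
    have "cut_sum (\<lambda>u v. ?t u * ?t v) x =
       cut_sum (\<lambda>u v. ?t u * ?t (v @ Wish # y)) p + cut_sum (\<lambda>u v. ?t (p @ Wish # u) * ?t v) y"
      by (simp add: x cut_sum_append)
    also have "\<dots> = of_real c * (cut_sum (\<lambda>u v. ?t u * ?t (v @ y)) p + cut_sum (\<lambda>u v. ?t (p @ u) * ?t v) y)
      + (split_sum (\<lambda>s t. ?t s * cut_sum (\<lambda>u v. ?t u * ?t (v @ Wish # t)) p) y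
        + split_sum (\<lambda>s t. ?t s * cut_sum (\<lambda>u v. ?t (p @ Wish # u) * ?t v) t) y)"
      unfolding left right by (simp only: distrib_left add_ac)
    finally show ?thesis unfolding eq1 eq2 by simp
  qed
qed

text \<open>Since the Wishart matrix is self-adjoint, the adjoint of \<open>u w\<close> is
  \<open>w\<close> times the inverse of \<open>u\<close>.\<close>

fun letters :: "star_exp \<Rightarrow> letter list" where
  "letters Plain = [Perm, Wish]"
| "letters Star = [Wish, PermInv]"

definition word :: "star_exp list \<Rightarrow> letter list" where
  "word es = concat (map letters es)"

lemma word_simps [simp]:
  "word [] = []" "word (e # es) = letters e @ word es" "word (xs @ ys) = word xs @ word ys"
  by (auto simp: word_def)

section \<open>Gaussian integration by parts\<close>

text \<open>Here \<open>f p r a b\<close> stands for the expectation of \<open>z ^ p * cnj z ^ r * x ^ a * y ^ b\<close>, where \<open>z = x + \<i> * y\<close>.\<close>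

lemma complex_moment_recursion:
  fixes f :: "nat \<Rightarrow> nat \<Rightarrow> nat \<Rightarrow> nat \<Rightarrow> complex"
  assumes z: "\<And>p r a b. f (Suc p) r a b = f p r (Suc a) b + \<i> * f p r a (Suc b)"
    and zbar: "\<And>p r a b. f p (Suc r) a b = f p r (Suc a) b - \<i> * f p r a (Suc b)"
    and x: "\<And>a b. f 0 0 (Suc a) b = of_nat a / 2 * f 0 0 (a - 1) b"
    and y: "\<And>a b. f 0 0 a (Suc b) = of_nat b / 2 * f 0 0 a (b - 1)"
  shows "f (Suc p) r a b = of_nat r * f p (r - 1) a b
    + (of_nat a * f p r (a - 1) b + \<i> * of_nat b * f p r a (b - 1)) / 2"
\<comment> \<open>\<open>a\<close> and \<open>b\<close> stay arbitrary because each step trades a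
  factor \<open>z\<close> or \<open>cnj z\<close> for \<open>x\<close> or \<open>y\<close>. The last
  summand of the claim is the derivative of \<open>x ^ a * y ^ b\<close> with respect to
  \<open>cnj z\<close>; a truncated \<open>a - 1\<close> or \<open>b - 1\<close> comes with
  coefficient 0.\<close>
proof (induction r arbitrary: a b)
  case 0
  show ?case
  proof (induction p arbitrary: a b)
    case 0
    show ?case by (simp add: z x y field_simps)
  next
    case (Suc p)
    have "f (Suc (Suc p)) 0 a b = f (Suc p) 0 (Suc a) b + \<i> * f (Suc p) 0 a (Suc b)"
      by (rule z)
    also have "\<dots> = (of_nat (Suc a) * f p 0 a b + \<i> * of_nat b * f p 0 (Suc a) (b - 1)) / 2
        + \<i> * (of_nat a * f p 0 (a - 1) (Suc b) + \<i> * of_nat (Suc b) * f p 0 a b) / 2"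
      by (simp only: Suc.IH) simp
    also have "\<dots> = (of_nat a * f (Suc p) 0 (a - 1) b + \<i> * of_nat b * f (Suc p) 0 a (b - 1)) / 2"
      by (cases a; cases b) (simp_all add: z field_simps)
    finally show ?case by simp
  qed
next
  case (Suc r)
  have "f (Suc p) (Suc r) a b = f (Suc p) r (Suc a) b - \<i> * f (Suc p) r a (Suc b)"
    by (rule zbar)
  also have "\<dots> = of_nat r * f p (r - 1) (Suc a) b - \<i> * of_nat r * f p (r - 1) a (Suc b)
      + (of_nat (Suc a) * f p r a b + \<i> * of_nat b * f p r (Suc a) (b - 1)) / 2
      - \<i> * (of_nat a * f p r (a - 1) (Suc b) + \<i> * of_nat (Suc b) * f p r a b) / 2"
    by (simp only: Suc.IH) (simp add: field_simps)
  also have "\<dots> = of_nat (Suc r) * f p r a b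
      + (of_nat a * f p (Suc r) (a - 1) b + \<i> * of_nat b * f p (Suc r) a (b - 1)) / 2"
    by (cases a; cases b; cases r) (simp_all add: zbar field_simps)
  finally show ?case by simp
qed

context prob_space
begin

text \<open>Stein's identity for variance 1/2, read off from the closed formulas: for even
  \<open>n\<close> both sides vanish, at \<open>n = 0\<close> through the coefficient, and for odd
  \<open>n\<close> the two even moments have quotient \<open>n / 2\<close>.\<close>

lemma normal_half_moments:
  assumes D: "distributed M lborel X (normal_density 0 (sqrt (1/2)))"
  shows "integrable M (\<lambda>\<omega>. X \<omega> ^ n)"
    and "expectation (\<lambda>\<omega>. X \<omega> ^ Suc n) = real n / 2 * expectation (\<lambda>\<omega>. X \<omega> ^ (n - 1))"
proof -
  have "integrable lborel (\<lambda>x. normal_density 0 (sqrt (1/2)) x * x ^ n)"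
    using integrable_normal_moment[of "sqrt (1/2)" 0 n] by simp
  then show "integrable M (\<lambda>\<omega>. X \<omega> ^ n)"
    using distributed_integrable[OF D, of "\<lambda>x. x ^ n"] by simp
  have E: "expectation (\<lambda>\<omega>. X \<omega> ^ n) = (\<integral>x. normal_density 0 (sqrt (1/2)) x * x ^ n \<partial>lborel)" for n
    using distributed_integral[OF D, of "\<lambda>x. x ^ n"] by simp
  have odd: "expectation (\<lambda>\<omega>. X \<omega> ^ (2 * k + 1)) = 0" for k
    unfolding E using integral_normal_moment_odd[of "sqrt (1/2)" 0 k] by simp
  have even: "expectation (\<lambda>\<omega>. X \<omega> ^ (2 * k)) = fact (2 * k) / (4 ^ k * fact k)" for k
    unfolding E using integral_normal_moment_even[of "sqrt (1/2)" 0 k] by (simp add: power_divide)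
  show "expectation (\<lambda>\<omega>. X \<omega> ^ Suc n) = real n / 2 * expectation (\<lambda>\<omega>. X \<omega> ^ (n - 1))"
  proof (cases "even n")
    case True
    then obtain k where k: "n = 2 * k" by (elim evenE)
    show ?thesis
    proof (cases k)
      case 0
      then show ?thesis using odd[of 0] k by simp
    next
      case (Suc j)
      then have "n - 1 = 2 * j + 1" using k by simp
      then show ?thesis using odd[of k] odd[of j] k by simp
    qed
  next
    case False
    then obtain k where k: "n = 2 * k + 1" by (elim oddE)
    then have "Suc n = 2 * Suc k" "n - 1 = 2 * k" by simp_all
    then have "expectation (\<lambda>\<omega>. X \<omega> ^ Suc n) = fact (2 * Suc k) / (4 ^ Suc k * fact (Suc k))"
      "expectation (\<lambda>\<omega>. X \<omega> ^ (n - 1)) = fact (2 * k) / (4 ^ k * fact k)"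
      using even[of "Suc k"] even[of k] by metis+
    moreover have "fact (2 * Suc k) / (4 ^ Suc k * fact (Suc k))
      = real n / 2 * (fact (2 * k) / (4 ^ k * fact k :: real))"
      by (simp add: k divide_simps)
    ultimately show ?thesis by simp
  qed
qed

text \<open>Integration by parts in one variable, with constant 1 because the second absolute moment
  is 1. The additional powers of the real and the imaginary part in \<open>q\<close> reduce
  integrability and the recursion to moments of two independent real Gaussians.\<close>

lemma standard_complex_gaussian_moments:
  assumes "standard_complex_gaussian M Z"
  shows "integrable M (\<lambda>\<omega>. Z \<omega> ^ p * cnj (Z \<omega>) ^ r)"
    and "expectation (\<lambda>\<omega>. Z \<omega> ^ Suc p * cnj (Z \<omega>) ^ r)
      = of_nat r * expectation (\<lambda>\<omega>. Z \<omega> ^ p * cnj (Z \<omega>) ^ (r - 1))"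
proof -
  define X Y where "X = (\<lambda>\<omega>. Re (Z \<omega>))" and "Y = (\<lambda>\<omega>. Im (Z \<omega>))"
  have ind: "indep_var borel X borel Y"
    and DX: "distributed M lborel X (normal_density 0 (sqrt (1/2)))"
    and DY: "distributed M lborel Y (normal_density 0 (sqrt (1/2)))"
    using assms by (auto simp: standard_complex_gaussian_def X_def Y_def)
  have indp: "indep_var borel (\<lambda>\<omega>. X \<omega> ^ a) borel (\<lambda>\<omega>. Y \<omega> ^ b)" for a b
    using indep_var_compose[OF ind, of "\<lambda>x. x ^ a" borel "\<lambda>x. x ^ b" borel] by (simp add: comp_def)
  note intX = normal_half_moments(1)[OF DX] and intY = normal_half_moments(1)[OF DY]
  define q where "q = (\<lambda>p r a b \<omega>. Z \<omega> ^ p * cnj (Z \<omega>) ^ r * complex_of_real (X \<omega> ^ a * Y \<omega> ^ b))"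
  have zeq: "Z \<omega> = complex_of_real (X \<omega>) + \<i> * complex_of_real (Y \<omega>)" for \<omega>
    by (simp add: X_def Y_def complex_eq_iff)
  have zbeq: "cnj (Z \<omega>) = complex_of_real (X \<omega>) - \<i> * complex_of_real (Y \<omega>)" for \<omega>
    by (simp add: X_def Y_def complex_eq_iff)
  have qz: "q (Suc p) r a b \<omega> = q p r (Suc a) b \<omega> + \<i> * q p r a (Suc b) \<omega>" for p r a b \<omega>
  proof -
    have "q (Suc p) r a b \<omega> = Z \<omega> * q p r a b \<omega>" by (simp add: q_def)
    also have "\<dots> = (complex_of_real (X \<omega>) + \<i> * complex_of_real (Y \<omega>)) * q p r a b \<omega>"
      by (subst zeq) simp
    also have "\<dots> = q p r (Suc a) b \<omega> + \<i> * q p r a (Suc b) \<omega>"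
      by (simp add: q_def algebra_simps)
    finally show ?thesis .
  qed
  have qzb: "q p (Suc r) a b \<omega> = q p r (Suc a) b \<omega> - \<i> * q p r a (Suc b) \<omega>" for p r a b \<omega>
  proof -
    have "q p (Suc r) a b \<omega> = cnj (Z \<omega>) * q p r a b \<omega>" by (simp add: q_def)
    also have "\<dots> = (complex_of_real (X \<omega>) - \<i> * complex_of_real (Y \<omega>)) * q p r a b \<omega>"
      by (subst zbeq) simp
    also have "\<dots> = q p r (Suc a) b \<omega> - \<i> * q p r a (Suc b) \<omega>"
      by (simp add: q_def algebra_simps)
    finally show ?thesis .
  qed
  have int00: "integrable M (q 0 0 a b)" for a b
  proof -
    have "integrable M (\<lambda>\<omega>. complex_of_real (X \<omega> ^ a * Y \<omega> ^ b))"
      by (intro integrable_of_real indep_var_integrable[OF indp intX intY])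
    then show ?thesis by (simp add: q_def)
  qed
  have int0: "integrable M (q p 0 a b)" for p a b
  proof (induction p arbitrary: a b)
    case (Suc p)
    show ?case unfolding qz[abs_def] by (intro Bochner_Integration.integrable_add integrable_mult_right Suc.IH)
  qed (rule int00)
  have int: "integrable M (q p r a b)" for p r a b
  proof (induction r arbitrary: a b)
    case (Suc r)
    show ?case unfolding qzb[abs_def] by (intro Bochner_Integration.integrable_diff integrable_mult_right Suc.IH)
  qed (rule int0)
  define f where "f = (\<lambda>p r a b. expectation (q p r a b))"
  have fz: "f (Suc p) r a b = f p r (Suc a) b + \<i> * f p r a (Suc b)" for p r a b
    unfolding f_def qz[abs_def] using int by (simp add: integral_add)
  have fzb: "f p (Suc r) a b = f p r (Suc a) b - \<i> * f p r a (Suc b)" for p r a b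
    unfolding f_def qzb[abs_def] using int by (simp add: integral_diff)
  have f00: "f 0 0 a b = of_real (expectation (\<lambda>\<omega>. X \<omega> ^ a) * expectation (\<lambda>\<omega>. Y \<omega> ^ b))" for a b
  proof -
    have "f 0 0 a b = of_real (expectation (\<lambda>\<omega>. X \<omega> ^ a * Y \<omega> ^ b))"
      by (simp add: f_def q_def flip: of_real_mult of_real_power)
    then show ?thesis using indep_var_lebesgue_integral[OF indp intX intY] by simp
  qed
  have fx: "f 0 0 (Suc a) b = of_nat a / 2 * f 0 0 (a - 1) b" for a b
    unfolding f00 normal_half_moments(2)[OF DX] by simp
  have fy: "f 0 0 a (Suc b) = of_nat b / 2 * f 0 0 a (b - 1)" for a b
    unfolding f00 normal_half_moments(2)[OF DY] by simp
  have "f (Suc p) r 0 0 = of_nat r * f p (r - 1) 0 0"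
    using complex_moment_recursion[of f p r 0 0, OF fz fzb fx fy] by simp
  then show "expectation (\<lambda>\<omega>. Z \<omega> ^ Suc p * cnj (Z \<omega>) ^ r)
      = of_nat r * expectation (\<lambda>\<omega>. Z \<omega> ^ p * cnj (Z \<omega>) ^ (r - 1))"
    by (simp add: f_def q_def)
  show "integrable M (\<lambda>\<omega>. Z \<omega> ^ p * cnj (Z \<omega>) ^ r)"
    using int[of p r 0 0] by (simp add: q_def)
qed

end

text \<open>A polynomial in the variables \<open>g i\<close> and \<open>cnj (g i)\<close>, paired with its derivative with respect to \<open>cnj (g a)\<close>.\<close>

inductive wirtinger :: "'i set \<Rightarrow> 'i \<Rightarrow> (('i \<Rightarrow> complex) \<Rightarrow> complex) \<Rightarrow> (('i \<Rightarrow> complex) \<Rightarrow> complex) \<Rightarrow> bool"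
  for I a where
  const: "wirtinger I a (\<lambda>g. c) (\<lambda>g. 0)"
| add: "wirtinger I a F F' \<Longrightarrow> wirtinger I a H H' \<Longrightarrow>
    wirtinger I a (\<lambda>g. F g + H g) (\<lambda>g. F' g + H' g)"
| mult_var: "i \<in> I \<Longrightarrow> wirtinger I a F F' \<Longrightarrow> wirtinger I a (\<lambda>g. g i * F g) (\<lambda>g. g i * F' g)"
| mult_cnj: "i \<in> I \<Longrightarrow> wirtinger I a F F' \<Longrightarrow>
    wirtinger I a (\<lambda>g. cnj (g i) * F g) (\<lambda>g. of_bool (i = a) * F g + cnj (g i) * F' g)"

lemma wirtinger_cong:
  assumes "wirtinger I a F F'" "\<And>g. F g = H g" "\<And>g. F' g = H' g"
  shows "wirtinger I a H H'"
proof -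
  have "F = H" "F' = H'" using assms(2,3) by auto
  then show ?thesis using assms(1) by simp
qed

lemma wirtinger_cmult:
  assumes "wirtinger I a F F'"
  shows "wirtinger I a (\<lambda>g. c * F g) (\<lambda>g. c * F' g)"
  using assms
proof induction
  case (const d)
  show ?case by (rule wirtinger_cong[OF wirtinger.const[of I a "c * d"]]) auto
next
  case (add F F' H H')
  show ?case by (rule wirtinger_cong[OF wirtinger.add[OF add.IH]]) (auto simp: algebra_simps)
next
  case (mult_var i F F')
  show ?case by (rule wirtinger_cong[OF wirtinger.mult_var[OF mult_var(1) mult_var.IH]]) (auto simp: algebra_simps)
next
  case (mult_cnj i F F')
  show ?case by (rule wirtinger_cong[OF wirtinger.mult_cnj[OF mult_cnj(1) mult_cnj.IH]]) (auto simp: algebra_simps)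
qed

lemma wirtinger_mult:
  assumes "wirtinger I a F F'" "wirtinger I a H H'"
  shows "wirtinger I a (\<lambda>g. F g * H g) (\<lambda>g. F' g * H g + F g * H' g)"
  using assms
proof induction
  case (const d)
  show ?case by (rule wirtinger_cong[OF wirtinger_cmult[OF const, of d]]) auto
next
  case (add F F' K K')
  show ?case
    by (rule wirtinger_cong[OF wirtinger.add[OF add.IH(1)[OF add.prems] add.IH(2)[OF add.prems]]])
      (auto simp: algebra_simps)
next
  case (mult_var i F F')
  show ?case
    by (rule wirtinger_cong[OF wirtinger.mult_var[OF mult_var(1) mult_var.IH[OF mult_var.prems]]])
      (auto simp: algebra_simps)
next
  case (mult_cnj i F F')
  show ?case
    by (rule wirtinger_cong[OF wirtinger.mult_cnj[OF mult_cnj(1) mult_cnj.IH[OF mult_cnj.prems]]])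
      (auto simp: algebra_simps)
qed

lemma wirtinger_sum:
  assumes "\<And>x. x \<in> A \<Longrightarrow> wirtinger I a (F x) (F' x)"
  shows "wirtinger I a (\<lambda>g. \<Sum>x\<in>A. F x g) (\<lambda>g. \<Sum>x\<in>A. F' x g)"
  using assms
proof (induction A rule: infinite_finite_induct)
  case (insert x A)
  then have "wirtinger I a (F x) (F' x)"
    "wirtinger I a (\<lambda>g. \<Sum>x\<in>A. F x g) (\<lambda>g. \<Sum>x\<in>A. F' x g)" by auto
  then show ?case using insert(1,2) wirtinger.add by fastforce
qed (simp_all add: wirtinger.const)

lemma wirtinger_var: "i \<in> I \<Longrightarrow> wirtinger I a (\<lambda>g. g i) (\<lambda>g. 0)"
  using wirtinger.mult_var[OF _ wirtinger.const[of I a 1]] by simp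

definition monomial :: "'i multiset \<Rightarrow> 'i multiset \<Rightarrow> ('i \<Rightarrow> complex) \<Rightarrow> complex" where
  "monomial A B g = (\<Prod>i\<in>#A. g i) * (\<Prod>i\<in>#B. cnj (g i))"

lemma monomial_eq_prod:
  assumes "finite I" "set_mset A \<subseteq> I" "set_mset B \<subseteq> I"
  shows "monomial A B g = (\<Prod>i\<in>I. g i ^ count A i * cnj (g i) ^ count B i)"
proof -
  have "(\<Prod>i\<in>#A. f i) = (\<Prod>i\<in>I. f i ^ count A i)" if "set_mset A \<subseteq> I" for A and f :: "'a \<Rightarrow> complex"
    unfolding image_prod_mset_multiplicity using assms(1) that
    by (intro prod.mono_neutral_left) (auto simp: not_in_iff)
  then show ?thesis using assms by (simp add: monomial_def prod.distrib)
qed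

locale gaussian_family = prob_space +
  fixes I :: "'i set" and Z :: "'a \<Rightarrow> 'i \<Rightarrow> complex"
  assumes finite_I: "finite I"
    and indep: "indep_vars (\<lambda>_. borel) (\<lambda>i \<omega>. Z \<omega> i) I"
    and gaussian: "i \<in> I \<Longrightarrow> standard_complex_gaussian M (\<lambda>\<omega>. Z \<omega> i)"
begin

lemma monomial_moments:
  assumes A: "set_mset A \<subseteq> I" and B: "set_mset B \<subseteq> I"
  shows "integrable M (\<lambda>\<omega>. monomial A B (Z \<omega>))"
    and "expectation (\<lambda>\<omega>. monomial A B (Z \<omega>))
      = (\<Prod>i\<in>I. expectation (\<lambda>\<omega>. Z \<omega> i ^ count A i * cnj (Z \<omega> i) ^ count B i))"
proof -
  have ind: "indep_vars (\<lambda>_. borel) (\<lambda>i \<omega>. Z \<omega> i ^ count A i * cnj (Z \<omega> i) ^ count B i) I"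
    by (rule indep_vars_compose2[OF indep, of "\<lambda>i z. z ^ count A i * cnj z ^ count B i"])
      (intro borel_measurable_continuous_onI continuous_intros)
  have int: "integrable M (\<lambda>\<omega>. Z \<omega> i ^ count A i * cnj (Z \<omega> i) ^ count B i)" if "i \<in> I" for i
    using standard_complex_gaussian_moments(1)[OF gaussian[OF that]] .
  show "integrable M (\<lambda>\<omega>. monomial A B (Z \<omega>))"
    unfolding monomial_eq_prod[OF finite_I A B] by (rule indep_vars_integrable[OF finite_I ind int])
  show "expectation (\<lambda>\<omega>. monomial A B (Z \<omega>))
      = (\<Prod>i\<in>I. expectation (\<lambda>\<omega>. Z \<omega> i ^ count A i * cnj (Z \<omega> i) ^ count B i))"
    unfolding monomial_eq_prod[OF finite_I A B] by (rule indep_vars_lebesgue_integral[OF finite_I ind int])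
qed

text \<open>Independence turns both expectations into products over \<open>I\<close> whose factors
  differ only at \<open>a\<close>, where the identity in one variable applies.\<close>

lemma monomial_by_parts:
  assumes A: "set_mset A \<subseteq> I" and B: "set_mset B \<subseteq> I" and a: "a \<in> I"
  shows "expectation (\<lambda>\<omega>. monomial (add_mset a A) B (Z \<omega>))
    = of_nat (count B a) * expectation (\<lambda>\<omega>. monomial A (B - {#a#}) (Z \<omega>))"
proof -
  have aA: "set_mset (add_mset a A) \<subseteq> I" using A a by simp
  have Ba: "set_mset (B - {#a#}) \<subseteq> I" using B by (meson in_diffD subset_iff)
  have "(\<Prod>i\<in>I - {a}. expectation (\<lambda>\<omega>. Z \<omega> i ^ count (add_mset a A) i * cnj (Z \<omega> i) ^ count B i))
    = (\<Prod>i\<in>I - {a}. expectation (\<lambda>\<omega>. Z \<omega> i ^ count A i * cnj (Z \<omega> i) ^ count (B - {#a#}) i))"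
    by (intro prod.cong) auto
  then show ?thesis
    unfolding monomial_moments(2)[OF aA B] monomial_moments(2)[OF A Ba]
    using standard_complex_gaussian_moments(2)[OF gaussian[OF a], of "count A a" "count B a"]
    by (simp add: prod.remove[OF finite_I a])
qed

text \<open>The additional monomial makes the induction on \<open>wirtinger\<close> work: a factor
  \<open>g i\<close> or \<open>cnj (g i)\<close> of the polynomial is absorbed into \<open>A\<close>
  or \<open>B\<close>, down to a constant times a monomial. The term with \<open>count B a\<close>
  is the derivative of the monomial itself and disappears for \<open>B = {#}\<close>.\<close>

lemma wirtinger_by_parts_monomial:
  assumes "wirtinger I a F F'" "a \<in> I" "set_mset A \<subseteq> I" "set_mset B \<subseteq> I"
  shows "integrable M (\<lambda>\<omega>. F (Z \<omega>) * monomial A B (Z \<omega>))"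
    and "integrable M (\<lambda>\<omega>. F' (Z \<omega>) * monomial A B (Z \<omega>))"
    and "expectation (\<lambda>\<omega>. F (Z \<omega>) * monomial (add_mset a A) B (Z \<omega>))
      = expectation (\<lambda>\<omega>. F' (Z \<omega>) * monomial A B (Z \<omega>))
        + of_nat (count B a) * expectation (\<lambda>\<omega>. F (Z \<omega>) * monomial A (B - {#a#}) (Z \<omega>))"
proof -
  have diff: "set_mset (B - {#a#}) \<subseteq> I" if "set_mset B \<subseteq> I" for B
    using that by (meson in_diffD subset_iff)
  have "\<forall>A B. set_mset A \<subseteq> I \<longrightarrow> set_mset B \<subseteq> I \<longrightarrow>
    integrable M (\<lambda>\<omega>. F (Z \<omega>) * monomial A B (Z \<omega>)) \<and>
    integrable M (\<lambda>\<omega>. F' (Z \<omega>) * monomial A B (Z \<omega>)) \<and>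
    expectation (\<lambda>\<omega>. F (Z \<omega>) * monomial (add_mset a A) B (Z \<omega>))
      = expectation (\<lambda>\<omega>. F' (Z \<omega>) * monomial A B (Z \<omega>))
        + of_nat (count B a) * expectation (\<lambda>\<omega>. F (Z \<omega>) * monomial A (B - {#a#}) (Z \<omega>))"
    using assms(1)
  proof induction
    case (const c)
    then show ?case
      using monomial_moments(1) monomial_by_parts assms(2) by simp
  next
    case (add F F' H H')
    show ?case
    proof (intro allI impI)
      fix A B :: "'i multiset" assume AB: "set_mset A \<subseteq> I" "set_mset B \<subseteq> I"
      note B' = diff[OF AB(2)]
      have aA: "set_mset (add_mset a A) \<subseteq> I" using AB assms(2) by simp
      note i = add.IH[rule_format, OF AB] add.IH[rule_format, OF aA AB(2)]
        add.IH[rule_format, OF AB(1) B']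
      show "integrable M (\<lambda>\<omega>. (F (Z \<omega>) + H (Z \<omega>)) * monomial A B (Z \<omega>)) \<and>
        integrable M (\<lambda>\<omega>. (F' (Z \<omega>) + H' (Z \<omega>)) * monomial A B (Z \<omega>)) \<and>
        expectation (\<lambda>\<omega>. (F (Z \<omega>) + H (Z \<omega>)) * monomial (add_mset a A) B (Z \<omega>))
        = expectation (\<lambda>\<omega>. (F' (Z \<omega>) + H' (Z \<omega>)) * monomial A B (Z \<omega>))
        + of_nat (count B a) * expectation (\<lambda>\<omega>. (F (Z \<omega>) + H (Z \<omega>)) * monomial A (B - {#a#}) (Z \<omega>))"
        using i by (simp add: distrib_right distrib_left)
    qed
  next
    case (mult_var i F F')
    have [simp]: "g i * k * monomial A B g = k * monomial (add_mset i A) B g" for g A B k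
      by (simp add: monomial_def mult_ac)
    show ?case
    proof (intro allI impI)
      fix A B :: "'i multiset" assume AB: "set_mset A \<subseteq> I" "set_mset B \<subseteq> I"
      have A: "set_mset (add_mset i A) \<subseteq> I" using AB mult_var(1) by simp
      show "integrable M (\<lambda>\<omega>. Z \<omega> i * F (Z \<omega>) * monomial A B (Z \<omega>)) \<and>
        integrable M (\<lambda>\<omega>. Z \<omega> i * F' (Z \<omega>) * monomial A B (Z \<omega>)) \<and>
        expectation (\<lambda>\<omega>. Z \<omega> i * F (Z \<omega>) * monomial (add_mset a A) B (Z \<omega>))
        = expectation (\<lambda>\<omega>. Z \<omega> i * F' (Z \<omega>) * monomial A B (Z \<omega>))
        + of_nat (count B a) * expectation (\<lambda>\<omega>. Z \<omega> i * F (Z \<omega>) * monomial A (B - {#a#}) (Z \<omega>))"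
        using mult_var.IH[rule_format, OF A AB(2)] by (simp add: add_mset_commute[of i a])
    qed
  next
    case (mult_cnj i F F')
    have m: "cnj (g i) * k * monomial A B g = k * monomial A (add_mset i B) g" for g A B k
      by (simp add: monomial_def mult_ac)
    show ?case
    proof (intro allI impI)
      fix A B :: "'i multiset" assume AB: "set_mset A \<subseteq> I" "set_mset B \<subseteq> I"
      have B: "set_mset (add_mset i B) \<subseteq> I" using AB mult_cnj(1) by simp
      note IH = mult_cnj.IH[rule_format, OF AB(1) B] and IH0 = mult_cnj.IH[rule_format, OF AB]
      \<comment> \<open>Absorbing \<open>cnj (g i)\<close> raises the multiplicity of
        \<open>a\<close> in \<open>B\<close> exactly when \<open>i = a\<close>; the additional term
        is the derivative of the absorbed factor.\<close>
      have count: "of_nat (count (add_mset i B) a) * expectation (\<lambda>\<omega>. F (Z \<omega>) * monomial A (add_mset i B - {#a#}) (Z \<omega>))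
        = of_bool (i = a) * expectation (\<lambda>\<omega>. F (Z \<omega>) * monomial A B (Z \<omega>))
          + of_nat (count B a) * expectation (\<lambda>\<omega>. F (Z \<omega>) * monomial A (add_mset i (B - {#a#})) (Z \<omega>))"
      proof (cases "a \<in># B")
        case True
        then show ?thesis by (cases "i = a") (auto simp: algebra_simps)
      next
        case False
        then show ?thesis by (cases "i = a") (auto simp: not_in_iff)
      qed
      have "(\<lambda>\<omega>. (of_bool (i = a) * F (Z \<omega>) + cnj (Z \<omega> i) * F' (Z \<omega>)) * monomial A B (Z \<omega>))
         = (\<lambda>\<omega>. of_bool (i = a) * (F (Z \<omega>) * monomial A B (Z \<omega>)) + F' (Z \<omega>) * monomial A (add_mset i B) (Z \<omega>))"
        by (simp only: distrib_right m mult.assoc[of "of_bool _"])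
      then show "integrable M (\<lambda>\<omega>. cnj (Z \<omega> i) * F (Z \<omega>) * monomial A B (Z \<omega>)) \<and>
        integrable M (\<lambda>\<omega>. (of_bool (i = a) * F (Z \<omega>) + cnj (Z \<omega> i) * F' (Z \<omega>)) * monomial A B (Z \<omega>)) \<and>
        expectation (\<lambda>\<omega>. cnj (Z \<omega> i) * F (Z \<omega>) * monomial (add_mset a A) B (Z \<omega>))
        = expectation (\<lambda>\<omega>. (of_bool (i = a) * F (Z \<omega>) + cnj (Z \<omega> i) * F' (Z \<omega>)) * monomial A B (Z \<omega>))
        + of_nat (count B a) * expectation (\<lambda>\<omega>. cnj (Z \<omega> i) * F (Z \<omega>) * monomial A (B - {#a#}) (Z \<omega>))"
        using IH IH0 count by (simp add: m)
    qed
  qed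
  then show "integrable M (\<lambda>\<omega>. F (Z \<omega>) * monomial A B (Z \<omega>))"
    "integrable M (\<lambda>\<omega>. F' (Z \<omega>) * monomial A B (Z \<omega>))"
    "expectation (\<lambda>\<omega>. F (Z \<omega>) * monomial (add_mset a A) B (Z \<omega>))
      = expectation (\<lambda>\<omega>. F' (Z \<omega>) * monomial A B (Z \<omega>))
        + of_nat (count B a) * expectation (\<lambda>\<omega>. F (Z \<omega>) * monomial A (B - {#a#}) (Z \<omega>))"
    using assms(3,4) by blast+
qed

theorem wirtinger_by_parts:
  assumes "wirtinger I a F F'" "a \<in> I"
  shows "integrable M (\<lambda>\<omega>. F (Z \<omega>))" "integrable M (\<lambda>\<omega>. F' (Z \<omega>))"
    and "integrable M (\<lambda>\<omega>. Z \<omega> a * F (Z \<omega>))"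
    and "expectation (\<lambda>\<omega>. Z \<omega> a * F (Z \<omega>)) = expectation (\<lambda>\<omega>. F' (Z \<omega>))"
  using wirtinger_by_parts_monomial[OF assms, of "{#}" "{#}"]
    wirtinger_by_parts_monomial(1)[OF assms, of "{#a#}" "{#}"] assms(2)
  by (simp_all add: monomial_def mult.commute)

end

section \<open>The Schwinger--Dyson equation\<close>

lemma split_sum_sum:
  "split_sum (\<lambda>u v. \<Sum>q\<in>Q. f q u v) x = (\<Sum>q\<in>Q. (split_sum (f q) x :: complex))"
  by (induction x arbitrary: f) (auto simp: sum.distrib)

lemma split_sum_append:
  "split_sum h (x @ y) = split_sum (\<lambda>u v. h u (v @ y)) x + split_sum (\<lambda>u v. h (x @ u) v) y"
  by (induction x arbitrary: h) (auto simp: add_ac)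

lemma split_sum_no_W: "Wish \<notin> set x \<Longrightarrow> split_sum h x = 0"
  by (induction x arbitrary: h) auto

fun letter_entry :: "(nat \<Rightarrow> nat) \<Rightarrow> (nat \<Rightarrow> nat \<Rightarrow> complex) \<Rightarrow> letter \<Rightarrow> nat \<Rightarrow> nat \<Rightarrow> complex" where
  "letter_entry \<sigma> w Perm i j = of_bool (i = \<sigma> j)"
| "letter_entry \<sigma> w PermInv i j = of_bool (j = \<sigma> i)"
| "letter_entry \<sigma> w Wish i j = w i j"

text \<open>Products are spelled out as index sums over scalar functions, not over the type
  \<open>mat\<close>, so that for a Gram matrix \<open>w\<close> every entry of a word is visibly a
  polynomial in the Gaussian variables and their conjugates, as \<open>wirtinger\<close>
  requires.\<close>

fun entry :: "nat \<Rightarrow> (nat \<Rightarrow> nat) \<Rightarrow> (nat \<Rightarrow> nat \<Rightarrow> complex) \<Rightarrow> letter list \<Rightarrow> nat \<Rightarrow> nat \<Rightarrow> complex" where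
  "entry N \<sigma> w [] i j = of_bool (i = j)"
| "entry N \<sigma> w (a # x) i j = (\<Sum>l<N. letter_entry \<sigma> w a i l * entry N \<sigma> w x l j)"

definition word_trace :: "nat \<Rightarrow> (nat \<Rightarrow> nat) \<Rightarrow> (nat \<Rightarrow> nat \<Rightarrow> complex) \<Rightarrow> letter list \<Rightarrow> complex" where
  "word_trace N \<sigma> w x = (\<Sum>i<N. entry N \<sigma> w x i i) / of_nat N"

definition trace_prod where
  "trace_prod N \<sigma> w xs = (\<Prod>x\<leftarrow>xs. word_trace N \<sigma> w x)"

definition gram :: "nat \<Rightarrow> nat \<Rightarrow> (nat \<times> nat \<Rightarrow> complex) \<Rightarrow> nat \<Rightarrow> nat \<Rightarrow> complex" where
  "gram M N g i j = (\<Sum>k<M. cnj (g (k, i)) * g (k, j)) / of_nat N"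

lemma entry_append:
  "i < N \<Longrightarrow> entry N \<sigma> w (x @ y) i j = (\<Sum>l<N. entry N \<sigma> w x i l * entry N \<sigma> w y l j)"
proof (induction x arbitrary: i)
  case Nil
  have "(\<Sum>l<N. of_bool (i = l) * entry N \<sigma> w y l j) = (\<Sum>l<N. if i = l then entry N \<sigma> w y l j else 0)"
    by (intro sum.cong) auto
  then show ?case using Nil by simp
next
  case (Cons a x)
  have "entry N \<sigma> w ((a # x) @ y) i j =
      (\<Sum>l<N. \<Sum>q<N. letter_entry \<sigma> w a i l * (entry N \<sigma> w x l q * entry N \<sigma> w y q j))"
    using Cons.IH by (simp add: sum_distrib_left)
  also have "\<dots> = (\<Sum>q<N. \<Sum>l<N. letter_entry \<sigma> w a i l * (entry N \<sigma> w x l q * entry N \<sigma> w y q j))"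
    by (rule sum.swap)
  finally show ?case by (simp add: sum_distrib_left sum_distrib_right mult_ac)
qed

lemma word_trace_commute: "word_trace N \<sigma> w (x @ y) = word_trace N \<sigma> w (y @ x)"
proof -
  have "(\<Sum>i<N. entry N \<sigma> w (x @ y) i i) = (\<Sum>i<N. \<Sum>l<N. entry N \<sigma> w x i l * entry N \<sigma> w y l i)"
    by (simp add: entry_append)
  also have "\<dots> = (\<Sum>l<N. \<Sum>i<N. entry N \<sigma> w y l i * entry N \<sigma> w x i l)"
    by (subst sum.swap) (simp add: mult.commute)
  also have "\<dots> = (\<Sum>l<N. entry N \<sigma> w (y @ x) l l)"
    by (simp add: entry_append)
  finally show ?thesis by (simp add: word_trace_def)
qed

lemma trace_prod_simps [simp]:
  "trace_prod N \<sigma> w [] = 1"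
  "trace_prod N \<sigma> w (x # xs) = word_trace N \<sigma> w x * trace_prod N \<sigma> w xs"
  "trace_prod N \<sigma> w (xs @ ys) = trace_prod N \<sigma> w xs * trace_prod N \<sigma> w ys"
  by (auto simp: trace_prod_def)

text \<open>The entry \<open>(i, q)\<close> of the Gram matrix contains conjugates only from column
  \<open>i\<close>, so its derivative is \<open>g (k, q) / of_nat N\<close> if \<open>i = l\<close>
  and 0 otherwise. The product rule thus opens the word at each \<open>Wish\<close>: the part
  \<open>u\<close> ends at index \<open>l\<close>, and the part \<open>v\<close> starts with the
  free row \<open>g (k, y)\<close>.\<close>

lemma wirtinger_entry:
  assumes "k < M" "l < N" "i < N" "j < N"
  shows "wirtinger ({..<M} \<times> {..<N}) (k, l) (\<lambda>g. entry N \<sigma> (gram M N g) x i j)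
    (\<lambda>g. split_sum (\<lambda>u v. entry N \<sigma> (gram M N g) u i l *
        ((\<Sum>y<N. g (k, y) * entry N \<sigma> (gram M N g) v y j) / of_nat N)) x)"
  using assms(3)
proof (induction x arbitrary: i)
  case Nil
  show ?case by (simp add: wirtinger.const)
next
  case (Cons a x)
  let ?I = "{..<M} \<times> {..<N}"
  let ?e = "\<lambda>g. entry N \<sigma> (gram M N g)"
  let ?d = "\<lambda>g u v. (\<Sum>y<N. g (k, y) * ?e g v y j) / of_nat N"
  have w: "wirtinger ?I (k, l) (\<lambda>g. letter_entry \<sigma> (gram M N g) a i q)
    (\<lambda>g. if a = Wish then of_bool (i = l) * (g (k, q) / of_nat N) else 0)" if q: "q < N" for q
  proof (cases a)
    case Wish
    have "wirtinger ?I (k, l) (\<lambda>g. \<Sum>k'<M. cnj (g (k', i)) * g (k', q))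
       (\<lambda>g. \<Sum>k'<M. of_bool ((k', i) = (k, l)) * g (k', q) + cnj (g (k', i)) * 0)"
      using q Cons.prems by (intro wirtinger_sum wirtinger.mult_cnj wirtinger_var) auto
    then have "wirtinger ?I (k, l) (\<lambda>g. (1 / of_nat N) * (\<Sum>k'<M. cnj (g (k', i)) * g (k', q)))
       (\<lambda>g. (1 / of_nat N) * (\<Sum>k'<M. of_bool ((k', i) = (k, l)) * g (k', q) + cnj (g (k', i)) * 0))"
      by (rule wirtinger_cmult)
    moreover have "(\<Sum>k'<M. of_bool ((k', i) = (k, l)) * g (k', q) + cnj (g (k', i)) * 0)
      = of_bool (i = l) * g (k, q)" for g :: "nat \<times> nat \<Rightarrow> complex"
    proof -
      have "(\<Sum>k'<M. of_bool ((k', i) = (k, l)) * g (k', q) + cnj (g (k', i)) * 0)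
        = (\<Sum>k'<M. if k = k' then of_bool (i = l) * g (k, q) else 0)"
        by (intro sum.cong) auto
      then show ?thesis using assms(1) by simp
    qed
    ultimately show ?thesis
      by (simp add: Wish gram_def)
  qed (simp_all add: wirtinger.const)
  have "wirtinger ?I (k, l) (\<lambda>g. \<Sum>q<N. letter_entry \<sigma> (gram M N g) a i q * ?e g x q j)
     (\<lambda>g. \<Sum>q<N. (if a = Wish then of_bool (i = l) * (g (k, q) / of_nat N) else 0) * ?e g x q j
        + letter_entry \<sigma> (gram M N g) a i q * split_sum (\<lambda>u v. ?e g u q l * ?d g u v) x)"
    by (intro wirtinger_sum wirtinger_mult w Cons.IH) auto
  then show ?case
  proof (rule wirtinger_cong)
    fix g
    have "(\<Sum>q<N. letter_entry \<sigma> (gram M N g) a i q * split_sum (\<lambda>u v. ?e g u q l * ?d g u v) x)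
       = split_sum (\<lambda>u v. ?e g (a # u) i l * ?d g u v) x"
      by (simp only: split_sum_mult_left[symmetric] split_sum_sum[symmetric] entry.simps
          sum_distrib_right mult.assoc)
    moreover have "(\<Sum>q<N. (if a = Wish then of_bool (i = l) * (g (k, q) / of_nat N) else 0) * ?e g x q j)
       = (if a = Wish then ?e g [] i l * ?d g [] x else 0)"
      by (auto simp: sum_distrib_left sum_distrib_right sum_divide_distrib)
    ultimately show "(\<Sum>q<N. (if a = Wish then of_bool (i = l) * (g (k, q) / of_nat N) else 0) * ?e g x q j
        + letter_entry \<sigma> (gram M N g) a i q * split_sum (\<lambda>u v. ?e g u q l * ?d g u v) x)
      = split_sum (\<lambda>u v. ?e g u i l * ?d g u v) (a # x)"
      by (simp add: sum.distrib del: entry.simps)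
  qed simp
qed

text \<open>Taking the trace closes the two ends left open in \<open>wirtinger_entry\<close> and
  glues \<open>v\<close> to \<open>u\<close>. One factor \<open>1 / N\<close> comes from the Gram
  matrix, the other from the normalised trace.\<close>

lemma wirtinger_word_trace:
  assumes "k < M" "l < N"
  shows "wirtinger ({..<M} \<times> {..<N}) (k, l) (\<lambda>g. word_trace N \<sigma> (gram M N g) x)
    (\<lambda>g. split_sum (\<lambda>u v. (\<Sum>y<N. g (k, y) * entry N \<sigma> (gram M N g) (v @ u) y l) / of_nat N ^ 2) x)"
proof -
  let ?e = "\<lambda>g. entry N \<sigma> (gram M N g)"
  have "wirtinger ({..<M} \<times> {..<N}) (k, l) (\<lambda>g. (1 / of_nat N) * (\<Sum>i<N. ?e g x i i))
    (\<lambda>g. (1 / of_nat N) * (\<Sum>i<N. split_sum (\<lambda>u v. ?e g u i l * ((\<Sum>y<N. g (k, y) * ?e g v y i) / of_nat N)) x))"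
    using assms by (intro wirtinger_cmult wirtinger_sum wirtinger_entry) auto
  then show ?thesis
  proof (rule wirtinger_cong)
    fix g
    have "(\<Sum>i<N. ?e g u i l * ((\<Sum>y<N. g (k, y) * ?e g v y i) / of_nat N))
      = (\<Sum>y<N. g (k, y) * ?e g (v @ u) y l) / of_nat N" for u v
    proof -
      have "(\<Sum>i<N. ?e g u i l * (\<Sum>y<N. g (k, y) * ?e g v y i))
        = (\<Sum>i<N. \<Sum>y<N. g (k, y) * (?e g v y i * ?e g u i l))"
        by (simp add: sum_distrib_left mult_ac)
      also have "\<dots> = (\<Sum>y<N. g (k, y) * ?e g (v @ u) y l)"
        by (subst sum.swap) (simp add: entry_append sum_distrib_left)
      finally show ?thesis by (simp flip: sum_divide_distrib)
    qed
    then show "(1 / of_nat N) * (\<Sum>i<N. split_sum (\<lambda>u v. ?e g u i l * ((\<Sum>y<N. g (k, y) * ?e g v y i) / of_nat N)) x)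
      = split_sum (\<lambda>u v. (\<Sum>y<N. g (k, y) * ?e g (v @ u) y l) / of_nat N ^ 2) x"
      by (simp add: power2_eq_square flip: split_sum_sum split_sum_mult_left)
  qed (simp add: word_trace_def)
qed

text \<open>The terms of order \<open>1 / N^2\<close> in the Schwinger--Dyson equation, where the derivative hits another
  trace and merges the two words.\<close>

primrec merge_sum :: "letter list \<Rightarrow> letter list list \<Rightarrow> (letter list list \<Rightarrow> complex) \<Rightarrow> complex" where
  "merge_sum y [] h = 0"
| "merge_sum y (x # xs) h =
     split_sum (\<lambda>u v. h ((Wish # v @ u @ y) # xs)) x + merge_sum y xs (\<lambda>zs. h (zs @ [x]))"

primrec trace_prod_deriv where
  "trace_prod_deriv M N \<sigma> k l [] g = 0"
| "trace_prod_deriv M N \<sigma> k l (x # xs) g =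
     split_sum (\<lambda>u v. (\<Sum>y<N. g (k, y) * entry N \<sigma> (gram M N g) (v @ u) y l) / of_nat N ^ 2) x
       * trace_prod N \<sigma> (gram M N g) xs
     + word_trace N \<sigma> (gram M N g) x * trace_prod_deriv M N \<sigma> k l xs g"

lemma wirtinger_trace_prod:
  assumes "k < M" "l < N"
  shows "wirtinger ({..<M} \<times> {..<N}) (k, l) (\<lambda>g. trace_prod N \<sigma> (gram M N g) xs)
    (trace_prod_deriv M N \<sigma> k l xs)"
proof (induction xs)
  case Nil
  show ?case by (rule wirtinger_cong[OF wirtinger.const[of _ _ 1]]) auto
next
  case (Cons x xs)
  show ?case
    by (rule wirtinger_cong[OF wirtinger_mult[OF wirtinger_word_trace[OF assms] Cons]]) auto
qed

text \<open>The sum over \<open>k\<close> joins a conjugate row and a free row to a new Gram matrix,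
  with a factor \<open>N\<close> from its normalisation. This turns derivatives back into
  words.\<close>

lemma sum_gram:
  assumes "N > 0"
  shows "(\<Sum>k<M. \<Sum>l<N. (\<Sum>j<N. cnj (g (k, j)) * f l j) * (\<Sum>y<N. g (k, y) * h y l))
    = of_nat N * (\<Sum>j<N. \<Sum>y<N. gram M N g j y * (\<Sum>l<N. h y l * f l j))"
proof -
  have "(\<Sum>k<M. \<Sum>l<N. (\<Sum>j<N. cnj (g (k, j)) * f l j) * (\<Sum>y<N. g (k, y) * h y l))
    = (\<Sum>k<M. \<Sum>l<N. \<Sum>j<N. \<Sum>y<N. cnj (g (k, j)) * g (k, y) * (h y l * f l j))"
    by (simp only: sum_product) (simp add: mult_ac)
  also have "\<dots> = (\<Sum>k<M. \<Sum>j<N. \<Sum>l<N. \<Sum>y<N. cnj (g (k, j)) * g (k, y) * (h y l * f l j))"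
    by (intro sum.cong refl sum.swap)
  also have "\<dots> = (\<Sum>k<M. \<Sum>j<N. \<Sum>y<N. \<Sum>l<N. cnj (g (k, j)) * g (k, y) * (h y l * f l j))"
    by (intro sum.cong refl sum.swap)
  also have "\<dots> = (\<Sum>j<N. \<Sum>k<M. \<Sum>y<N. \<Sum>l<N. cnj (g (k, j)) * g (k, y) * (h y l * f l j))"
    by (rule sum.swap)
  also have "\<dots> = (\<Sum>j<N. \<Sum>y<N. \<Sum>k<M. \<Sum>l<N. cnj (g (k, j)) * g (k, y) * (h y l * f l j))"
    by (intro sum.cong refl sum.swap)
  also have "\<dots> = (\<Sum>j<N. \<Sum>y<N. (\<Sum>k<M. cnj (g (k, j)) * g (k, y)) * (\<Sum>l<N. h y l * f l j))"
    by (simp add: sum_product)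
  also have "\<dots> = of_nat N * (\<Sum>j<N. \<Sum>y<N. gram M N g j y * (\<Sum>l<N. h y l * f l j))"
    using assms by (simp add: gram_def sum_distrib_left)
  finally show ?thesis .
qed

text \<open>The left factor is the row that remains of the first trace once \<open>g (k, l)\<close>
  is taken out of its leading \<open>Wish\<close>. By \<open>sum_gram\<close> it joins the free row
  of a differentiated trace \<open>u @ Wish # v\<close> to the single word
  \<open>Wish # v @ u @ y\<close>. Of the factor \<open>1 / N^2\<close> in the derivative,
  \<open>sum_gram\<close> absorbs one power and the trace of the merged word the other.\<close>

lemma sum_merge:
  assumes "N > 0"
  shows "(\<Sum>k<M. \<Sum>l<N. (\<Sum>j<N. cnj (g (k, j)) * entry N \<sigma> (gram M N g) y l j) * trace_prod_deriv M N \<sigma> k l xs g)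
    = merge_sum y xs (trace_prod N \<sigma> (gram M N g))"
proof (induction xs)
  case (Cons x xs)
  let ?e = "entry N \<sigma> (gram M N g)" and ?t = "trace_prod N \<sigma> (gram M N g)" and ?w = "word_trace N \<sigma> (gram M N g)"
  let ?f = "\<lambda>k l. \<Sum>j<N. cnj (g (k, j)) * ?e y l j"
  have one: "(\<Sum>k<M. \<Sum>l<N. ?f k l * ((\<Sum>z<N. g (k, z) * ?e (v @ u) z l) / of_nat N ^ 2))
      = ?w (Wish # v @ u @ y)" for u v
  proof -
    have "(\<Sum>k<M. \<Sum>l<N. ?f k l * ((\<Sum>z<N. g (k, z) * ?e (v @ u) z l) / of_nat N ^ 2))
      = (\<Sum>k<M. \<Sum>l<N. ?f k l * (\<Sum>z<N. g (k, z) * ?e (v @ u) z l)) / of_nat N ^ 2"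
      by (simp only: times_divide_eq_right sum_divide_distrib[symmetric])
    also have "\<dots> = (\<Sum>j<N. \<Sum>z<N. gram M N g j z * (\<Sum>l<N. ?e (v @ u) z l * ?e y l j)) / of_nat N"
      using assms by (subst sum_gram) (auto simp: power2_eq_square)
    also have "\<dots> = ?w (Wish # (v @ u) @ y)"
      by (simp add: word_trace_def entry_append del: append_assoc)
    finally show ?thesis by simp
  qed
  have gen: "(\<Sum>k<M. \<Sum>l<N. f k l * (s k l * t + c * d k l))
      = (\<Sum>k<M. \<Sum>l<N. f k l * s k l) * t + (\<Sum>k<M. \<Sum>l<N. f k l * d k l) * c"
    for f s d :: "nat \<Rightarrow> nat \<Rightarrow> complex" and t c
    by (simp add: distrib_left sum.distrib sum_distrib_left sum_distrib_right mult_ac)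
  have "(\<Sum>k<M. \<Sum>l<N. ?f k l * trace_prod_deriv M N \<sigma> k l (x # xs) g)
     = (\<Sum>k<M. \<Sum>l<N. split_sum (\<lambda>u v. ?f k l * ((\<Sum>z<N. g (k, z) * ?e (v @ u) z l) / of_nat N ^ 2)) x) * ?t xs
       + (\<Sum>k<M. \<Sum>l<N. ?f k l * trace_prod_deriv M N \<sigma> k l xs g) * ?w x"
    by (simp only: gen trace_prod_deriv.simps split_sum_mult_left)
  also have "(\<Sum>k<M. \<Sum>l<N. split_sum (\<lambda>u v. ?f k l * ((\<Sum>z<N. g (k, z) * ?e (v @ u) z l) / of_nat N ^ 2)) x)
     = split_sum (\<lambda>u v. ?w (Wish # v @ u @ y)) x"
    by (simp only: split_sum_sum[symmetric] one)
  finally have *: "(\<Sum>k<M. \<Sum>l<N. ?f k l * trace_prod_deriv M N \<sigma> k l (x # xs) g)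
     = split_sum (\<lambda>u v. ?w (Wish # v @ u @ y)) x * ?t xs + merge_sum y xs ?t * ?w x"
    by (simp only: Cons)
  have ms: "merge_sum y xs (\<lambda>zs. h zs * k) = merge_sum y xs h * k" for h k
    by (induction xs arbitrary: h) (auto simp: split_sum_mult_right distrib_right)
  show ?case unfolding * by (simp add: ms split_sum_mult_right)
qed simp

lemma (in prob_space) expectation_split_sum:
  assumes "\<And>u v. integrable M (f u v)"
  shows "integrable M (\<lambda>\<omega>. split_sum (\<lambda>u v. f u v \<omega>) x)"
    and "expectation (\<lambda>\<omega>. split_sum (\<lambda>u v. f u v \<omega>) x) = split_sum (\<lambda>u v. expectation (f u v) :: complex) x"
proof -
  have "integrable M (\<lambda>\<omega>. split_sum (\<lambda>u v. f u v \<omega>) x) \<and>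
    expectation (\<lambda>\<omega>. split_sum (\<lambda>u v. f u v \<omega>) x) = split_sum (\<lambda>u v. expectation (f u v)) x"
    using assms
  proof (induction x arbitrary: f)
    case (Cons a x)
    show ?case
      using Cons.IH[of "\<lambda>u. f (a # u)"] Cons.prems by (cases "a = Wish") (auto simp: integral_add)
  qed simp
  then show "integrable M (\<lambda>\<omega>. split_sum (\<lambda>u v. f u v \<omega>) x)"
    "expectation (\<lambda>\<omega>. split_sum (\<lambda>u v. f u v \<omega>) x) = split_sum (\<lambda>u v. expectation (f u v)) x"
    by auto
qed

lemma (in prob_space) expectation_merge_sum:
  assumes "\<And>zs. integrable M (f zs)"
  shows "integrable M (\<lambda>\<omega>. merge_sum y xs (\<lambda>zs. f zs \<omega>))"
    and "expectation (\<lambda>\<omega>. merge_sum y xs (\<lambda>zs. f zs \<omega>)) = merge_sum y xs (\<lambda>zs. expectation (f zs))"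
proof -
  have "integrable M (\<lambda>\<omega>. merge_sum y xs (\<lambda>zs. f zs \<omega>)) \<and>
    expectation (\<lambda>\<omega>. merge_sum y xs (\<lambda>zs. f zs \<omega>)) = merge_sum y xs (\<lambda>zs. expectation (f zs))"
    using assms
  proof (induction xs arbitrary: f)
    case (Cons x xs)
    show ?case
      using Cons.IH[of "\<lambda>zs. f (zs @ [x])"] Cons.prems
        expectation_split_sum[of "\<lambda>u v. f ((Wish # v @ u @ y) # xs)" x]
      by (auto simp: integral_add)
  qed simp
  then show "integrable M (\<lambda>\<omega>. merge_sum y xs (\<lambda>zs. f zs \<omega>))"
    "expectation (\<lambda>\<omega>. merge_sum y xs (\<lambda>zs. f zs \<omega>)) = merge_sum y xs (\<lambda>zs. expectation (f zs))"
    by auto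
qed

locale gaussian_matrix = gaussian_family P "{..<m} \<times> {..<n}" Z
  for P :: "'w measure" and m n :: nat and Z :: "'w \<Rightarrow> nat \<times> nat \<Rightarrow> complex" +
  assumes pos: "m > 0" "n > 0"
begin

definition mean_trace :: "(nat \<Rightarrow> nat) \<Rightarrow> letter list list \<Rightarrow> complex" where
  "mean_trace \<sigma> xs = expectation (\<lambda>\<omega>. trace_prod n \<sigma> (gram m n (Z \<omega>)) xs)"

lemma integrable_trace_prod: "integrable P (\<lambda>\<omega>. trace_prod n \<sigma> (gram m n (Z \<omega>)) xs)"
  using wirtinger_by_parts(1)[OF wirtinger_trace_prod[of 0 m 0 n]] pos by simp

text \<open>Up to \<open>1 / n^2\<close> the left side is the sum of the expectations of
  \<open>g (k, l) * F k l g\<close>, and each is integrated by parts. The derivative hits the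
  conjugate in the same Gram matrix, giving \<open>m * n\<close> times the trace of
  \<open>y\<close>; or a \<open>Wish\<close> inside \<open>y\<close>, which splits the word into two
  traces; or a word of \<open>xs\<close>, which merges with \<open>y\<close>.\<close>

theorem schwinger_dyson:
  "mean_trace \<sigma> ((Wish # y) # xs) = of_nat m / of_nat n * mean_trace \<sigma> (y # xs)
     + split_sum (\<lambda>u v. mean_trace \<sigma> (u # (Wish # v) # xs)) y
     + merge_sum y xs (mean_trace \<sigma>) / of_nat n ^ 2"
proof -
  let ?e = "\<lambda>g. entry n \<sigma> (gram m n g)" and ?t = "\<lambda>g. trace_prod n \<sigma> (gram m n g)"
    and ?w = "\<lambda>g. word_trace n \<sigma> (gram m n g)"
  define F where "F = (\<lambda>k l g. (\<Sum>j<n. cnj (g (k, j)) * ?e g y l j) * ?t g xs)"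
  define F' where "F' = (\<lambda>k l g. (\<Sum>j<n. of_bool ((k, j) = (k, l)) * ?e g y l j
      + cnj (g (k, j)) * split_sum (\<lambda>u v. ?e g u l l * ((\<Sum>z<n. g (k, z) * ?e g v z j) / of_nat n)) y) * ?t g xs
      + (\<Sum>j<n. cnj (g (k, j)) * ?e g y l j) * trace_prod_deriv m n \<sigma> k l xs g)"
  have FF': "wirtinger ({..<m} \<times> {..<n}) (k, l) (F k l) (F' k l)" if "k < m" "l < n" for k l
    unfolding F_def F'_def using that
    by (intro wirtinger_mult wirtinger_trace_prod wirtinger_sum wirtinger.mult_cnj wirtinger_entry) auto
  have left: "?t g ((Wish # y) # xs) = (\<Sum>k<m. \<Sum>l<n. g (k, l) * F k l g) / of_nat n ^ 2" for g
  proof -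
    \<comment> \<open>Writing \<open>g (k, l)\<close> as a row times the identity matrix brings the
      sum into the shape of \<open>sum_gram\<close>.\<close>
    have "(\<Sum>k<m. \<Sum>l<n. g (k, l) * F k l g)
      = (\<Sum>k<m. \<Sum>l<n. (\<Sum>j<n. cnj (g (k, j)) * ?e g y l j) * (\<Sum>z<n. g (k, z) * of_bool (z = l))) * ?t g xs"
    proof -
      have "(\<Sum>z<n. g (k, z) * of_bool (z = l)) = g (k, l)" if "l < n" for k l
      proof -
        have "(\<Sum>z<n. g (k, z) * of_bool (z = l)) = (\<Sum>z<n. if z = l then g (k, z) else 0)"
          by (intro sum.cong) auto
        then show ?thesis using that by simp
      qed
      then show ?thesis by (simp add: F_def sum_distrib_left sum_distrib_right mult_ac)
    qed
    also have "\<dots> = of_nat n * (\<Sum>j<n. \<Sum>z<n. gram m n g j z * (\<Sum>l<n. of_bool (z = l) * ?e g y l j)) * ?t g xs"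
      using pos by (subst sum_gram) auto
    also have "\<dots> = of_nat n * (\<Sum>j<n. \<Sum>z<n. gram m n g j z * ?e g y z j) * ?t g xs"
      using entry_append[of _ n \<sigma> "gram m n g" "[]" y] by simp
    also have "(\<Sum>j<n. \<Sum>z<n. gram m n g j z * ?e g y z j) = of_nat n * ?w g (Wish # y)"
      using pos by (simp add: word_trace_def)
    finally show ?thesis using pos by (simp add: power2_eq_square)
  qed
  have right: "(\<Sum>k<m. \<Sum>l<n. F' k l g) / of_nat n ^ 2 = of_nat m / of_nat n * ?t g (y # xs)
     + split_sum (\<lambda>u v. ?t g (u # (Wish # v) # xs)) y + merge_sum y xs (?t g) / of_nat n ^ 2" for g
  proof -
    have diag: "(\<Sum>j<n. of_bool ((k, j) = (k, l)) * ?e g y l j) = ?e g y l l" if "l < n" for k l :: nat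
    proof -
      have "(\<Sum>j<n. of_bool ((k, j) = (k, l)) * ?e g y l j) = (\<Sum>j<n. if j = l then ?e g y l j else 0)"
        by (intro sum.cong) auto
      then show ?thesis using that by simp
    qed
    have S1: "(\<Sum>k<m. \<Sum>l<n. ?e g y l l) = of_nat m * of_nat n * ?w g y"
      using pos by (simp add: word_trace_def)
    have S2: "(\<Sum>k<m. \<Sum>l<n. \<Sum>j<n. cnj (g (k, j)) *
        split_sum (\<lambda>u v. ?e g u l l * ((\<Sum>z<n. g (k, z) * ?e g v z j) / of_nat n)) y)
      = of_nat n ^ 2 * split_sum (\<lambda>u v. ?w g u * ?w g (Wish # v)) y"
    proof -
      \<comment> \<open>The index \<open>l\<close> occurs only in the diagonal entry of
        \<open>u\<close> and sums to its trace, while the rows indexed by \<open>k\<close> contract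
        to the trace of \<open>Wish # v\<close>.\<close>
      have one: "(\<Sum>k<m. \<Sum>l<n. \<Sum>j<n. cnj (g (k, j)) * (?e g u l l * ((\<Sum>z<n. g (k, z) * ?e g v z j) / of_nat n)))
        = of_nat n ^ 2 * (?w g u * ?w g (Wish # v))" for u v
      proof -
        have "(\<Sum>k<m. \<Sum>l<n. \<Sum>j<n. cnj (g (k, j)) * (?e g u l l * ((\<Sum>z<n. g (k, z) * ?e g v z j) / of_nat n)))
          = (\<Sum>l<n. ?e g u l l) * (\<Sum>k<m. \<Sum>j<n. cnj (g (k, j)) * ((\<Sum>z<n. g (k, z) * ?e g v z j) / of_nat n))"
          unfolding sum_distrib_left sum_distrib_right
          by (subst sum.swap) (simp add: mult_ac sum_distrib_left)
        also have "(\<Sum>k<m. \<Sum>j<n. cnj (g (k, j)) * ((\<Sum>z<n. g (k, z) * ?e g v z j) / of_nat n))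
          = (\<Sum>j<n. \<Sum>z<n. gram m n g j z * ?e g v z j)"
        proof -
          have "(\<Sum>k<m. \<Sum>j<n. cnj (g (k, j)) * ((\<Sum>z<n. g (k, z) * ?e g v z j) / of_nat n))
            = (\<Sum>k<m. \<Sum>j<n. \<Sum>z<n. cnj (g (k, j)) * g (k, z) / of_nat n * ?e g v z j)"
            by (simp add: sum_distrib_left sum_divide_distrib mult_ac)
          also have "\<dots> = (\<Sum>j<n. \<Sum>k<m. \<Sum>z<n. cnj (g (k, j)) * g (k, z) / of_nat n * ?e g v z j)"
            by (rule sum.swap)
          also have "\<dots> = (\<Sum>j<n. \<Sum>z<n. \<Sum>k<m. cnj (g (k, j)) * g (k, z) / of_nat n * ?e g v z j)"
            by (intro sum.cong refl sum.swap)
          finally show ?thesis by (simp add: gram_def sum_distrib_right sum_divide_distrib)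
        qed
        finally show ?thesis using pos by (simp add: word_trace_def power2_eq_square)
      qed
      show ?thesis
        by (simp only: split_sum_mult_left[symmetric] split_sum_sum[symmetric] one)
    qed
    have "(\<Sum>k<m. \<Sum>l<n. F' k l g) =
       (\<Sum>k<m. \<Sum>l<n. ?e g y l l) * ?t g xs
       + (\<Sum>k<m. \<Sum>l<n. \<Sum>j<n. cnj (g (k, j)) *
        split_sum (\<lambda>u v. ?e g u l l * ((\<Sum>z<n. g (k, z) * ?e g v z j) / of_nat n)) y) * ?t g xs
       + (\<Sum>k<m. \<Sum>l<n. (\<Sum>j<n. cnj (g (k, j)) * ?e g y l j) * trace_prod_deriv m n \<sigma> k l xs g)"
    proof -
      have F': "F' k l g = (?e g y l l + (\<Sum>j<n. cnj (g (k, j)) *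
          split_sum (\<lambda>u v. ?e g u l l * ((\<Sum>z<n. g (k, z) * ?e g v z j) / of_nat n)) y)) * ?t g xs
        + (\<Sum>j<n. cnj (g (k, j)) * ?e g y l j) * trace_prod_deriv m n \<sigma> k l xs g" if "l < n" for k l
        unfolding F'_def by (simp only: sum.distrib diag[OF that])
      have gen: "(\<Sum>k<m. \<Sum>l<n. (a l + b k l) * t + d k l)
          = (\<Sum>k<m. \<Sum>l<n. a l) * t + (\<Sum>k<m. \<Sum>l<n. b k l) * t + (\<Sum>k<m. \<Sum>l<n. d k l)"
        for a and b d :: "nat \<Rightarrow> nat \<Rightarrow> complex" and t
        by (simp add: distrib_right sum.distrib sum_distrib_right del: sum_constant)
      have "(\<Sum>k<m. \<Sum>l<n. F' k l g) = (\<Sum>k<m. \<Sum>l<n. (?e g y l l + (\<Sum>j<n. cnj (g (k, j)) *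
          split_sum (\<lambda>u v. ?e g u l l * ((\<Sum>z<n. g (k, z) * ?e g v z j) / of_nat n)) y)) * ?t g xs
        + (\<Sum>j<n. cnj (g (k, j)) * ?e g y l j) * trace_prod_deriv m n \<sigma> k l xs g)"
        by (intro sum.cong refl F') auto
      then show ?thesis by (simp only: gen)
    qed
    also have "\<dots> = of_nat m * of_nat n * ?w g y * ?t g xs
       + of_nat n ^ 2 * split_sum (\<lambda>u v. ?w g u * ?w g (Wish # v)) y * ?t g xs + merge_sum y xs (?t g)"
      unfolding S1 S2 using pos by (simp only: sum_merge)
    finally have F': "(\<Sum>k<m. \<Sum>l<n. F' k l g) = of_nat m * of_nat n * ?w g y * ?t g xs
       + of_nat n ^ 2 * split_sum (\<lambda>u v. ?w g u * ?w g (Wish # v)) y * ?t g xs + merge_sum y xs (?t g)" .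
    have split: "split_sum (\<lambda>u v. ?t g (u # (Wish # v) # xs)) y
      = split_sum (\<lambda>u v. ?w g u * ?w g (Wish # v)) y * ?t g xs"
      by (simp only: split_sum_mult_right trace_prod_simps mult.assoc)
    show ?thesis
      unfolding F' split using pos by (simp add: field_simps power2_eq_square)
  qed
  have swap: "expectation (\<lambda>\<omega>. (\<Sum>k<m. \<Sum>l<n. h k l \<omega>) / of_nat n ^ 2)
      = (\<Sum>k<m. \<Sum>l<n. expectation (h k l)) / of_nat n ^ 2"
    if "\<And>k l. k < m \<Longrightarrow> l < n \<Longrightarrow> integrable P (h k l)" for h :: "nat \<Rightarrow> nat \<Rightarrow> 'w \<Rightarrow> complex"
  proof -
    have "expectation (\<lambda>\<omega>. \<Sum>k<m. \<Sum>l<n. h k l \<omega>) = (\<Sum>k<m. expectation (\<lambda>\<omega>. \<Sum>l<n. h k l \<omega>))"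
      using that by (intro Bochner_Integration.integral_sum Bochner_Integration.integrable_sum) auto
    also have "\<dots> = (\<Sum>k<m. \<Sum>l<n. expectation (h k l))"
      using that by (intro sum.cong refl Bochner_Integration.integral_sum) auto
    finally show ?thesis by simp
  qed
  have I: "(k, l) \<in> {..<m} \<times> {..<n}" if "k < m" "l < n" for k l using that by simp
  have "mean_trace \<sigma> ((Wish # y) # xs) = expectation (\<lambda>\<omega>. (\<Sum>k<m. \<Sum>l<n. Z \<omega> (k, l) * F k l (Z \<omega>)) / of_nat n ^ 2)"
    unfolding mean_trace_def left ..
  also have "\<dots> = (\<Sum>k<m. \<Sum>l<n. expectation (\<lambda>\<omega>. Z \<omega> (k, l) * F k l (Z \<omega>))) / of_nat n ^ 2"
    using wirtinger_by_parts(3)[OF FF' I] by (intro swap) auto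
  also have "\<dots> = (\<Sum>k<m. \<Sum>l<n. expectation (\<lambda>\<omega>. F' k l (Z \<omega>))) / of_nat n ^ 2"
    using wirtinger_by_parts(4)[OF FF' I] by simp
  also have "\<dots> = expectation (\<lambda>\<omega>. (\<Sum>k<m. \<Sum>l<n. F' k l (Z \<omega>)) / of_nat n ^ 2)"
    using wirtinger_by_parts(2)[OF FF' I] by (intro swap[symmetric]) auto
  also have "\<dots> = of_nat m / of_nat n * mean_trace \<sigma> (y # xs)
     + split_sum (\<lambda>u v. mean_trace \<sigma> (u # (Wish # v) # xs)) y
     + merge_sum y xs (mean_trace \<sigma>) / of_nat n ^ 2"
    unfolding right mean_trace_def
    using expectation_split_sum[of "\<lambda>u v \<omega>. ?t (Z \<omega>) (u # (Wish # v) # xs)" y, OF integrable_trace_prod]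
      expectation_merge_sum[of "\<lambda>zs \<omega>. ?t (Z \<omega>) zs" y xs, OF integrable_trace_prod]
      integrable_trace_prod[of \<sigma> "y # xs"]
    by (simp add: integral_add del: trace_prod_simps(2))
  finally show ?thesis .
qed

end

section \<open>Random permutations and convergence of the traces\<close>

definition int_funpow :: "(nat \<Rightarrow> nat) \<Rightarrow> int \<Rightarrow> nat \<Rightarrow> nat" where
  "int_funpow \<sigma> e = (if e \<ge> 0 then \<sigma> ^^ nat e else Hilbert_Choice.inv \<sigma> ^^ nat (- e))"

lemma int_funpow_step:
  assumes "bij \<sigma>"
  shows "\<sigma> (int_funpow \<sigma> e i) = int_funpow \<sigma> (1 + e) i"
    and "Hilbert_Choice.inv \<sigma> (int_funpow \<sigma> e i) = int_funpow \<sigma> (e - 1) i"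
proof -
  have s: "\<sigma> (Hilbert_Choice.inv \<sigma> k) = k" "Hilbert_Choice.inv \<sigma> (\<sigma> k) = k" for k
    using assms by (simp_all add: bij_is_surj surj_f_inv_f bij_is_inj)
  show "\<sigma> (int_funpow \<sigma> e i) = int_funpow \<sigma> (1 + e) i"
  proof (cases "e \<ge> 0")
    case True
    then have "nat (1 + e) = Suc (nat e)" by simp
    then show ?thesis using True by (simp add: int_funpow_def)
  next
    case False
    define k where "k = nat (- e) - 1"
    then have "e = - int (Suc k)" using False by simp
    then show ?thesis by (cases k) (simp_all add: int_funpow_def s nat_add_distrib)
  qed
  show "Hilbert_Choice.inv \<sigma> (int_funpow \<sigma> e i) = int_funpow \<sigma> (e - 1) i"
  proof (cases "e > 0")
    case True
    then have "nat e = Suc (nat (e - 1))" by simp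
    then show ?thesis using True by (simp add: int_funpow_def s)
  next
    case False
    then have "nat (- (e - 1)) = Suc (nat (- e))" by simp
    then show ?thesis using False by (simp add: int_funpow_def)
  qed
qed

lemma int_funpow_fixpoint:
  assumes "bij \<sigma>"
  shows "int_funpow \<sigma> e i = i \<longleftrightarrow> (\<sigma> ^^ nat \<bar>e\<bar>) i = i"
proof (cases "e \<ge> 0")
  case False
  have "(Hilbert_Choice.inv \<sigma> ^^ k) i = i \<longleftrightarrow> (\<sigma> ^^ k) i = i" for k
    using inv_fn[OF assms, of k] bij_inv_eq_iff[OF bij_fn[OF assms, of k], of i i] by metis
  then show ?thesis using False by (simp add: int_funpow_def)
qed (simp add: int_funpow_def)

lemma int_funpow_in:
  assumes "\<sigma> permutes {..<N}" "i < N"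
  shows "int_funpow \<sigma> e i < N"
proof -
  have "(\<tau> ^^ k) i < N" if "\<tau> permutes {..<N}" for \<tau> and k :: nat
    using assms(2) permutes_in_image[OF that] by (induction k) auto
  then show ?thesis
    using assms(1) permutes_inv[OF assms(1)] by (simp add: int_funpow_def)
qed

lemma entry_unitary:
  assumes "\<sigma> permutes {..<N}" "Wish \<notin> set x" "i < N" "j < N"
  shows "entry N \<sigma> w x i j = of_bool (i = int_funpow \<sigma> (exponent x) j)"
  using assms(2,3)
proof (induction x arbitrary: i)
  case Nil
  show ?case by (simp add: int_funpow_def)
next
  case (Cons a x)
  have bij: "bij \<sigma>" using assms(1) by (rule permutes_bij)
  define k where "k = int_funpow \<sigma> (exponent x) j"
  have k: "k < N" unfolding k_def using assms by (intro int_funpow_in)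
  have IH: "entry N \<sigma> w x l j = of_bool (l = k)" if "l < N" for l
    using Cons that by (simp add: k_def)
  have "entry N \<sigma> w (a # x) i j = (\<Sum>l<N. if l = k then letter_entry \<sigma> w a i l else 0)"
    unfolding entry.simps by (intro sum.cong) (auto simp: IH)
  also have "\<dots> = letter_entry \<sigma> w a i k" using k by simp
  also have "\<dots> = of_bool (i = int_funpow \<sigma> (exponent (a # x)) j)"
  proof (cases a)
    case Perm
    then show ?thesis using int_funpow_step(1)[OF bij, of "exponent x" j] by (simp add: k_def)
  next
    case PermInv
    have "k = \<sigma> i \<longleftrightarrow> i = Hilbert_Choice.inv \<sigma> k"
      using permutes_inv_eq[OF assms(1), of k i] by metis
    then show ?thesis using PermInv int_funpow_step(2)[OF bij, of "exponent x" j] by (simp add: k_def)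
  next
    case Wish
    then show ?thesis using Cons.prems by simp
  qed
  finally show ?case .
qed

lemma word_trace_unitary:
  assumes "\<sigma> permutes {..<N}" "Wish \<notin> set x"
  shows "word_trace N \<sigma> w x = of_nat (card {i\<in>{..<N}. (\<sigma> ^^ nat \<bar>exponent x\<bar>) i = i}) / of_nat N"
proof -
  have "(\<Sum>i<N. entry N \<sigma> w x i i) = (\<Sum>i<N. of_bool ((\<sigma> ^^ nat \<bar>exponent x\<bar>) i = i))"
  proof (intro sum.cong refl)
    fix i assume "i \<in> {..<N}"
    then have "entry N \<sigma> w x i i = of_bool (i = int_funpow \<sigma> (exponent x) i)"
      by (intro entry_unitary assms) auto
    also have "i = int_funpow \<sigma> (exponent x) i \<longleftrightarrow> (\<sigma> ^^ nat \<bar>exponent x\<bar>) i = i"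
      using int_funpow_fixpoint[OF permutes_bij[OF assms(1)], of "exponent x" i] by metis
    finally show "entry N \<sigma> w x i i = of_bool ((\<sigma> ^^ nat \<bar>exponent x\<bar>) i = i)" .
  qed
  then show ?thesis by (simp add: word_trace_def Int_def conj_commute)
qed

text \<open>A permutation with least period \<open>d\<close> at \<open>i\<close> and a point \<open>x\<close> off the cycle of \<open>i\<close> can be recovered
  from their product \<open>\<rho> = (i x) \<circ> \<sigma>\<close>, since \<open>x\<close> is the \<open>d\<close>-th iterate of \<open>\<rho>\<close> at \<open>i\<close>.\<close>

lemma card_least_period:
  assumes "i < N" "d > 0"
  shows "card {\<sigma>. \<sigma> permutes {..<N} \<and> (\<sigma> ^^ d) i = i \<and> (\<forall>j. 0 < j \<and> j < d \<longrightarrow> (\<sigma> ^^ j) i \<noteq> i)} * (N - d)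
    \<le> fact N" (is "card ?Q * _ \<le> _")
proof -
  define Q where "Q = ?Q"
  have Q: "\<sigma> permutes {..<N}" "(\<sigma> ^^ d) i = i" "\<And>j. 0 < j \<Longrightarrow> j < d \<Longrightarrow> (\<sigma> ^^ j) i \<noteq> i" if "\<sigma> \<in> Q" for \<sigma>
    using that by (auto simp: Q_def)
  define C where "C = (\<lambda>\<sigma>. {..<N} - (\<lambda>j. (\<sigma> ^^ j) i) ` {..<d})"
  have fin: "finite Q" unfolding Q_def by (rule finite_subset[OF _ finite_permutations[of "{..<N}"]]) auto
  have C: "N - d \<le> card (C \<sigma>)" for \<sigma>
  proof -
    have "card ((\<lambda>j. (\<sigma> ^^ j) i) ` {..<d}) \<le> d"
      using card_image_le[of "{..<d}" "\<lambda>j. (\<sigma> ^^ j) i"] by simp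
    then have "N - d \<le> card {..<N} - card ((\<lambda>j. (\<sigma> ^^ j) i) ` {..<d})" by simp
    also have "\<dots> \<le> card (C \<sigma>)" unfolding C_def by (rule diff_card_le_card_Diff) simp
    finally show ?thesis .
  qed
  have iter: "((Transposition.transpose i x \<circ> \<sigma>) ^^ d) i = x" if \<sigma>: "\<sigma> \<in> Q" and x: "x \<in> C \<sigma>" for \<sigma> x
  proof -
    \<comment> \<open>Before time \<open>d\<close> the orbit of \<open>i\<close> under
      \<open>\<sigma>\<close> avoids both points moved by the transposition: \<open>i\<close> since
      \<open>d\<close> is the least period, \<open>x\<close> since it lies off the cycle. At time
      \<open>d\<close> it returns to \<open>i\<close>, which the transposition sends to
      \<open>x\<close>.\<close>
    have step: "((Transposition.transpose i x \<circ> \<sigma>) ^^ j) i = (\<sigma> ^^ j) i" if "j < d" for j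
      using that
    proof (induction j)
      case (Suc j)
      have "(\<sigma> ^^ Suc j) i \<noteq> i" using Q(3)[OF \<sigma>] Suc.prems by blast
      moreover have "(\<sigma> ^^ Suc j) i \<noteq> x"
        using x Suc.prems imageI[of "Suc j" "{..<d}" "\<lambda>j. (\<sigma> ^^ j) i"] by (auto simp: C_def)
      ultimately show ?case using Suc by (simp add: Transposition.transpose_def)
    qed simp
    obtain d' where d': "d = Suc d'" using assms(2) by (cases d) auto
    have "\<sigma> ((\<sigma> ^^ d') i) = i" using Q(2)[OF \<sigma>] d' by simp
    then show ?thesis using step[of d'] by (simp add: d' Transposition.transpose_def)
  qed
  have "card Q * (N - d) \<le> (\<Sum>\<sigma>\<in>Q. card (C \<sigma>))"
    using sum_mono[of Q "\<lambda>_. N - d" "\<lambda>\<sigma>. card (C \<sigma>)", OF C] by simp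
  also have "\<dots> = card (Sigma Q C)"
    using fin by (simp add: C_def)
  also have "\<dots> \<le> card {\<rho>. \<rho> permutes {..<N}}"
  proof (rule card_inj_on_le[of "\<lambda>(\<sigma>, x). Transposition.transpose i x \<circ> \<sigma>"])
    show "inj_on (\<lambda>(\<sigma>, x). Transposition.transpose i x \<circ> \<sigma>) (Sigma Q C)"
    proof (rule inj_onI, clarify)
      fix \<sigma> x \<tau> y
      assume "\<sigma> \<in> Q" "x \<in> C \<sigma>" "\<tau> \<in> Q" "y \<in> C \<tau>"
        and eq: "Transposition.transpose i x \<circ> \<sigma> = Transposition.transpose i y \<circ> \<tau>"
      then have xy: "x = y" using iter[of \<sigma> x] iter[of \<tau> y] by metis
      have "\<sigma> k = \<tau> k" for k
        using fun_cong[OF eq, of k] xy by (simp add: inj_eq)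
      then show "\<sigma> = \<tau> \<and> x = y" using xy by auto
    qed
    show "(\<lambda>(\<sigma>, x). Transposition.transpose i x \<circ> \<sigma>) ` Sigma Q C \<subseteq> {\<rho>. \<rho> permutes {..<N}}"
    proof (rule image_subsetI)
      fix s assume "s \<in> Sigma Q C"
      then obtain \<sigma> x where s: "s = (\<sigma>, x)" "\<sigma> \<in> Q" "x \<in> C \<sigma>" by auto
      have "Transposition.transpose i x permutes {..<N}"
        using assms(1) s(3) by (intro permutes_swap_id) (auto simp: C_def)
      then show "(case s of (\<sigma>, x) \<Rightarrow> Transposition.transpose i x \<circ> \<sigma>) \<in> {\<rho>. \<rho> permutes {..<N}}"
        using permutes_compose[OF Q(1)[OF s(2)]] s(1) by simp
    qed
  qed (simp add: finite_permutations)
  also have "\<dots> = fact N" by (simp add: card_permutations)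
  finally show ?thesis unfolding Q_def .
qed

text \<open>The point has some least period \<open>d \<le> k\<close>, and each such \<open>d\<close>
  accounts for at most \<open>fact N / (N - d)\<close> permutations. Letting \<open>d\<close> run
  over all values up to \<open>k\<close> is crude but sufficient, as \<open>k\<close> is fixed while
  \<open>N\<close> grows.\<close>

lemma card_power_fixpoint:
  assumes "i < N" "0 < k" "k < N"
  shows "real (card {\<sigma>. \<sigma> permutes {..<N} \<and> (\<sigma> ^^ k) i = i}) \<le> real k * fact N / (real N - real k)"
proof -
  define Q where "Q = (\<lambda>d. {\<sigma>. \<sigma> permutes {..<N} \<and> (\<sigma> ^^ d) i = i \<and> (\<forall>j. 0 < j \<and> j < d \<longrightarrow> (\<sigma> ^^ j) i \<noteq> i)})"
  have finQ: "finite (Q d)" for d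
    unfolding Q_def by (rule finite_subset[OF _ finite_permutations[of "{..<N}"]]) auto
  have "{\<sigma>. \<sigma> permutes {..<N} \<and> (\<sigma> ^^ k) i = i} \<subseteq> (\<Union>d\<in>{1..k}. Q d)"
  proof clarify
    fix \<sigma> assume \<sigma>: "\<sigma> permutes {..<N}" "(\<sigma> ^^ k) i = i"
    define d where "d = (LEAST d. 0 < d \<and> (\<sigma> ^^ d) i = i)"
    have "0 < d \<and> (\<sigma> ^^ d) i = i" unfolding d_def by (rule LeastI[of _ k]) (use \<sigma> assms in auto)
    moreover have "d \<le> k" unfolding d_def by (rule Least_le) (use \<sigma> assms in auto)
    moreover have "(\<sigma> ^^ j) i \<noteq> i" if "0 < j" "j < d" for j
      using not_less_Least[of j "\<lambda>d. 0 < d \<and> (\<sigma> ^^ d) i = i"] that unfolding d_def by blast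
    ultimately show "\<sigma> \<in> (\<Union>d\<in>{1..k}. Q d)" using \<sigma> by (auto simp: Q_def intro!: bexI[of _ d])
  qed
  then have "card {\<sigma>. \<sigma> permutes {..<N} \<and> (\<sigma> ^^ k) i = i} \<le> card (\<Union>d\<in>{1..k}. Q d)"
    using finQ by (intro card_mono) auto
  also have "\<dots> \<le> (\<Sum>d\<in>{1..k}. card (Q d))" by (intro card_UN_le) simp
  finally have "real (card {\<sigma>. \<sigma> permutes {..<N} \<and> (\<sigma> ^^ k) i = i}) \<le> (\<Sum>d\<in>{1..k}. real (card (Q d)))"
    by (simp flip: of_nat_sum)
  also have "\<dots> \<le> (\<Sum>d\<in>{1..k}. fact N / (real N - real k))"
  proof (intro sum_mono)
    fix d assume d: "d \<in> {1..k}"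
    have "card (Q d) * (N - k) \<le> card (Q d) * (N - d)" using d by (intro mult_left_mono) auto
    also have "\<dots> \<le> fact N" unfolding Q_def using d assms by (intro card_least_period) auto
    finally have "real (card (Q d) * (N - k)) \<le> real (fact N)" by (rule of_nat_mono)
    then show "real (card (Q d)) \<le> fact N / (real N - real k)"
      using assms by (simp add: pos_le_divide_eq of_nat_diff)
  qed
  finally show ?thesis by simp
qed

lemma sum_card_power_fixpoints:
  assumes "0 < k" "k < N"
  shows "(\<Sum>\<sigma> | \<sigma> permutes {..<N}. real (card {i\<in>{..<N}. (\<sigma> ^^ k) i = i}))
    \<le> real N * (real k * fact N / (real N - real k))"
proof -
  have "(\<Sum>\<sigma> | \<sigma> permutes {..<N}. real (card {i\<in>{..<N}. (\<sigma> ^^ k) i = i}))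
    = (\<Sum>\<sigma> | \<sigma> permutes {..<N}. \<Sum>i<N. of_bool ((\<sigma> ^^ k) i = i))"
    by (intro sum.cong) (auto simp: Int_def conj_commute)
  also have "\<dots> = (\<Sum>i<N. \<Sum>\<sigma> | \<sigma> permutes {..<N}. of_bool ((\<sigma> ^^ k) i = i))"
    by (rule sum.swap)
  also have "\<dots> = (\<Sum>i<N. real (card {\<sigma>. \<sigma> permutes {..<N} \<and> (\<sigma> ^^ k) i = i}))"
    by (intro sum.cong) (auto simp: Int_def finite_permutations)
  also have "\<dots> \<le> (\<Sum>i<N. real k * fact N / (real N - real k))"
    using assms by (intro sum_mono card_power_fixpoint) auto
  finally show ?thesis by simp
qed

section \<open>Averaging over the symmetric group\<close>

lemma merge_sum_linear:
  "merge_sum y xs (\<lambda>zs. \<Sum>q\<in>Q. c * f q zs) = (\<Sum>q\<in>Q. c * merge_sum y xs (f q))"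
  by (induction xs arbitrary: f)
    (auto simp: split_sum_sum split_sum_mult_left sum.distrib distrib_left)

context gaussian_matrix
begin

text \<open>A finite sum over the symmetric group replaces the random permutation, so all Gaussian
  computations are done at fixed \<open>\<sigma>\<close>. The independence of the two matrices
  enters only in \<open>expectation_norm_trace\<close>.\<close>

definition average_trace :: "letter list list \<Rightarrow> complex" where
  "average_trace xs = (\<Sum>\<sigma> | \<sigma> permutes {..<n}. (1 / fact n) * mean_trace \<sigma> xs)"

lemma average_trace_cong:
  assumes "\<And>\<sigma> g. trace_prod n \<sigma> (gram m n g) xs = trace_prod n \<sigma> (gram m n g) ys"
  shows "average_trace xs = average_trace ys"
  by (simp add: average_trace_def mean_trace_def assms)

lemma average_schwinger_dyson:
  "average_trace ((Wish # y) # xs) = of_nat m / of_nat n * average_trace (y # xs)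
     + split_sum (\<lambda>u v. average_trace (u # (Wish # v) # xs)) y
     + merge_sum y xs average_trace / of_nat n ^ 2"
  unfolding average_trace_def schwinger_dyson merge_sum_linear split_sum_sum split_sum_mult_left
  by (simp only: distrib_left sum.distrib sum_distrib_left sum_divide_distrib times_divide_eq_right
      mult.left_commute[of "1 / fact n"])

text \<open>On words without \<open>Wish\<close> the product of traces does not depend on the
  Gaussian variables: it is a product of fractions of fixed points. As these lie between 0 and 1, a
  single word of nonzero exponent bounds the whole product by its own average, and no joint
  information on several powers is required.\<close>

lemma average_trace_unitary:
  assumes "\<And>x. x \<in> set xs \<Longrightarrow> Wish \<notin> set x"
  shows "(\<And>x. x \<in> set xs \<Longrightarrow> exponent x = 0) \<Longrightarrow> average_trace xs = 1"
    and "x \<in> set xs \<Longrightarrow> exponent x \<noteq> 0 \<Longrightarrow> nat \<bar>exponent x\<bar> < n \<Longrightarrow>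
      norm (average_trace xs) \<le> real (nat \<bar>exponent x\<bar>) / (real n - real (nat \<bar>exponent x\<bar>))"
proof -
  define t where "t = (\<lambda>\<sigma> x. real (card {i\<in>{..<n}. (\<sigma> ^^ nat \<bar>exponent x\<bar>) i = i}) / real n)"
  have t: "word_trace n \<sigma> w x = of_real (t \<sigma> x)" if "\<sigma> permutes {..<n}" "x \<in> set xs" for \<sigma> w x
    using word_trace_unitary[OF that(1) assms[OF that(2)]] by (simp add: t_def)
  have tp: "trace_prod n \<sigma> w xs = of_real (\<Prod>x\<leftarrow>xs. t \<sigma> x)" if "\<sigma> permutes {..<n}" for \<sigma> w
    using t[OF that] by (induction xs) (auto simp: trace_prod_def)
  have mean: "mean_trace \<sigma> xs = of_real (\<Prod>x\<leftarrow>xs. t \<sigma> x)" if "\<sigma> permutes {..<n}" for \<sigma>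
    unfolding mean_trace_def tp[OF that] by (simp add: prob_space)
  have avg: "average_trace xs = of_real (\<Sum>\<sigma> | \<sigma> permutes {..<n}. (1 / fact n) * (\<Prod>x\<leftarrow>xs. t \<sigma> x))"
    unfolding average_trace_def by (simp add: mean)
  have t01: "0 \<le> t \<sigma> x" "t \<sigma> x \<le> 1" for \<sigma> x
    using card_mono[of "{..<n}" "{i\<in>{..<n}. (\<sigma> ^^ nat \<bar>exponent x\<bar>) i = i}"] pos
    by (auto simp: t_def divide_le_eq)
  show "average_trace xs = 1" if z: "\<And>x. x \<in> set xs \<Longrightarrow> exponent x = 0"
  proof -
    have "t \<sigma> x = 1" if "x \<in> set xs" for \<sigma> x
      using z[OF that] pos by (simp add: t_def)
    then have "(\<Prod>x\<leftarrow>xs. t \<sigma> x) = 1" for \<sigma>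
      by (induction xs) auto
    then show ?thesis unfolding avg by (simp add: card_permutations)
  qed
  show "norm (average_trace xs) \<le> real (nat \<bar>exponent x\<bar>) / (real n - real (nat \<bar>exponent x\<bar>))"
    if x: "x \<in> set xs" "exponent x \<noteq> 0" "nat \<bar>exponent x\<bar> < n"
  proof -
    have p0: "0 \<le> (\<Prod>x\<leftarrow>ys. t \<sigma> x) \<and> (\<Prod>x\<leftarrow>ys. t \<sigma> x) \<le> 1" for \<sigma> ys
      using t01 by (induction ys) (auto intro: mult_le_one)
    have le: "(\<Prod>x\<leftarrow>xs. t \<sigma> x) \<le> t \<sigma> x" for \<sigma>
    proof -
      obtain ys zs where "xs = ys @ x # zs" using x(1) by (meson split_list)
      then have "(\<Prod>x\<leftarrow>xs. t \<sigma> x) = t \<sigma> x * (\<Prod>x\<leftarrow>ys @ zs. t \<sigma> x)" by simp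
      also have "\<dots> \<le> t \<sigma> x * 1" using p0[of \<sigma> "ys @ zs"] t01 by (intro mult_left_mono) auto
      finally show ?thesis by simp
    qed
    have "norm (average_trace xs) = (\<Sum>\<sigma> | \<sigma> permutes {..<n}. (1 / fact n) * (\<Prod>x\<leftarrow>xs. t \<sigma> x))"
      unfolding avg norm_of_real using p0 by (intro abs_of_nonneg sum_nonneg mult_nonneg_nonneg) auto
    also have "\<dots> \<le> (\<Sum>\<sigma> | \<sigma> permutes {..<n}. (1 / fact n) * t \<sigma> x)"
      by (intro sum_mono mult_left_mono le) auto
    also have "\<dots> = (\<Sum>\<sigma> | \<sigma> permutes {..<n}. real (card {i\<in>{..<n}. (\<sigma> ^^ nat \<bar>exponent x\<bar>) i = i})) / (fact n * real n)"
      by (simp add: t_def sum_divide_distrib)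
    also have "\<dots> \<le> (real n * (real (nat \<bar>exponent x\<bar>) * fact n / (real n - real (nat \<bar>exponent x\<bar>)))) / (fact n * real n)"
      using x by (intro divide_right_mono sum_card_power_fixpoints) auto
    also have "\<dots> = real (nat \<bar>exponent x\<bar>) / (real n - real (nat \<bar>exponent x\<bar>))"
      using pos by simp
    finally show ?thesis .
  qed
qed

end

section \<open>Passage to the limit\<close>

lemma tendsto_split_sum:
  fixes f :: "nat \<Rightarrow> letter list \<Rightarrow> letter list \<Rightarrow> complex"
  assumes "\<And>u v. x = u @ Wish # v \<Longrightarrow> (\<lambda>q. f q u v) \<longlonglongrightarrow> l u v"
  shows "(\<lambda>q. split_sum (f q) x) \<longlonglongrightarrow> split_sum l x"
  using assms
proof (induction x arbitrary: f l)
  case (Cons a x)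
  have "(\<lambda>q. split_sum (\<lambda>u v. f q (a # u) v) x) \<longlonglongrightarrow> split_sum (\<lambda>u v. l (a # u) v) x"
    by (intro Cons.IH) (auto intro: Cons.prems)
  moreover have "(\<lambda>q. if a = Wish then f q [] x else 0) \<longlonglongrightarrow> (if a = Wish then l [] x else 0)"
    using Cons.prems[of "[]" x] by auto
  ultimately show ?case by (auto intro: tendsto_add)
qed simp

definition count_W :: "letter list list \<Rightarrow> nat" where
  "count_W xs = (\<Sum>x\<leftarrow>xs. count_list x Wish)"

lemma count_W_simps [simp]:
  "count_W [] = 0" "count_W (x # xs) = count_list x Wish + count_W xs" "count_W (xs @ ys) = count_W xs + count_W ys"
  by (auto simp: count_W_def)

lemma tendsto_merge_sum:
  assumes "\<And>zs. count_W zs = count_list y Wish + count_W xs \<Longrightarrow> (\<lambda>q. f q zs) \<longlonglongrightarrow> l zs"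
  shows "(\<lambda>q. merge_sum y xs (f q)) \<longlonglongrightarrow> merge_sum y xs l"
  using assms
proof (induction xs arbitrary: f l)
  case (Cons x xs)
  have "(\<lambda>q. merge_sum y xs (\<lambda>zs. f q (zs @ [x]))) \<longlonglongrightarrow> merge_sum y xs (\<lambda>zs. l (zs @ [x]))"
    by (intro Cons.IH) (auto intro!: Cons.prems)
  moreover have "(\<lambda>q. split_sum (\<lambda>u v. f q ((Wish # v @ u @ y) # xs)) x)
      \<longlonglongrightarrow> split_sum (\<lambda>u v. l ((Wish # v @ u @ y) # xs)) x"
    by (intro tendsto_split_sum Cons.prems) auto
  ultimately show ?case by (auto intro: tendsto_add)
qed simp

text \<open>The total number of \<open>Wish\<close> drops by one in each term of the equation, the
  merged ones included, and serves as induction measure. The other traces \<open>r\<close> change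
  only in \<open>merge_sum\<close>, which is negligible, so the recursion acts on one factor of the
  product; this yields factorisation without a variance estimate.\<close>

theorem average_trace_tendsto:
  assumes model: "\<And>q. gaussian_matrix (P q) (m q) (n q) (Z q)"
    and n: "filterlim n at_top sequentially"
    and ratio: "(\<lambda>q. real (m q) / real (n q)) \<longlonglongrightarrow> c"
  shows "(\<lambda>q. gaussian_matrix.average_trace (P q) (m q) (n q) (Z q) xs)
    \<longlonglongrightarrow> (\<Prod>x\<leftarrow>xs. limit_trace c x)"
proof (induction "count_W xs" arbitrary: xs rule: less_induct)
  case (less xs)
  define e where "e q = gaussian_matrix.average_trace (P q) (m q) (n q) (Z q)" for q
  note cong = gaussian_matrix.average_trace_cong[OF model, folded e_def]
  note sd = gaussian_matrix.average_schwinger_dyson[OF model, folded e_def]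
  note IH = less[folded e_def]
  have n_real: "filterlim (\<lambda>q. real (n q)) at_top sequentially"
    using n by (rule filterlim_compose[OF filterlim_real_sequentially])
  show ?case
    unfolding e_def[symmetric]
  proof (cases "\<exists>x\<in>set xs. Wish \<in> set x")
    case False
    then have noW: "\<And>x. x \<in> set xs \<Longrightarrow> Wish \<notin> set x" by blast
    have lim: "(\<Prod>x\<leftarrow>xs. limit_trace c x) = of_bool (\<forall>x\<in>set xs. exponent x = 0)"
      using noW by (induction xs) (auto simp: limit_trace_unitary)
    show "(\<lambda>q. e q xs) \<longlonglongrightarrow> (\<Prod>x\<leftarrow>xs. limit_trace c x)"
    proof (cases "\<forall>x\<in>set xs. exponent x = 0")
      case True
      then have "e q xs = 1" for q
        unfolding e_def using gaussian_matrix.average_trace_unitary(1)[OF model noW] by blast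
      then show ?thesis using True by (simp add: lim)
    next
      case False
      then obtain x where x: "x \<in> set xs" "exponent x \<noteq> 0" by blast
      define k where "k = nat \<bar>exponent x\<bar>"
      have "eventually (\<lambda>q. k < n q) sequentially"
        using n eventually_gt_at_top[of k] by (simp add: filterlim_iff)
      then have "eventually (\<lambda>q. norm (e q xs) \<le> real k / (real (n q) - real k)) sequentially"
      proof eventually_elim
        case (elim q)
        then show ?case
          unfolding e_def k_def using gaussian_matrix.average_trace_unitary(2)[OF model noW x] by blast
      qed
      moreover have "(\<lambda>q. real k / (real (n q) - real k)) \<longlonglongrightarrow> 0"
      proof (rule tendsto_divide_0[OF tendsto_const])
        have "filterlim (\<lambda>q. - real k + real (n q)) at_top sequentially"
          by (rule filterlim_tendsto_add_at_top[OF tendsto_const n_real])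
        then show "filterlim (\<lambda>q. real (n q) - real k) at_infinity sequentially"
          by (intro filterlim_at_top_imp_at_infinity) simp
      qed
      ultimately have "(\<lambda>q. e q xs) \<longlonglongrightarrow> 0" by (rule Lim_null_comparison)
      then show ?thesis by (simp only: lim False of_bool_eq)
    qed
  next
    case True
    then obtain x where x: "x \<in> set xs" "Wish \<in> set x" by blast
    then obtain ys zs where xs: "xs = ys @ x # zs" by (meson split_list)
    obtain p y where px: "x = p @ Wish # y" and p: "Wish \<notin> set p" using x(2) by (meson split_list_first)
    define r where "r = ys @ zs"
    let ?t = "limit_trace c" and ?R = "\<Prod>x\<leftarrow>r. limit_trace c x"
    have p0: "count_list p Wish = 0" using p by (simp add: count_list_0_iff)
    \<comment> \<open>At finite size traces are exactly cyclic: the first \<open>Wish\<close> of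
      \<open>x\<close> is moved to the front of its word, and in the resulting terms the prefix
      \<open>p\<close> is moved back to the place it has in \<open>limit_trace\<close>.\<close>
    have "e q xs = e q ((Wish # y @ p) # r)" for q
    proof (rule cong)
      fix \<sigma> g
      show "trace_prod (n q) \<sigma> (gram (m q) (n q) g) xs = trace_prod (n q) \<sigma> (gram (m q) (n q) g) ((Wish # y @ p) # r)"
        using word_trace_commute[of "n q" \<sigma> "gram (m q) (n q) g" p "Wish # y"]
        by (simp add: xs r_def px)
    qed
    moreover have "e q ((y @ p) # r) = e q ((p @ y) # r)" for q
      by (rule cong) (simp add: word_trace_commute[of _ _ _ y p])
    moreover have "e q (u # (Wish # v @ p) # r) = e q (u # (p @ Wish # v) # r)" for q u v
    proof (rule cong)
      fix \<sigma> g
      show "trace_prod (n q) \<sigma> (gram (m q) (n q) g) (u # (Wish # v @ p) # r)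
          = trace_prod (n q) \<sigma> (gram (m q) (n q) g) (u # (p @ Wish # v) # r)"
        using word_trace_commute[of "n q" \<sigma> "gram (m q) (n q) g" p "Wish # v"] by simp
    qed
    ultimately have eq: "e q xs = of_real (real (m q) / real (n q)) * e q ((p @ y) # r)
        + split_sum (\<lambda>u v. e q (u # (p @ Wish # v) # r)) y
        + merge_sum (y @ p) r (e q) * of_real ((1 / real (n q)) ^ 2)" for q
      using split_sum_no_W[OF p] by (simp add: sd split_sum_append power_divide)
    have small: "count_W xs = Suc (count_list y Wish + count_W r)"
      by (simp add: xs px r_def p0)
    \<comment> \<open>The merged terms converge by the induction hypothesis as well; the scalar
      behind them is what tends to 0. The limit is left unsimplified to match the summands of
      \<open>eq\<close>.\<close>
    have "(\<lambda>q. e q xs) \<longlonglongrightarrow> of_real c * (?t (p @ y) * ?R)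
        + split_sum (\<lambda>u v. ?t u * (?t (p @ Wish # v) * ?R)) y
        + merge_sum (y @ p) r (\<lambda>zs. \<Prod>x\<leftarrow>zs. ?t x) * of_real (0 ^ 2)"
      unfolding eq
    proof (intro tendsto_add tendsto_mult tendsto_of_real tendsto_power ratio tendsto_split_sum tendsto_merge_sum)
      show "(\<lambda>q. e q ((p @ y) # r)) \<longlonglongrightarrow> ?t (p @ y) * ?R"
        using IH[of "(p @ y) # r"] small p0 by simp
      show "(\<lambda>q. e q (u # (p @ Wish # v) # r)) \<longlonglongrightarrow> ?t u * (?t (p @ Wish # v) * ?R)" if "y = u @ Wish # v" for u v
        using IH[of "u # (p @ Wish # v) # r"] small p0 that by simp
      show "(\<lambda>q. e q zs) \<longlonglongrightarrow> (\<Prod>x\<leftarrow>zs. ?t x)" if "count_W zs = count_list (y @ p) Wish + count_W r" for zs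
        using IH[of zs] small p0 that by simp
      show "(\<lambda>q. 1 / real (n q)) \<longlonglongrightarrow> 0"
        using n_real by (intro tendsto_divide_0[OF tendsto_const] filterlim_at_top_imp_at_infinity)
    qed
    also have "of_real c * (?t (p @ y) * ?R) + split_sum (\<lambda>u v. ?t u * (?t (p @ Wish # v) * ?R)) y
        + merge_sum (y @ p) r (\<lambda>zs. \<Prod>x\<leftarrow>zs. ?t x) * of_real (0 ^ 2) = ?t x * ?R"
      by (simp add: px limit_trace_W[OF p, of c y] distrib_right split_sum_mult_right mult.assoc)
    also have "?t x * ?R = (\<Prod>x\<leftarrow>xs. ?t x)" by (simp add: xs r_def mult_ac)
    finally show "(\<lambda>q. e q xs) \<longlonglongrightarrow> (\<Prod>x\<leftarrow>xs. limit_trace c x)" .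
  qed
qed

section \<open>The matrix model\<close>

lemma mat_adjoint_carrier: "A \<in> carrier_mat m n \<Longrightarrow> mat_adjoint A \<in> carrier_mat n m"
  by (auto simp: mat_adjoint_def intro!: carrier_matI)

lemma mat_adjoint_index:
  fixes A :: "complex mat"
  assumes "A \<in> carrier_mat m n" "i < n" "j < m"
  shows "mat_adjoint A $$ (i, j) = cnj (A $$ (j, i))"
  using assms by (simp add: mat_adjoint_def mat_of_rows_def)

lemma wishart_carrier: "g \<in> carrier_mat m n \<Longrightarrow> wishart n g \<in> carrier_mat n n"
  by (auto simp: wishart_def mat_adjoint_def)

lemma wishart_index:
  assumes "g \<in> carrier_mat m n" "i < n" "j < n"
  shows "wishart n g $$ (i, j) = gram m n (\<lambda>e. g $$ e) i j"
proof -
  have "(mat_adjoint g * g) $$ (i, j) = (\<Sum>k<m. cnj (g $$ (k, i)) * g $$ (k, j))"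
    using assms mat_adjoint_carrier[OF assms(1)]
    by (auto simp: scalar_prod_def mat_adjoint_index[OF assms(1)] atLeast0LessThan intro!: sum.cong)
  then show ?thesis
    using assms mat_adjoint_carrier[OF assms(1)] by (simp add: wishart_def gram_def)
qed

lemma gram_hermitian: "gram m n g i j = cnj (gram m n g j i)"
  by (simp add: gram_def mult.commute)

definition perm_mat :: "nat \<Rightarrow> (nat \<Rightarrow> nat) \<Rightarrow> complex mat" where
  "perm_mat n \<sigma> = Matrix.mat n n (\<lambda>(i, j). if i = \<sigma> j then 1 else 0)"

lemma perm_mat_inj: "inj_on (perm_mat n) {\<sigma>. \<sigma> permutes {..<n}}"
proof (rule inj_onI, rule ext)
  fix \<sigma> \<tau> j
  assume *: "\<sigma> \<in> {\<sigma>. \<sigma> permutes {..<n}}" "\<tau> \<in> {\<sigma>. \<sigma> permutes {..<n}}" "perm_mat n \<sigma> = perm_mat n \<tau>"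
  show "\<sigma> j = \<tau> j"
  proof (cases "j < n")
    case True
    then have "\<sigma> j < n" using * permutes_in_image[of \<sigma> "{..<n}" j] by simp
    then have "perm_mat n \<sigma> $$ (\<sigma> j, j) = 1" "perm_mat n \<tau> $$ (\<sigma> j, j) = (if \<sigma> j = \<tau> j then 1 else 0)"
      using True by (simp_all add: perm_mat_def)
    then show ?thesis using *(3) by (metis zero_neq_one)
  next
    case False
    then show ?thesis using * permutes_not_in[of \<sigma> "{..<n}" j] permutes_not_in[of \<tau> "{..<n}" j] by simp
  qed
qed

lemma permutation_matrices_eq: "permutation_matrices n = perm_mat n ` {\<sigma>. \<sigma> permutes {..<n}}"
  by (auto simp: permutation_matrices_def perm_mat_def)

lemma card_permutation_matrices: "card (permutation_matrices n) = fact n"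
  by (simp add: permutation_matrices_eq card_image[OF perm_mat_inj] card_permutations)

lemma mat_word_entry:
  assumes w: "w \<in> carrier_mat n n" "\<And>i j. i < n \<Longrightarrow> j < n \<Longrightarrow> w $$ (i, j) = f i j"
    and herm: "\<And>i j. f i j = cnj (f j i)"
    and \<sigma>: "\<sigma> permutes {..<n}"
  shows "mat_word n (perm_mat n \<sigma> * w) es \<in> carrier_mat n n"
    and "i < n \<Longrightarrow> j < n \<Longrightarrow> mat_word n (perm_mat n \<sigma> * w) es $$ (i, j) = entry n \<sigma> f (word es) i j"
proof -
  let ?A = "perm_mat n \<sigma> * w"
  have A: "?A \<in> carrier_mat n n" using w by (intro mult_carrier_mat[of _ n n]) (auto simp: perm_mat_def)
  have Ai: "?A $$ (i, j) = (\<Sum>q<n. of_bool (i = \<sigma> q) * f q j)" if "i < n" "j < n" for i j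
  proof -
    have "?A $$ (i, j) = (\<Sum>q\<in>{0..<n}. perm_mat n \<sigma> $$ (i, q) * w $$ (q, j))"
      using that w(1) by (simp add: scalar_prod_def perm_mat_def)
    also have "\<dots> = (\<Sum>q<n. of_bool (i = \<sigma> q) * f q j)"
    proof (rule sum.cong)
      fix q assume "q \<in> {..<n}"
      then show "perm_mat n \<sigma> $$ (i, q) * w $$ (q, j) = of_bool (i = \<sigma> q) * f q j"
        using that w(2)[of q j] by (simp add: perm_mat_def)
    qed (simp add: atLeast0LessThan)
    finally show ?thesis .
  qed
  have star_carrier: "mat_star_power ?A e \<in> carrier_mat n n" for e
    using A mat_adjoint_carrier[OF A] by (cases e) simp_all
  have single: "(\<Sum>r<n. f q r * of_bool (r = l)) = f q l" "(\<Sum>r<n. of_bool (r = s) * of_bool (r = l)) = (of_bool (l = s) :: complex)"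
    if "l < n" for q l s
  proof -
    have "(\<Sum>r<n. f q r * of_bool (r = l)) = (\<Sum>r<n. if r = l then f q r else 0)"
      by (intro sum.cong) auto
    then show "(\<Sum>r<n. f q r * of_bool (r = l)) = f q l" using that by simp
    have "(\<Sum>r<n. of_bool (r = s) * of_bool (r = l)) = (\<Sum>r<n. if r = l then of_bool (l = s) else (0::complex))"
      by (intro sum.cong) auto
    then show "(\<Sum>r<n. of_bool (r = s) * of_bool (r = l)) = (of_bool (l = s) :: complex)" using that by simp
  qed
  have star_entry: "mat_star_power ?A e $$ (i, l) = entry n \<sigma> f (letters e) i l" if "i < n" "l < n" for e i l
  proof (cases e)
    case Plain
    then show ?thesis using that by (simp add: Ai single)
  next
    case Star
    \<comment> \<open>The Hermitian symmetry of \<open>f\<close> absorbs the conjugation; the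
      remaining indicator \<open>l = \<sigma> q\<close> is the entry \<open>(q, l)\<close> of
      \<open>PermInv\<close>.\<close>
    have "mat_adjoint ?A $$ (i, l) = (\<Sum>q<n. of_bool (l = \<sigma> q) * f i q)"
      unfolding mat_adjoint_index[OF A that] Ai[OF that(2,1)] using herm[of i] by simp
    also have "\<dots> = (\<Sum>q<n. f i q * of_bool (l = \<sigma> q))" by (simp only: mult.commute)
    also have "\<dots> = entry n \<sigma> f (letters Star) i l"
      by (simp only: letters.simps entry.simps letter_entry.simps single(2)[OF that(2)])
    finally show ?thesis using Star by simp
  qed
  have "mat_word n ?A es \<in> carrier_mat n n \<and>
    (\<forall>i<n. \<forall>j<n. mat_word n ?A es $$ (i, j) = entry n \<sigma> f (word es) i j)"
  proof (induction es)
    case Nil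
    show ?case by (simp add: mat_word_def)
  next
    case (Cons e es)
    have eq: "mat_word n ?A (e # es) = mat_star_power ?A e * mat_word n ?A es"
      by (simp add: mat_word_def)
    have "mat_word n ?A (e # es) $$ (i, j) = entry n \<sigma> f (word (e # es)) i j" if "i < n" "j < n" for i j
    proof -
      have "mat_word n ?A (e # es) $$ (i, j) = (\<Sum>l<n. mat_star_power ?A e $$ (i, l) * mat_word n ?A es $$ (l, j))"
        unfolding eq using that star_carrier[of e] Cons
        by (auto simp: scalar_prod_def atLeast0LessThan intro!: sum.cong)
      also have "\<dots> = (\<Sum>l<n. entry n \<sigma> f (letters e) i l * entry n \<sigma> f (word es) l j)"
        using that Cons by (intro sum.cong refl) (simp add: star_entry)
      finally show ?thesis using that by (simp add: entry_append)
    qed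
    moreover have "mat_word n ?A (e # es) \<in> carrier_mat n n"
      unfolding eq using star_carrier Cons by (intro mult_carrier_mat) auto
    ultimately show ?case by blast
  qed
  then show "mat_word n ?A es \<in> carrier_mat n n"
    "i < n \<Longrightarrow> j < n \<Longrightarrow> mat_word n ?A es $$ (i, j) = entry n \<sigma> f (word es) i j"
    by blast+
qed

lemma entry_cong:
  assumes "\<And>i j. i < n \<Longrightarrow> j < n \<Longrightarrow> f i j = f' i j" "i < n"
  shows "entry n \<sigma> f x i j = entry n \<sigma> f' x i j"
  using assms(2)
proof (induction x arbitrary: i)
  case (Cons a x)
  have "letter_entry \<sigma> f a i l = letter_entry \<sigma> f' a i l" if "l < n" for l
    using assms(1) Cons.prems that by (cases a) auto
  then show ?case using Cons.IH by (auto intro!: sum.cong)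
qed simp

lemma word_trace_cong:
  assumes "\<And>i j. i < n \<Longrightarrow> j < n \<Longrightarrow> f i j = f' i j"
  shows "word_trace n \<sigma> f x = word_trace n \<sigma> f' x"
  unfolding word_trace_def using entry_cong[of n f f'] assms by simp

lemma measurable_word_trace:
  "(\<lambda>v. word_trace n \<sigma> (\<lambda>i j. v (i, j)) x) \<in> borel_measurable (PiM ({..<n} \<times> {..<n}) (\<lambda>_. borel))"
proof -
  have "(\<lambda>v. entry n \<sigma> (\<lambda>i j. v (i, j)) x i j) \<in> borel_measurable (PiM ({..<n} \<times> {..<n}) (\<lambda>_. borel))"
    if "i < n" "j < n" for i j
    using that
  proof (induction x arbitrary: i)
    case (Cons a x)
    have "(\<lambda>v. letter_entry \<sigma> (\<lambda>i j. v (i, j)) a i l) \<in> borel_measurable (PiM ({..<n} \<times> {..<n}) (\<lambda>_. borel))"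
      if "l < n" for l
      using Cons.prems that by (cases a) (auto intro: measurable_component_singleton)
    then show ?case using Cons.IH Cons.prems(2)
      by (auto intro!: borel_measurable_sum borel_measurable_times)
  qed simp
  then show ?thesis
    unfolding word_trace_def by (intro borel_measurable_divide borel_measurable_sum) auto
qed

text \<open>This singles out one permutation matrix among the entry vectors. Writing the indicator
  as a product over the entries makes measurability a componentwise matter.\<close>

lemma measurable_eq_indicator:
  assumes "finite I"
  shows "(\<lambda>v. of_bool (\<forall>e\<in>I. v e = (b e :: complex)) :: complex) \<in> borel_measurable (PiM I (\<lambda>_. borel))"
proof -
  have "(\<lambda>v. \<Prod>e\<in>I. (if v e = b e then 1 else 0) :: complex) \<in> borel_measurable (PiM I (\<lambda>_. borel))"
    by measurable
  moreover have "(\<Prod>e\<in>I. (if v e = b e then 1 else 0) :: complex) = of_bool (\<forall>e\<in>I. v e = b e)" for v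
    using assms by (induction I rule: finite_induct) auto
  ultimately show ?thesis by simp
qed

text \<open>The trace is decomposed by the value of the permutation matrix, as a sum over
  \<open>\<sigma>\<close> of the indicator of that value times the trace of the word at fixed
  \<open>\<sigma>\<close>. By independence each summand has expectation \<open>1 / fact n\<close>
  times \<open>mean_trace\<close>.\<close>

theorem expectation_norm_trace:
  fixes P :: "nat \<Rightarrow> nat \<Rightarrow> 'w measure" and G U :: "nat \<Rightarrow> nat \<Rightarrow> 'w \<Rightarrow> complex mat"
  assumes model: "permuted_wishart_model P G U" and pos: "m \<ge> 1" "n \<ge> 1"
  shows "gaussian_matrix (P m n) m n (\<lambda>\<omega> e. G m n \<omega> $$ e)"
    and "integral\<^sup>L (P m n) (\<lambda>\<omega>. norm_trace (mat_word n (U m n \<omega> * wishart n (G m n \<omega>)) es))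
      = gaussian_matrix.average_trace (P m n) m n (\<lambda>\<omega> e. G m n \<omega> $$ e) [word es]"
proof -
  define p where "p = P m n"
  define g where "g = G m n"
  define u where "u = U m n"
  let ?I = "{..<n} \<times> {..<n}"
  have ps: "prob_space p" and cgm: "complex_gaussian_matrix p m n g"
    and up: "uniform_permutation_matrix p n u"
    and ind: "indep_random_matrices p n n u (\<lambda>\<omega>. wishart n (g \<omega>))"
    using model pos unfolding permuted_wishart_model_def p_def g_def u_def by blast+
  interpret prob_space p by (rule ps)
  have g: "g \<omega> \<in> carrier_mat m n" if "\<omega> \<in> space p" for \<omega>
    using cgm that by (auto simp: complex_gaussian_matrix_def)
  have gm: "gaussian_matrix p m n (\<lambda>\<omega> e. g \<omega> $$ e)"
  proof
    show "indep_vars (\<lambda>_. borel) (\<lambda>i \<omega>. g \<omega> $$ i) ({..<m} \<times> {..<n})"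
      using cgm by (simp add: complex_gaussian_matrix_def)
    show "standard_complex_gaussian p (\<lambda>\<omega>. g \<omega> $$ i)" if "i \<in> {..<m} \<times> {..<n}" for i
      using cgm that by (auto simp: complex_gaussian_matrix_def)
  qed (use pos in auto)
  then show "gaussian_matrix (P m n) m n (\<lambda>\<omega> e. G m n \<omega> $$ e)" by (simp add: p_def g_def)
  interpret gaussian_matrix p m n "\<lambda>\<omega> e. g \<omega> $$ e" by (rule gm)
  define X where "X = (\<lambda>\<omega>. \<lambda>ij\<in>?I. u \<omega> $$ ij)"
  define Y where "Y = (\<lambda>\<omega>. \<lambda>ij\<in>?I. wishart n (g \<omega>) $$ ij)"
  have XY: "indep_var (PiM ?I (\<lambda>_. borel)) X (PiM ?I (\<lambda>_. borel)) Y"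
    using ind by (simp add: indep_random_matrices_def X_def Y_def)
  have u_meas: "u \<in> measurable p (count_space (permutation_matrices n))"
    and u_distr: "distr p (count_space (permutation_matrices n)) u = uniform_count_measure (permutation_matrices n)"
    using up by (auto simp: uniform_permutation_matrix_def)
  have u_in: "u \<omega> \<in> permutation_matrices n" if "\<omega> \<in> space p" for \<omega>
    using measurable_space[OF u_meas that] by simp
  have fin: "finite (permutation_matrices n)"
    by (simp add: permutation_matrices_eq finite_permutations)
  let ?S = "{\<sigma>. \<sigma> permutes {..<n}}"
  \<comment> \<open>Independence is a statement about the entry vectors \<open>X\<close> and
    \<open>Y\<close>, so the event and the trace are both expressed as measurable functions of these
    vectors.\<close>
  define h where "h = (\<lambda>\<sigma> v. of_bool (\<forall>e\<in>?I. v e = perm_mat n \<sigma> $$ e) :: complex)"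
  define t where "t = (\<lambda>\<sigma> v. word_trace n \<sigma> (\<lambda>i j. v (i, j)) (word es))"
  have hX: "h \<sigma> (X \<omega>) = indicator {\<omega> \<in> space p. u \<omega> = perm_mat n \<sigma>} \<omega>" if "\<omega> \<in> space p" for \<sigma> \<omega>
  proof -
    have "u \<omega> \<in> carrier_mat n n" using u_in[OF that] by (auto simp: permutation_matrices_eq perm_mat_def)
    then have "(\<forall>e\<in>?I. X \<omega> e = perm_mat n \<sigma> $$ e) \<longleftrightarrow> u \<omega> = perm_mat n \<sigma>"
      by (auto simp: X_def perm_mat_def intro!: eq_matI)
    then show ?thesis using that by (simp add: h_def indicator_def)
  qed
  have tY: "t \<sigma> (Y \<omega>) = trace_prod n \<sigma> (gram m n (\<lambda>e. g \<omega> $$ e)) [word es]" if "\<omega> \<in> space p" for \<sigma> \<omega>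
    unfolding t_def using wishart_index[OF g[OF that]]
    by (simp add: trace_prod_def) (intro word_trace_cong, simp add: Y_def)
  have int_h: "integrable p (\<lambda>\<omega>. h \<sigma> (X \<omega>))"
    and E_h: "expectation (\<lambda>\<omega>. h \<sigma> (X \<omega>)) = 1 / fact n" if \<sigma>: "\<sigma> \<in> ?S" for \<sigma>
  proof -
    have mem: "perm_mat n \<sigma> \<in> permutation_matrices n" using \<sigma> by (auto simp: permutation_matrices_eq)
    have set: "{\<omega> \<in> space p. u \<omega> = perm_mat n \<sigma>} = u -` {perm_mat n \<sigma>} \<inter> space p" by auto
    have meas: "{\<omega> \<in> space p. u \<omega> = perm_mat n \<sigma>} \<in> sets p"
      unfolding set using mem by (intro measurable_sets[OF u_meas]) auto
    have "measure p {\<omega> \<in> space p. u \<omega> = perm_mat n \<sigma>}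
      = measure (distr p (count_space (permutation_matrices n)) u) {perm_mat n \<sigma>}"
      unfolding set using mem by (subst measure_distr[OF u_meas]) auto
    also have "\<dots> = 1 / fact n"
      unfolding u_distr using mem fin
      by (subst measure_uniform_count_measure) (auto simp: card_permutation_matrices)
    finally have prob: "measure p {\<omega> \<in> space p. u \<omega> = perm_mat n \<sigma>} = 1 / fact n" .
    have "integrable p (\<lambda>\<omega>. complex_of_real (indicator {\<omega> \<in> space p. u \<omega> = perm_mat n \<sigma>} \<omega>))"
      using meas by (intro integrable_of_real integrable_real_indicator) (auto simp: emeasure_eq_measure)
    then show "integrable p (\<lambda>\<omega>. h \<sigma> (X \<omega>))"
      by (rule Bochner_Integration.integrable_cong[THEN iffD1, rotated 2]) (auto simp: hX indicator_def)
    have "expectation (\<lambda>\<omega>. h \<sigma> (X \<omega>)) = expectation (\<lambda>\<omega>. complex_of_real (indicator {\<omega> \<in> space p. u \<omega> = perm_mat n \<sigma>} \<omega>))"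
      by (rule Bochner_Integration.integral_cong) (auto simp: hX indicator_def)
    then show "expectation (\<lambda>\<omega>. h \<sigma> (X \<omega>)) = 1 / fact n"
      using prob meas by simp
  qed
  have int_t: "integrable p (\<lambda>\<omega>. t \<sigma> (Y \<omega>))" for \<sigma>
    using integrable_trace_prod[of \<sigma> "[word es]"]
    by (rule Bochner_Integration.integrable_cong[THEN iffD1, rotated 2]) (simp_all add: tY)
  have E_t: "expectation (\<lambda>\<omega>. t \<sigma> (Y \<omega>)) = mean_trace \<sigma> [word es]" for \<sigma>
    unfolding mean_trace_def by (rule Bochner_Integration.integral_cong) (simp_all add: tY)
  have ht: "indep_var borel (\<lambda>\<omega>. h \<sigma> (X \<omega>)) borel (\<lambda>\<omega>. t \<sigma> (Y \<omega>))" for \<sigma>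
    using indep_var_compose[OF XY measurable_eq_indicator[of ?I "\<lambda>e. perm_mat n \<sigma> $$ e"] measurable_word_trace[of n \<sigma> "word es"]]
    by (simp add: comp_def h_def t_def)
  have pointwise: "norm_trace (mat_word n (u \<omega> * wishart n (g \<omega>)) es) = (\<Sum>\<sigma>\<in>?S. h \<sigma> (X \<omega>) * t \<sigma> (Y \<omega>))"
    if \<omega>: "\<omega> \<in> space p" for \<omega>
  proof -
    obtain \<tau> where \<tau>: "\<tau> permutes {..<n}" "u \<omega> = perm_mat n \<tau>"
      using u_in[OF \<omega>] by (auto simp: permutation_matrices_eq)
    have "h \<sigma> (X \<omega>) = (if \<sigma> = \<tau> then 1 else 0)" if "\<sigma> \<in> ?S" for \<sigma>
      using hX[OF \<omega>, of \<sigma>] inj_onD[OF perm_mat_inj[of n], of \<tau> \<sigma>] \<tau> that \<omega> by (auto simp: indicator_def)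
    then have "(\<Sum>\<sigma>\<in>?S. h \<sigma> (X \<omega>) * t \<sigma> (Y \<omega>)) = (\<Sum>\<sigma>\<in>?S. if \<sigma> = \<tau> then t \<sigma> (Y \<omega>) else 0)"
      by (intro sum.cong) auto
    also have "\<dots> = t \<tau> (Y \<omega>)" using \<tau> by (simp add: finite_permutations)
    also have "\<dots> = word_trace n \<tau> (gram m n (\<lambda>e. g \<omega> $$ e)) (word es)" by (simp add: tY[OF \<omega>])
    also have "\<dots> = norm_trace (mat_word n (u \<omega> * wishart n (g \<omega>)) es)"
      using mat_word_entry[OF wishart_carrier[OF g[OF \<omega>]] wishart_index[OF g[OF \<omega>]] gram_hermitian \<tau>(1), where es = es] \<tau>(2)
      by (simp add: word_trace_def norm_trace_def)
    finally show ?thesis ..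
  qed
  have "integral\<^sup>L p (\<lambda>\<omega>. norm_trace (mat_word n (u \<omega> * wishart n (g \<omega>)) es))
    = expectation (\<lambda>\<omega>. \<Sum>\<sigma>\<in>?S. h \<sigma> (X \<omega>) * t \<sigma> (Y \<omega>))"
    by (rule Bochner_Integration.integral_cong) (simp_all add: pointwise)
  also have "\<dots> = (\<Sum>\<sigma>\<in>?S. expectation (\<lambda>\<omega>. h \<sigma> (X \<omega>) * t \<sigma> (Y \<omega>)))"
    by (intro Bochner_Integration.integral_sum indep_var_integrable[OF ht int_h int_t]) auto
  also have "\<dots> = (\<Sum>\<sigma>\<in>?S. (1 / fact n) * mean_trace \<sigma> [word es])"
    by (intro sum.cong refl) (simp add: indep_var_lebesgue_integral[OF ht int_h int_t] E_h E_t)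
  finally have "integral\<^sup>L p (\<lambda>\<omega>. norm_trace (mat_word n (u \<omega> * wishart n (g \<omega>)) es)) = average_trace [word es]"
    by (simp add: average_trace_def)
  then show "integral\<^sup>L (P m n) (\<lambda>\<omega>. norm_trace (mat_word n (U m n \<omega> * wishart n (G m n \<omega>)) es))
      = gaussian_matrix.average_trace (P m n) m n (\<lambda>\<omega> e. G m n \<omega> $$ e) [word es]"
    by (simp add: p_def g_def u_def)
qed

section \<open>Vanishing of non-alternating cumulants\<close>

text \<open>Position \<open>p\<close> separates the indices below \<open>p\<close> from those
  starting at \<open>p\<close>. A \<open>Star\<close> followed by a \<open>Plain\<close> names the
  same position twice, with opposite signs.\<close>

definition cut_index :: "star_exp \<Rightarrow> nat \<Rightarrow> nat" where
  "cut_index e a = (case e of Plain \<Rightarrow> a | Star \<Rightarrow> Suc a)"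

definition sign :: "star_exp \<Rightarrow> complex" where
  "sign e = (case e of Plain \<Rightarrow> 1 | Star \<Rightarrow> - 1)"

section \<open>Non-crossing partitions of arbitrary index sets\<close>

definition NC_on :: "nat set \<Rightarrow> nat set set set" where
  "NC_on S = {\<pi>. partition_on S \<pi> \<and> noncrossing \<pi>}"

lemma NC_eq_NC_on: "NC n = NC_on {..<n}"
  by (simp add: NC_def NC_on_def)

lemma NC_on_subset: "\<pi> \<in> NC_on S \<Longrightarrow> V \<in> \<pi> \<Longrightarrow> V \<subseteq> S"
  by (auto simp: NC_on_def partition_on_def)

lemma NC_on_image:
  assumes "\<pi> \<in> NC_on S" "strict_mono_on S f"
  shows "(`) f ` \<pi> \<in> NC_on (f ` S)"
proof -
  have inj: "inj_on f S" using assms(2) by (rule strict_mono_on_imp_inj_on)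
  have p: "partition_on S \<pi>" and nc: "noncrossing \<pi>"
    using assms(1) by (auto simp: NC_on_def)
  have "{} \<notin> (`) f ` \<pi>" using p by (auto simp: partition_on_def)
  then have "partition_on (f ` S) ((`) f ` \<pi>)"
    using partition_on_inj_image[OF p inj] by simp
  moreover have "noncrossing ((`) f ` \<pi>)"
    unfolding noncrossing_def
  proof (intro ballI allI impI)
    fix V' V'' a b c d
    assume "V' \<in> (`) f ` \<pi>" "V'' \<in> (`) f ` \<pi>"
      and *: "a < b \<and> b < c \<and> c < d \<and> a \<in> V' \<and> c \<in> V' \<and> b \<in> V'' \<and> d \<in> V''"
    then obtain V1 V2 where V: "V1 \<in> \<pi>" "V2 \<in> \<pi>" "V' = f ` V1" "V'' = f ` V2" by auto
    with * obtain a' b' c' d' where e: "a' \<in> V1" "c' \<in> V1" "b' \<in> V2" "d' \<in> V2"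
        "a = f a'" "b = f b'" "c = f c'" "d = f d'" by auto
    have S: "a' \<in> S" "b' \<in> S" "c' \<in> S" "d' \<in> S"
      using e V NC_on_subset[OF assms(1)] by blast+
    have less: "x < y" if "f x < f y" "x \<in> S" "y \<in> S" for x y
      using that assms(2) by (metis not_less_iff_gr_or_eq strict_mono_onD)
    have "a' < b'" "b' < c'" "c' < d'" using * e S less by auto
    then have "V1 = V2"
      using nc e V unfolding noncrossing_def by blast
    then show "V' = V''" using V by simp
  qed
  ultimately show ?thesis by (simp add: NC_on_def)
qed

lemma card_less_strict_mono_on:
  assumes "finite S"
  shows "strict_mono_on S (\<lambda>i. card {i' \<in> S. i' < (i::nat)})"
proof (rule strict_mono_onI)
  fix r s assume "r \<in> S" "s \<in> S" "r < s"
  then have "{i' \<in> S. i' < r} \<subset> {i' \<in> S. i' < s}" by auto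
  then show "card {i' \<in> S. i' < r} < card {i' \<in> S. i' < s}"
    using assms by (intro psubset_card_mono) auto
qed

lemma card_less_image:
  assumes "finite S"
  shows "(\<lambda>i. card {i' \<in> S. i' < (i::nat)}) ` S = {..<card S}"
proof (rule card_subset_eq)
  show "(\<lambda>i. card {i' \<in> S. i' < i}) ` S \<subseteq> {..<card S}"
    using assms by (auto intro!: psubset_card_mono)
  show "card ((\<lambda>i. card {i' \<in> S. i' < i}) ` S) = card {..<card S}"
    using card_image[OF strict_mono_on_imp_inj_on[OF card_less_strict_mono_on[OF assms]]] by simp
qed simp

lemma strict_mono_on_inv:
  assumes "strict_mono_on S (f :: nat \<Rightarrow> nat)"
  shows "strict_mono_on (f ` S) (the_inv_into S f)"
proof (rule strict_mono_onI)
  have inj: "inj_on f S" using assms by (rule strict_mono_on_imp_inj_on)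
  fix r s assume "r \<in> f ` S" "s \<in> f ` S" "r < s"
  then obtain r' s' where e: "r' \<in> S" "s' \<in> S" "r = f r'" "s = f s'" by auto
  then have "r' < s'"
    using \<open>r < s\<close> assms by (metis not_less_iff_gr_or_eq strict_mono_onD)
  then show "the_inv_into S f r < the_inv_into S f s"
    using e by (simp add: the_inv_into_f_f[OF inj])
qed

text \<open>The rank in \<open>S\<close> is an order isomorphism onto an initial segment, so it
  preserves non-crossing partitions in both directions, and selecting from \<open>nths xs S\<close>
  is selecting by rank. The complement of an arc, whose indices need not be consecutive, requires
  this generality.\<close>

lemma sum_NC_on_relabel:
  fixes k :: "'a list \<Rightarrow> complex"
  assumes S: "S \<subseteq> {..<length xs}"
  shows "(\<Sum>\<pi>\<in>NC_on S. \<Prod>V\<in>\<pi>. k (nths xs V))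
    = (\<Sum>\<pi>\<in>NC (length (nths xs S)). \<Prod>V\<in>\<pi>. k (nths (nths xs S) V))"
proof -
  define r where "r = (\<lambda>i. card {i' \<in> S. i' < i})"
  define h where "h = the_inv_into S r"
  have fin: "finite S" using S finite_subset by blast
  have mono: "strict_mono_on S r" unfolding r_def by (rule card_less_strict_mono_on[OF fin])
  have inj: "inj_on r S" using mono by (rule strict_mono_on_imp_inj_on)
  have rS: "r ` S = {..<card S}" unfolding r_def by (rule card_less_image[OF fin])
  have hmono: "strict_mono_on {..<card S} h"
    unfolding h_def rS[symmetric] by (rule strict_mono_on_inv[OF mono])
  have hr: "h (r x) = x" if "x \<in> S" for x
    using that by (simp add: h_def the_inv_into_f_f[OF inj])
  have rh: "r (h x) = x" if "x < card S" for x
    using that f_the_inv_into_f[OF inj, of x] by (simp add: h_def rS)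
  have hS: "h ` {..<card S} = S"
    by (simp add: rS[symmetric] image_comp) (auto simp: hr image_iff)
  have len: "length (nths xs S) = card S"
  proof -
    have "{i. i < length xs \<and> i \<in> S} = S" using S by auto
    then show ?thesis by (simp add: length_nths)
  qed
  have hrV: "(`) h ` (`) r ` \<pi> = \<pi>" if "\<pi> \<in> NC_on S" for \<pi>
  proof -
    have "h ` r ` V = V" if "V \<in> \<pi>" for V
      using NC_on_subset[OF \<open>\<pi> \<in> NC_on S\<close> that] hr by (force simp: image_iff)
    then show ?thesis by (force simp: image_iff)
  qed
  have rhV: "(`) r ` (`) h ` \<pi> = \<pi>" if "\<pi> \<in> NC_on {..<card S}" for \<pi>
  proof -
    have "r ` h ` V = V" if "V \<in> \<pi>" for V
      using NC_on_subset[OF \<open>\<pi> \<in> NC_on {..<card S}\<close> that] rh by (force simp: image_iff)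
    then show ?thesis by (force simp: image_iff)
  qed
  have prod: "(\<Prod>V\<in>(`) r ` \<pi>. k (nths (nths xs S) V)) = (\<Prod>V\<in>\<pi>. k (nths xs V))"
    if \<pi>: "\<pi> \<in> NC_on S" for \<pi>
  proof -
    have "inj_on ((`) r) \<pi>"
      using NC_on_subset[OF \<pi>] inj by (auto intro!: inj_onI simp: inj_on_image_eq_iff)
    moreover have "nths (nths xs S) (r ` V) = nths xs V" if "V \<in> \<pi>" for V
    proof -
      have "{i \<in> S. \<exists>j\<in>r ` V. r i = j} = V"
        using NC_on_subset[OF \<pi> that] inj by (auto simp: inj_on_def)
      then show ?thesis by (simp add: nths_nths r_def)
    qed
    ultimately show ?thesis by (simp add: prod.reindex)
  qed
  show ?thesis
    unfolding len NC_eq_NC_on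
  proof (rule sum.reindex_bij_witness[of _ "(`) ((`) h)" "(`) ((`) r)"])
    fix \<pi> assume "\<pi> \<in> NC_on S"
    then show "(`) r ` \<pi> \<in> NC_on {..<card S}"
      using NC_on_image[OF _ mono] by (simp add: rS)
  next
    fix \<pi> assume "\<pi> \<in> NC_on {..<card S}"
    then show "(`) h ` \<pi> \<in> NC_on S"
      using NC_on_image[OF _ hmono] by (simp add: hS)
  qed (use hrV rhV prod in simp_all)
qed

text \<open>Membership in \<open>S\<close> is constant on every block. In this form the property
  visibly passes to symmetric differences, which is what \<open>block_union_between\<close>
  uses.\<close>

definition block_union :: "nat set set \<Rightarrow> nat set \<Rightarrow> bool" where
  "block_union \<pi> S \<longleftrightarrow> (\<forall>V\<in>\<pi>. \<forall>x\<in>V. \<forall>y\<in>V. (x \<in> S) = (y \<in> S))"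

lemma block_union_cases: "block_union \<pi> S \<Longrightarrow> V \<in> \<pi> \<Longrightarrow> V \<subseteq> S \<or> V \<inter> S = {}"
  unfolding block_union_def by blast

text \<open>Partitions of the interval and of its complement can be glued freely: by convexity of
  the interval, a block inside and a block outside never cross. Conversely,
  \<open>block_union\<close> keeps the blocks whole under restriction.\<close>

lemma sum_NC_block_union:
  fixes f :: "nat set \<Rightarrow> complex"
  assumes I: "{p..<q} \<subseteq> {..<n}"
  shows "(\<Sum>\<pi> | \<pi> \<in> NC n \<and> block_union \<pi> {p..<q}. \<Prod>V\<in>\<pi>. f V)
    = (\<Sum>\<pi>\<in>NC_on {p..<q}. \<Prod>V\<in>\<pi>. f V) * (\<Sum>\<pi>\<in>NC_on ({..<n} - {p..<q}). \<Prod>V\<in>\<pi>. f V)"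
proof -
  let ?I = "{p..<q}" and ?J = "{..<n} - {p..<q}"
  let ?X = "{\<pi>. \<pi> \<in> NC n \<and> block_union \<pi> ?I}"
  have "(\<Sum>\<pi>\<in>NC_on ?I. \<Prod>V\<in>\<pi>. f V) * (\<Sum>\<pi>\<in>NC_on ?J. \<Prod>V\<in>\<pi>. f V)
     = (\<Sum>(\<sigma>, \<tau>)\<in>NC_on ?I \<times> NC_on ?J. (\<Prod>V\<in>\<sigma>. f V) * (\<Prod>V\<in>\<tau>. f V))"
    by (simp add: sum_product sum.cartesian_product)
  also have "\<dots> = (\<Sum>\<pi>\<in>?X. \<Prod>V\<in>\<pi>. f V)"
  proof (rule sum.reindex_bij_witness[of _ "\<lambda>\<pi>. ({V\<in>\<pi>. V \<subseteq> ?I}, {V\<in>\<pi>. V \<inter> ?I = {}})" "\<lambda>(\<sigma>, \<tau>). \<sigma> \<union> \<tau>"])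
    fix st assume "st \<in> NC_on ?I \<times> NC_on ?J"
    then obtain \<sigma> \<tau> where st: "st = (\<sigma>, \<tau>)" and \<sigma>: "\<sigma> \<in> NC_on ?I" and \<tau>: "\<tau> \<in> NC_on ?J"
      by auto
    have p\<sigma>: "partition_on ?I \<sigma>" "noncrossing \<sigma>" and p\<tau>: "partition_on ?J \<tau>" "noncrossing \<tau>"
      using \<sigma> \<tau> by (auto simp: NC_on_def)
    have sub\<sigma>: "V \<subseteq> ?I" if "V \<in> \<sigma>" for V using NC_on_subset[OF \<sigma> that] .
    have sub\<tau>: "V \<subseteq> ?J" if "V \<in> \<tau>" for V using NC_on_subset[OF \<tau> that] .
    have ne: "V \<noteq> {}" if "V \<in> \<sigma> \<union> \<tau>" for V
      using that p\<sigma> p\<tau> by (auto simp: partition_on_def)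
    have sep: "{V \<in> \<sigma> \<union> \<tau>. V \<subseteq> ?I} = \<sigma>" "{V \<in> \<sigma> \<union> \<tau>. V \<inter> ?I = {}} = \<tau>"
      using sub\<sigma> sub\<tau> ne by (auto simp del: atLeastLessThan_iff) blast+
    show "({V \<in> (case st of (\<sigma>, \<tau>) \<Rightarrow> \<sigma> \<union> \<tau>). V \<subseteq> ?I},
        {V \<in> (case st of (\<sigma>, \<tau>) \<Rightarrow> \<sigma> \<union> \<tau>). V \<inter> ?I = {}}) = st"
      using sep by (simp add: st)
    have "partition_on (?I \<union> ?J) (\<sigma> \<union> \<tau>)"
    proof (rule partition_onI)
      show "\<Union>(\<sigma> \<union> \<tau>) = ?I \<union> ?J" using p\<sigma>(1) p\<tau>(1) by (simp add: partition_on_def)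
      show "{} \<notin> \<sigma> \<union> \<tau>" using ne by blast
      show "disjnt V V'" if V: "V \<in> \<sigma> \<union> \<tau>" "V' \<in> \<sigma> \<union> \<tau>" "V \<noteq> V'" for V V'
      proof -
        have "disjnt V V'" if "V \<in> \<sigma>" "V' \<in> \<sigma>"
          using that V(3) p\<sigma>(1) by (auto simp: partition_on_def disjoint_def disjnt_def)
        moreover have "disjnt V V'" if "V \<in> \<tau>" "V' \<in> \<tau>"
          using that V(3) p\<tau>(1) by (auto simp: partition_on_def disjoint_def disjnt_def)
        moreover have "disjnt V V'" if "V \<in> \<sigma>" "V' \<in> \<tau>"
          using sub\<sigma>[OF that(1)] sub\<tau>[OF that(2)] unfolding disjnt_def by blast
        moreover have "disjnt V V'" if "V \<in> \<tau>" "V' \<in> \<sigma>"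
          using sub\<tau>[OF that(1)] sub\<sigma>[OF that(2)] unfolding disjnt_def by blast
        ultimately show ?thesis using V by blast
      qed
    qed
    then have part: "partition_on {..<n} (\<sigma> \<union> \<tau>)"
      using I by (simp add: Un_absorb1)
    have nc: "noncrossing (\<sigma> \<union> \<tau>)"
      unfolding noncrossing_def
    proof (intro ballI allI impI)
      fix V V' a b c d
      assume V: "V \<in> \<sigma> \<union> \<tau>" "V' \<in> \<sigma> \<union> \<tau>"
        and *: "a < b \<and> b < c \<and> c < d \<and> a \<in> V \<and> c \<in> V \<and> b \<in> V' \<and> d \<in> V'"
      have "V = V'" if "V \<in> \<sigma>" "V' \<in> \<sigma>" using * that p\<sigma>(2) unfolding noncrossing_def by blast
      moreover have "V = V'" if "V \<in> \<tau>" "V' \<in> \<tau>" using * that p\<tau>(2) unfolding noncrossing_def by blast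
      moreover have False if "V \<in> \<sigma>" "V' \<in> \<tau>"
      proof -
        have "a \<in> ?I" "c \<in> ?I" "b \<in> ?J" using * sub\<sigma>[OF that(1)] sub\<tau>[OF that(2)] by blast+
        then show False using * by auto
      qed
      moreover have False if "V \<in> \<tau>" "V' \<in> \<sigma>"
      proof -
        have "b \<in> ?I" "d \<in> ?I" "c \<in> ?J" using * sub\<tau>[OF that(1)] sub\<sigma>[OF that(2)] by blast+
        then show False using * by auto
      qed
      ultimately show "V = V'" using V by blast
    qed
    have "block_union (\<sigma> \<union> \<tau>) ?I"
      unfolding block_union_def using sub\<sigma> sub\<tau> by blast
    then show "(case st of (\<sigma>, \<tau>) \<Rightarrow> \<sigma> \<union> \<tau>) \<in> ?X"
      using part nc by (simp add: st NC_def)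
    have "\<sigma> \<inter> \<tau> = {}"
      using sub\<sigma> sub\<tau> ne by blast
    moreover have "finite \<sigma>" "finite \<tau>"
      using finite_elements[OF _ p\<sigma>(1)] finite_elements[OF _ p\<tau>(1)] by auto
    ultimately show "(\<Prod>V\<in>(case st of (\<sigma>, \<tau>) \<Rightarrow> \<sigma> \<union> \<tau>). f V) =
        (case st of (\<sigma>, \<tau>) \<Rightarrow> (\<Prod>V\<in>\<sigma>. f V) * (\<Prod>V\<in>\<tau>. f V))"
      by (simp add: st prod.union_disjoint)
  next
    fix \<pi> assume \<pi>: "\<pi> \<in> ?X"
    then have p: "partition_on {..<n} \<pi>" "noncrossing \<pi>" and r: "block_union \<pi> ?I"
      by (auto simp: NC_def)
    have cases: "V \<subseteq> ?I \<or> V \<inter> ?I = {}" if "V \<in> \<pi>" for V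
      using block_union_cases[OF r that] .
    show "(case ({V\<in>\<pi>. V \<subseteq> ?I}, {V\<in>\<pi>. V \<inter> ?I = {}}) of (\<sigma>, \<tau>) \<Rightarrow> \<sigma> \<union> \<tau>) = \<pi>"
      using cases by auto
    have un: "\<Union>\<pi> = {..<n}" and ne: "{} \<notin> \<pi>" and dis: "disjoint \<pi>"
      using p by (auto simp: partition_on_def)
    have "\<Union>{V\<in>\<pi>. V \<subseteq> ?I} = ?I"
    proof
      show "?I \<subseteq> \<Union>{V\<in>\<pi>. V \<subseteq> ?I}"
      proof
        fix x assume x: "x \<in> ?I"
        then obtain V where "V \<in> \<pi>" "x \<in> V" using un I by blast
        then show "x \<in> \<Union>{V\<in>\<pi>. V \<subseteq> ?I}" using cases[of V] x by blast
      qed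
    qed blast
    moreover have "\<Union>{V\<in>\<pi>. V \<inter> ?I = {}} = ?J"
    proof
      show "?J \<subseteq> \<Union>{V\<in>\<pi>. V \<inter> ?I = {}}"
      proof
        fix x assume x: "x \<in> ?J"
        then obtain V where "V \<in> \<pi>" "x \<in> V" using un by blast
        then show "x \<in> \<Union>{V\<in>\<pi>. V \<inter> ?I = {}}" using cases[of V] x by blast
      qed
      show "\<Union>{V\<in>\<pi>. V \<inter> ?I = {}} \<subseteq> ?J" using un by blast
    qed
    moreover have "disjoint {V\<in>\<pi>. V \<subseteq> ?I}" "disjoint {V\<in>\<pi>. V \<inter> ?I = {}}"
      using dis by (auto simp: disjoint_def)
    moreover have "noncrossing {V\<in>\<pi>. V \<subseteq> ?I}" "noncrossing {V\<in>\<pi>. V \<inter> ?I = {}}"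
      using p(2) unfolding noncrossing_def by blast+
    ultimately show "({V\<in>\<pi>. V \<subseteq> ?I}, {V\<in>\<pi>. V \<inter> ?I = {}}) \<in> NC_on ?I \<times> NC_on ?J"
      using ne by (simp add: NC_on_def partition_on_def)
  qed
  finally show ?thesis by simp
qed

text \<open>The interval between \<open>p\<close> and \<open>q\<close> is the symmetric difference
  of the arcs from \<open>b\<close> to \<open>p\<close> and from \<open>b\<close> to
  \<open>q\<close>.\<close>

lemma block_union_between:
  assumes "block_union \<pi> {min p q..<max p q}"
  shows "block_union \<pi> {min b p..<max b p} \<longleftrightarrow> block_union \<pi> {min b q..<max b (q::nat)}"
proof -
  have *: "x \<in> {min b q..<max b q} \<longleftrightarrow> (x \<in> {min b p..<max b p}) \<noteq> (x \<in> {min p q..<max p q})" for x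
    by (auto simp: min_def max_def)
  show ?thesis
    using assms unfolding block_union_def * by blast
qed

lemma block_union_gap:
  assumes nc: "noncrossing \<pi>" and V: "V \<in> \<pi>" "a \<in> V" "d \<in> V"
    and dis: "disjoint \<pi>" and gap: "V \<inter> {Suc a..<d} = {}"
  shows "block_union \<pi> {Suc a..<d}"
proof -
  have "False" if V': "V' \<in> \<pi>" "x \<in> V'" "y \<in> V'" "x \<in> {Suc a..<d}" "y \<notin> {Suc a..<d}" for V' x y
  proof -
    have "V \<noteq> V'" using V' gap by auto
    then have "y \<noteq> a" "y \<noteq> d" using V V' dis by (auto simp: disjoint_def)
    then consider "y < a" | "d < y" using V'(5) by fastforce
    then show False
    proof cases
      case 1
      then have "y < a \<and> a < x \<and> x < d \<and> y \<in> V' \<and> x \<in> V' \<and> a \<in> V \<and> d \<in> V" using V' V by auto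
      then show False using nc V(1) V'(1) \<open>V \<noteq> V'\<close> unfolding noncrossing_def by metis
    next
      case 2
      then have "a < x \<and> x < d \<and> d < y \<and> a \<in> V \<and> d \<in> V \<and> x \<in> V' \<and> y \<in> V'" using V' V by auto
      then show False using nc V(1) V'(1) \<open>V \<noteq> V'\<close> unfolding noncrossing_def by metis
    qed
  qed
  then show ?thesis unfolding block_union_def by blast
qed

text \<open>The outer gap of \<open>V\<close>, from its last element cyclically round to its first,
  is the complement of the hull; that no block splits it is expressed through the hull, by the same
  crossing argument.\<close>

lemma block_union_hull:
  assumes nc: "noncrossing \<pi>" and V: "V \<in> \<pi>" "a \<in> V" "d \<in> V" "V \<subseteq> {a..d}"
    and dis: "disjoint \<pi>"
  shows "block_union \<pi> {a..<Suc d}"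
proof -
  have "False" if V': "V' \<in> \<pi>" "x \<in> V'" "y \<in> V'" "x \<in> {a..<Suc d}" "y \<notin> {a..<Suc d}" for V' x y
  proof -
    have "V \<noteq> V'" using V' V by auto
    then have "x \<noteq> a" "x \<noteq> d" using V V' dis by (auto simp: disjoint_def)
    then have x: "a < x" "x < d" using V'(4) by auto
    consider "y < a" | "d < y" using V'(5) by fastforce
    then show False
    proof cases
      case 1
      then have "y < a \<and> a < x \<and> x < d \<and> y \<in> V' \<and> x \<in> V' \<and> a \<in> V \<and> d \<in> V" using V' V x by auto
      then show False using nc V(1) V'(1) \<open>V \<noteq> V'\<close> unfolding noncrossing_def by metis
    next
      case 2
      then have "a < x \<and> x < d \<and> d < y \<and> a \<in> V \<and> d \<in> V \<and> x \<in> V' \<and> y \<in> V'" using V' V x by auto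
      then show False using nc V(1) V'(1) \<open>V \<noteq> V'\<close> unfolding noncrossing_def by metis
    qed
  qed
  then show ?thesis unfolding block_union_def by blast
qed

section \<open>Cancellation of the cuts at an alternating block\<close>

lemma length_concat_replicate_pair: "length (concat (replicate k [x, y])) = 2 * k"
  by (induction k) auto

lemma nth_concat_replicate_pair:
  "j < 2 * k \<Longrightarrow> concat (replicate k [x, y]) ! j = (if even j then x else y)"
proof (induction k arbitrary: j)
  case (Suc k)
  then show ?case
    by (cases j; cases "j - 1") (auto simp: nth_Cons split: nat.splits)
qed simp

lemma sum_pairs: "(\<Sum>j<2 * k. g j) = (\<Sum>j<k. g (2 * j) + g (2 * j + 1 :: nat) :: complex)"
  by (induction k) (auto simp: add_ac)

lemma sum_block_cuts:
  fixes b :: nat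
  assumes \<pi>: "\<pi> \<in> NC (length es)" and V: "V \<in> \<pi>" and alt: "alternating (nths es V)"
  defines "R \<equiv> \<lambda>p. of_bool (block_union \<pi> {min b p..<max b p}) :: complex"
  shows "(\<Sum>a\<in>V. sign (es ! a) * R (cut_index (es ! a) a)) = 0"
proof -
  define vs where "vs = nths [0..<length es] V"
  have nc: "noncrossing \<pi>" and dis: "disjoint \<pi>" and sub: "V \<subseteq> {..<length es}"
    using \<pi> V by (auto simp: NC_def partition_on_def)
  have set_vs: "set vs = V"
  proof
    show "V \<subseteq> set vs"
    proof
      fix x assume "x \<in> V"
      moreover from this have "x < length es" using sub by auto
      ultimately show "x \<in> set vs" by (auto simp: vs_def set_nths intro!: exI[of _ x])
    qed
  qed (auto simp: vs_def set_nths)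
  have dist: "distinct vs" by (simp add: vs_def)
  have sorted: "sorted vs" by (simp add: vs_def sorted_nths)
  have strict: "vs ! i < vs ! j" if "i < j" "j < length vs" for i j
    using that sorted dist by (simp add: sorted_wrt_nth_less strict_sorted_iff)
  have nths_es: "nths es V = map ((!) es) vs"
    by (simp add: vs_def nths_map[symmetric] map_nth)
  \<comment> \<open>The cut behind an element of \<open>V\<close> and the cut in front of the next
    one differ by a gap of \<open>V\<close>, which no block splits; so \<open>R\<close> agrees at
    both, wherever the base point \<open>b\<close> lies.\<close>
  have gap: "R (Suc (vs ! j)) = R (vs ! Suc j)" if j: "Suc j < length vs" for j
  proof -
    have "V \<inter> {Suc (vs ! j)..<vs ! Suc j} = {}"
    proof (rule ccontr)
      assume "V \<inter> {Suc (vs ! j)..<vs ! Suc j} \<noteq> {}"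
      then obtain x where x: "x \<in> set vs" "vs ! j < x" "x < vs ! Suc j"
        using set_vs by (auto simp: Suc_le_eq)
      then obtain i where i: "i < length vs" "vs ! j < vs ! i" "vs ! i < vs ! Suc j"
        by (auto simp: in_set_conv_nth)
      have "\<not> i \<le> j" using i(2) strict[of i j] j by (cases "i = j") auto
      moreover have "\<not> Suc j \<le> i" using i(1,3) strict[of "Suc j" i] by (cases "i = Suc j") auto
      ultimately show False by simp
    qed
    then have "block_union \<pi> {Suc (vs ! j)..<vs ! Suc j}"
      using j set_vs by (intro block_union_gap[OF nc V _ _ dis]) auto
    moreover have "Suc (vs ! j) \<le> vs ! Suc j" using strict[of j "Suc j"] j by simp
    ultimately show ?thesis
      unfolding R_def by (subst block_union_between[of \<pi> "Suc (vs ! j)" "vs ! Suc j"]) (auto simp: min_def max_def)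
  qed
  have hull: "R (vs ! 0) = R (Suc (vs ! (length vs - 1)))" if "vs \<noteq> []"
  proof -
    have len: "0 < length vs" using that by simp
    have ends: "vs ! 0 \<le> vs ! j \<and> vs ! j \<le> vs ! (length vs - 1)" if "j < length vs" for j
      using that sorted by (auto simp: sorted_iff_nth_mono)
    have "V \<subseteq> {vs ! 0..vs ! (length vs - 1)}"
      using ends set_vs by (auto simp: in_set_conv_nth)
    then have "block_union \<pi> {vs ! 0..<Suc (vs ! (length vs - 1))}"
      using len set_vs by (intro block_union_hull[OF nc V _ _ _ dis]) auto
    moreover have "vs ! 0 \<le> Suc (vs ! (length vs - 1))" using ends[OF len] by simp
    ultimately show ?thesis
      unfolding R_def by (subst block_union_between[of \<pi> "vs ! 0" "Suc (vs ! (length vs - 1))"]) (auto simp: min_def max_def)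
  qed
  let ?g = "\<lambda>a. sign (es ! a) * R (cut_index (es ! a) a)"
  have sum: "(\<Sum>a\<in>V. ?g a) = (\<Sum>j<length vs. ?g (vs ! j))"
    using sum.reindex_bij_betw[OF bij_betw_nth[OF dist refl set_vs[symmetric]], of ?g] by simp
  from alt obtain m where m: "nths es V = concat (replicate m [Plain, Star]) \<or>
      nths es V = concat (replicate m [Star, Plain])"
    unfolding alternating_def by blast
  have len: "length vs = 2 * m"
    using m nths_es length_concat_replicate_pair by (metis length_map)
  from m show ?thesis
  proof
    assume eq: "nths es V = concat (replicate m [Plain, Star])"
    have e: "es ! (vs ! j) = (if even j then Plain else Star)" if "j < 2 * m" for j
      using that len nths_es eq nth_concat_replicate_pair[OF that] by (metis nth_map)
    \<comment> \<open>In the pattern \<open>Plain\<close>, \<open>Star\<close> each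
      \<open>Star\<close> cancels against the next \<open>Plain\<close>, so the partners are shifted
      by one and the sum telescopes. \<open>F m\<close> wraps round to the first element, which
      \<open>hull\<close> identifies with the cut behind the last one.\<close>
    define F where "F = (\<lambda>j. if j = m then R (vs ! 0) else R (vs ! (2 * j)))"
    have "?g (vs ! (2 * j)) + ?g (vs ! (2 * j + 1)) = F j - F (Suc j)" if j: "j < m" for j
    proof -
      have "R (Suc (vs ! (2 * j + 1))) = F (Suc j)"
      proof (cases "Suc j = m")
        case True
        then have "length vs - 1 = 2 * j + 1" "vs \<noteq> []" using len by auto
        then show ?thesis using hull True by (simp add: F_def)
      next
        case False
        then show ?thesis using gap[of "2 * j + 1"] len j by (simp add: F_def)
      qed
      then show ?thesis using e[of "2 * j"] e[of "2 * j + 1"] j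
        by (simp add: sign_def cut_index_def F_def)
    qed
    then have "(\<Sum>a\<in>V. ?g a) = (\<Sum>j<m. F j - F (Suc j))"
      unfolding sum len sum_pairs by simp
    also have "\<dots> = 0"
      by (subst sum_lessThan_telescope') (simp add: F_def)
    finally show ?thesis .
  next
    assume eq: "nths es V = concat (replicate m [Star, Plain])"
    have e: "es ! (vs ! j) = (if even j then Star else Plain)" if "j < 2 * m" for j
      using that len nths_es eq nth_concat_replicate_pair[OF that] by (metis nth_map)
    \<comment> \<open>In the pattern \<open>Star\<close>, \<open>Plain\<close> the two cuts of each
      pair already lie at the two ends of the same gap.\<close>
    have "?g (vs ! (2 * j)) + ?g (vs ! (2 * j + 1)) = 0" if j: "j < m" for j
      using e[of "2 * j"] e[of "2 * j + 1"] j gap[of "2 * j"] len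
      by (simp add: sign_def cut_index_def)
    then show ?thesis
      unfolding sum len sum_pairs by simp
  qed
qed


text \<open>Over two letters, a word without equal neighbours repeats a pair \<open>[x, y]\<close>,
  and the condition on \<open>hd\<close> and \<open>last\<close> excludes odd length. Removing two
  letters at a time lets this condition pass to the rest.\<close>

lemma alternating_cases:
  assumes "\<And>i. Suc i < length es \<Longrightarrow> es ! i \<noteq> es ! Suc i"
    and "es \<noteq> [] \<Longrightarrow> hd es \<noteq> last es"
  shows "alternating es"
proof -
  have "\<exists>m x y. es = concat (replicate m [x, y]) \<and> x \<noteq> y \<and> (es \<noteq> [] \<longrightarrow> hd es = x)"
    using assms
  proof (induction es rule: induct_list012)
    case 1
    have "[] = concat (replicate 0 [Plain, Star]) \<and> Plain \<noteq> Star \<and> ([] \<noteq> [] \<longrightarrow> hd [] = Plain)"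
      by simp
    then show ?case by blast
  next
    case (2 x)
    then show ?case by simp
  next
    case (3 x y zs)
    have xy: "x \<noteq> y" using 3(3)[of 0] by simp
    have two: "a = x \<or> a = y" for a :: star_exp using xy by (cases a; cases x; cases y) auto
    have "\<exists>m x y. zs = concat (replicate m [x, y]) \<and> x \<noteq> y \<and> (zs \<noteq> [] \<longrightarrow> hd zs = x)"
    proof (rule 3(1))
      show "zs ! i \<noteq> zs ! Suc i" if "Suc i < length zs" for i
        using 3(3)[of "Suc (Suc i)"] that by simp
      show "hd zs \<noteq> last zs" if "zs \<noteq> []"
      proof -
        have "hd zs \<noteq> y" using 3(3)[of 1] that by (simp add: hd_conv_nth)
        moreover have "last zs \<noteq> x" using 3(4) that by simp
        ultimately show ?thesis using two by metis
      qed
    qed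
    then obtain m x' y' where zs: "zs = concat (replicate m [x', y'])" "x' \<noteq> y'" "zs \<noteq> [] \<Longrightarrow> hd zs = x'"
      by blast
    have "zs = concat (replicate m [x, y])"
    proof (cases "m = 0")
      case False
      then have "zs \<noteq> []" using zs(1) by (cases m) auto
      then have "x' \<noteq> y" using 3(3)[of 1] zs(3) by (simp add: hd_conv_nth)
      then have "x' = x" "y' = y" using two[of x'] two[of y'] zs(2) by auto
      then show ?thesis using zs(1) by simp
    qed (use zs in simp)
    then have "x # y # zs = concat (replicate (Suc m) [x, y])" by simp
    then show ?case using xy by (metis list.sel(1))
  qed
  then obtain m x y where "es = concat (replicate m [x, y])" "x \<noteq> y" by blast
  then show ?thesis
    unfolding alternating_def by (cases x; cases y) auto
qed

section \<open>Cumulants of moments that satisfy the cut identity\<close>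

lemma nths_middle:
  "nths (xs @ ys @ zs) {length xs..<length xs + length ys} = ys"
  "nths (xs @ ys @ zs) ({..<length xs + length ys + length zs} - {length xs..<length xs + length ys}) = xs @ zs"
proof -
  have 1: "nths xs {length xs..<length xs + length ys} = []"
    by (auto simp: set_nths[of xs] simp flip: set_empty)
  have 2: "{j. j + length xs \<in> {length xs..<length xs + length ys}} = {..<length ys}" by auto
  have 3: "nths zs {j. j + length ys \<in> {..<length ys}} = []"
    by (simp add: set_nths[of zs] flip: set_empty)
  show "nths (xs @ ys @ zs) {length xs..<length xs + length ys} = ys"
    by (simp only: nths_append 1 2 3) simp
  let ?T = "{..<length xs + length ys + length zs} - {length xs..<length xs + length ys}"
  have 4: "nths xs ?T = xs" by (rule nths_all) auto
  have 5: "nths ys {j. j + length xs \<in> ?T} = []"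
    by (auto simp: set_nths[of ys] simp flip: set_empty)
  have 6: "nths zs {j. j + length ys \<in> {j. j + length xs \<in> ?T}} = zs"
    by (rule nths_all) auto
  show "nths (xs @ ys @ zs) ?T = xs @ zs"
    by (simp only: nths_append 4 5 6) simp
qed

lemma cut_index_bounds: "a \<le> cut_index e a" "a < n \<Longrightarrow> cut_index e a \<le> n"
  and cut_index_add: "cut_index e (a + k) = cut_index e a + k"
  by (auto simp: cut_index_def split: star_exp.splits)

text \<open>This isolates the combinatorial part from the random matrices: only moments, cumulants
  and the cut identity remain. For the empty word the first assumption says \<open>m [] = 1\<close>,
  because the empty partition is the only element of \<open>NC 0\<close>.\<close>

locale gauge_invariant_moments =
  fixes m k :: "star_exp list \<Rightarrow> complex"
  assumes moment_cumulant: "m es = (\<Sum>\<pi>\<in>NC (length es). \<Prod>V\<in>\<pi>. k (nths es V))"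
    and tracial: "m (xs @ ys) = m (ys @ xs)"
    and gauge: "(\<Sum>a<length es. sign (es ! a) *
      (m (take (cut_index (es ! a) a) es) * m (drop (cut_index (es ! a) a) es))) = 0"
begin

text \<open>Traciality moves the base point of the cuts from \<open>0\<close> to \<open>b\<close>: the two factors become the moments of the arc
  \<open>I p\<close> between \<open>b\<close> and the cut, and of its complement.\<close>

lemma gauge_base:
  assumes b: "b \<le> length es"
  defines "I \<equiv> \<lambda>p. {min b p..<max b p}"
  shows "(\<Sum>a<length es. sign (es ! a) * (m (nths es (I (cut_index (es ! a) a)))
     * m (nths es ({..<length es} - I (cut_index (es ! a) a))))) = 0"
proof -
  define L R where "L = take b es" and "R = drop b es"
  have es: "es = L @ R" by (simp add: L_def R_def)
  have lenL: "length L = b" using b by (simp add: L_def)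
  define f where "f = (\<lambda>a. sign (es ! a) * (m (nths es (I (cut_index (es ! a) a)))
     * m (nths es ({..<length es} - I (cut_index (es ! a) a)))))"
  define g where "g = (\<lambda>a. sign ((R @ L) ! a) * (m (take (cut_index ((R @ L) ! a) a) (R @ L))
     * m (drop (cut_index ((R @ L) ! a) a) (R @ L))))"
  have right: "f (a + b) = g a" if a: "a < length R" for a
  proof -
    define c where "c = cut_index (R ! a) a"
    have c: "c \<le> length R" unfolding c_def using a by (rule cut_index_bounds)
    have nth: "es ! (a + b) = R ! a" "(R @ L) ! a = R ! a"
      using a lenL by (simp_all add: es nth_append)
    have I: "I (c + b) = {length L..<length L + length (take c R)}"
      using c lenL by (simp add: I_def min_def add.commute)
    have "es = L @ take c R @ drop c R" by (simp add: es)
    then have n: "nths es (I (c + b)) = take c R" "nths es ({..<length es} - I (c + b)) = L @ drop c R"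
      using nths_middle[of L "take c R" "drop c R"] c unfolding I by (simp_all add: es)
    have rot: "m (L @ drop c R) = m (drop c R @ L)" by (rule tracial)
    show ?thesis using c by (simp add: f_def g_def nth cut_index_add c_def[symmetric] n rot)
  qed
  \<comment> \<open>For these cuts the arc \<open>I c\<close> is a suffix of the rotated word, not a
    prefix, so the two factors change places.\<close>
  have left: "f a = g (a + length R)" if a: "a < length L" for a
  proof -
    define c where "c = cut_index (L ! a) a"
    have c: "c \<le> length L" unfolding c_def using a by (rule cut_index_bounds)
    have nth: "es ! a = L ! a" "(R @ L) ! (a + length R) = L ! a"
      using a by (simp_all add: es nth_append)
    have I: "I c = {length (take c L)..<length (take c L) + length (drop c L)}"
      using c lenL by (simp add: I_def max_def)
    have LR: "take c L @ drop c L @ R = L @ R" by (simp flip: append_assoc)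
    have n: "nths es (I c) = drop c L" "nths es ({..<length es} - I c) = take c L @ R"
      using nths_middle[of "take c L" "drop c L" R] c unfolding I LR by (simp_all add: es)
    have rot: "m (take c L @ R) = m (R @ take c L)" by (rule tracial)
    show ?thesis using c by (simp add: f_def g_def nth cut_index_add c_def[symmetric] n rot mult_ac)
  qed
  have split: "(\<Sum>a<p + q. h a) = (\<Sum>a<p. h a) + (\<Sum>a<q. h (a + p))" for h :: "nat \<Rightarrow> complex" and p q
    by (induction q) (auto simp: add_ac)
  have "(\<Sum>a<length es. f a) = (\<Sum>a<length L. f a) + (\<Sum>a<length R. f (a + length L))"
    by (simp add: es split)
  also have "\<dots> = (\<Sum>a<length R + length L. g a)"
    using left right by (simp add: split lenL)
  also have "\<dots> = 0"
    using gauge[of "R @ L"] by (simp add: g_def)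
  finally show ?thesis by (simp add: f_def)
qed

lemma moments_interval:
  assumes "p \<le> q" "q \<le> length es"
  shows "m (nths es {p..<q}) * m (nths es ({..<length es} - {p..<q}))
    = (\<Sum>\<pi>\<in>NC (length es). (\<Prod>V\<in>\<pi>. k (nths es V)) * of_bool (block_union \<pi> {p..<q}))"
proof -
  have I: "{p..<q} \<subseteq> {..<length es}" using assms by auto
  have "m (nths es S) = (\<Sum>\<pi>\<in>NC_on S. \<Prod>V\<in>\<pi>. k (nths es V))" if "S \<subseteq> {..<length es}" for S
    using that by (simp add: moment_cumulant sum_NC_on_relabel)
  then have "m (nths es {p..<q}) * m (nths es ({..<length es} - {p..<q}))
    = (\<Sum>\<pi> | \<pi> \<in> NC (length es) \<and> block_union \<pi> {p..<q}. \<Prod>V\<in>\<pi>. k (nths es V))"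
    using I by (simp add: sum_NC_block_union)
  also have "\<dots> = (\<Sum>\<pi>\<in>NC (length es). (\<Prod>V\<in>\<pi>. k (nths es V)) * of_bool (block_union \<pi> {p..<q}))"
    by (rule sum.mono_neutral_cong_left) (auto simp: finite_NC)
  finally show ?thesis .
qed

theorem cumulant_eq_0:
  assumes "\<not> alternating es"
  shows "k es = 0"
  using assms
proof (induction es rule: length_induct)
  case (1 es)
  let ?n = "length es"
  have ne: "es \<noteq> []"
    using 1(2) by (auto simp: alternating_def intro: exI[of _ 0])
  \<comment> \<open>The cyclic predecessor. A word in which no letter equals its cyclic predecessor
    is alternating.\<close>
  define pre where "pre = (\<lambda>b. if b = 0 then ?n - 1 else b - 1)"
  have "\<exists>b<?n. es ! b = es ! pre b"
  proof (rule ccontr)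
    assume *: "\<not> (\<exists>b<?n. es ! b = es ! pre b)"
    have "alternating es"
    proof (rule alternating_cases)
      show "es ! i \<noteq> es ! Suc i" if "Suc i < length es" for i
        using * that by (force simp: pre_def)
      show "hd es \<noteq> last es" using * ne by (auto simp: pre_def hd_conv_nth last_conv_nth)
    qed
    then show False using 1(2) by simp
  qed
  then obtain b where b: "b < ?n" "es ! b = es ! pre b" by blast
  define I where "I = (\<lambda>p. {min b p..<max b p})"
  define c where "c = (\<lambda>a. cut_index (es ! a) a)"
  define K where "K = (\<lambda>\<pi>. \<Prod>V\<in>\<pi>. k (nths es V))"
  define N where "N = (\<lambda>\<pi>. \<Sum>a<?n. sign (es ! a) * of_bool (block_union \<pi> (I (c a))))"
  have "(\<Sum>\<pi>\<in>NC ?n. K \<pi> * N \<pi>) =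
    (\<Sum>a<?n. sign (es ! a) * (\<Sum>\<pi>\<in>NC ?n. K \<pi> * of_bool (block_union \<pi> (I (c a)))))"
    unfolding N_def sum_distrib_left by (subst sum.swap) (simp add: mult_ac)
  also have "\<dots> = (\<Sum>a<?n. sign (es ! a) * (m (nths es (I (c a))) * m (nths es ({..<?n} - I (c a)))))"
  proof (intro sum.cong refl)
    fix a assume "a \<in> {..<?n}"
    then have "c a \<le> ?n" unfolding c_def by (intro cut_index_bounds) auto
    then show "sign (es ! a) * (\<Sum>\<pi>\<in>NC ?n. K \<pi> * of_bool (block_union \<pi> (I (c a)))) =
       sign (es ! a) * (m (nths es (I (c a))) * m (nths es ({..<?n} - I (c a))))"
      unfolding I_def K_def using b by (subst moments_interval) auto
  qed
  also have "\<dots> = 0"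
    unfolding I_def c_def using b(1) by (intro gauge_base) simp
  finally have total: "(\<Sum>\<pi>\<in>NC ?n. K \<pi> * N \<pi>) = 0" .
  have rest: "K \<pi> * N \<pi> = 0" if \<pi>: "\<pi> \<in> NC ?n - {{{..<?n}}}" for \<pi>
  proof (cases "\<forall>V\<in>\<pi>. alternating (nths es V)")
    case True
    have part: "partition_on {..<?n} \<pi>" using \<pi> by (auto simp: NC_def)
    have fin: "finite \<pi>" using finite_elements[OF _ part] by simp
    have "N \<pi> = (\<Sum>V\<in>\<pi>. \<Sum>a\<in>V. sign (es ! a) * of_bool (block_union \<pi> (I (c a))))"
    proof -
      have "finite V" if "V \<in> \<pi>" for V
        using part that by (auto simp: partition_on_def intro: finite_subset[of _ "{..<?n}"])
      moreover have "\<forall>V\<in>\<pi>. \<forall>V'\<in>\<pi>. V \<noteq> V' \<longrightarrow> V \<inter> V' = {}"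
        using part by (auto simp: partition_on_def disjoint_def)
      ultimately show ?thesis
        unfolding N_def using part fin
        by (subst partition_onD1[OF part], subst sum.Union_disjoint) auto
    qed
    also have "\<dots> = 0"
    proof (rule sum.neutral, rule ballI)
      fix V assume "V \<in> \<pi>"
      then show "(\<Sum>a\<in>V. sign (es ! a) * of_bool (block_union \<pi> (I (c a)))) = 0"
        unfolding I_def c_def using \<pi> True by (intro sum_block_cuts) auto
    qed
    finally show ?thesis by simp
  next
    case False
    then obtain V where V: "V \<in> \<pi>" "\<not> alternating (nths es V)" by blast
    have "k (nths es V) = 0" using 1(1) V length_nths_less[OF \<pi>] by blast
    moreover have "finite \<pi>"
      using \<pi> finite_elements[of "{..<?n}" \<pi>] by (auto simp: NC_def)
    ultimately have "K \<pi> = 0" unfolding K_def using V by (auto simp: prod_zero_iff)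
    then show ?thesis by simp
  qed
  have "K {{..<?n}} * N {{..<?n}} = 0"
    using total ne rest by (subst (asm) sum.remove[OF finite_NC one_block_in_NC]) auto
  moreover have "N {{..<?n}} \<noteq> 0"
  proof -
    \<comment> \<open>The single block is respected only by the empty arc and by the full one. The
      full arc occurs when the base point is 0 and the cut is at the end, which is the same place
      cyclically.\<close>
    have bu: "block_union {{..<?n}} (I (c a)) \<longleftrightarrow> c a = b \<or> (b = 0 \<and> c a = ?n)" if "a < ?n" for a
    proof -
      have "c a \<le> ?n" unfolding c_def using that by (rule cut_index_bounds)
      have "block_union {{..<?n}} S \<longleftrightarrow> S = {} \<or> S = {..<?n}" if "S \<subseteq> {..<?n}" for S
        using that unfolding block_union_def by blast
      moreover have sub: "I (c a) \<subseteq> {..<?n}" unfolding I_def using \<open>c a \<le> ?n\<close> b by auto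
      moreover have "I (c a) = {} \<longleftrightarrow> c a = b"
        unfolding I_def by (cases "c a" b rule: linorder_cases) simp_all
      moreover have "I (c a) = {..<?n} \<longleftrightarrow> b = 0 \<and> c a = ?n"
      proof
        assume eq: "I (c a) = {..<?n}"
        have "0 \<in> I (c a)" "?n - 1 \<in> I (c a)" unfolding eq using b ne by simp_all
        then show "b = 0 \<and> c a = ?n" using \<open>c a \<le> ?n\<close> b unfolding I_def
          by (cases "c a" b rule: linorder_cases) simp_all
      next
        assume "b = 0 \<and> c a = ?n"
        then show "I (c a) = {..<?n}" unfolding I_def by (simp add: lessThan_atLeast0)
      qed
      ultimately show ?thesis by metis
    qed
    \<comment> \<open>As the letters on both sides of the base point agree, exactly one of them is
      cut there: the one at \<open>b\<close> if both are \<open>Plain\<close>, the one at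
      \<open>pre b\<close> if both are \<open>Star\<close>. Hence the coefficient of the one-block
      partition is a single sign.\<close>
    have "N {{..<?n}} = (\<Sum>a<?n. sign (es ! a) * of_bool (a = (case es ! b of Plain \<Rightarrow> b | Star \<Rightarrow> pre b)))"
      unfolding N_def
    proof (intro sum.cong refl)
      fix a assume a: "a \<in> {..<?n}"
      have "block_union {{..<?n}} (I (c a)) \<longleftrightarrow> (a = (case es ! b of Plain \<Rightarrow> b | Star \<Rightarrow> pre b))"
      proof -
        have "block_union {{..<?n}} (I (c a)) \<longleftrightarrow> (case es ! a of Plain \<Rightarrow> a = b | Star \<Rightarrow> a = pre b)"
          using a b by (subst bu) (auto simp: c_def cut_index_def pre_def split: star_exp.splits)
        also have "\<dots> \<longleftrightarrow> (a = (case es ! b of Plain \<Rightarrow> b | Star \<Rightarrow> pre b))"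
          using b by (auto split: star_exp.splits)
        finally show ?thesis .
      qed
      then show "sign (es ! a) * of_bool (block_union {{..<?n}} (I (c a)))
        = sign (es ! a) * of_bool (a = (case es ! b of Plain \<Rightarrow> b | Star \<Rightarrow> pre b))" by simp
    qed
    also have "\<dots> = sign (es ! b)"
    proof -
      define z where "z = (case es ! b of Plain \<Rightarrow> b | Star \<Rightarrow> pre b)"
      have "z < ?n" using b ne by (auto simp: z_def pre_def split: star_exp.splits)
      moreover have "es ! z = es ! b" using b by (auto simp: z_def split: star_exp.splits)
      ultimately show ?thesis
        unfolding z_def[symmetric] by (simp add: of_bool_def if_distrib sum.delta cong: if_cong)
    qed
    finally show ?thesis by (auto simp: sign_def split: star_exp.splits)
  qed
  ultimately show ?case
    by (simp add: K_def nths_all)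
qed

end

section \<open>The free *-algebra on one generator\<close>

fun flip :: "star_exp \<Rightarrow> star_exp" where
  "flip Plain = Star"
| "flip Star = Plain"

definition adj_word :: "star_exp list \<Rightarrow> star_exp list" where
  "adj_word x = rev (map flip x)"

lemma flip_flip [simp]: "flip (flip e) = e"
  by (cases e) auto

lemma adj_word_simps [simp]:
  "adj_word [] = []" "adj_word (adj_word x) = x" "adj_word (x @ y) = adj_word y @ adj_word x"
  by (simp_all add: adj_word_def rev_map comp_def)

definition splits :: "'a list \<Rightarrow> ('a list \<times> 'a list) set" where
  "splits x = {(u, v). u @ v = x}"

lemma finite_splits [simp]: "finite (splits x)"
proof -
  have "splits x \<subseteq> (\<lambda>i. (take i x, drop i x)) ` {..length x}"
  proof
    fix s assume "s \<in> splits x"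
    then obtain u v where "s = (u, v)" "x = u @ v" by (auto simp: splits_def)
    then show "s \<in> (\<lambda>i. (take i x, drop i x)) ` {..length x}"
      by (intro image_eqI[of _ _ "length u"]) auto
  qed
  then show ?thesis by (rule finite_subset) simp
qed

definition conv :: "('a list \<Rightarrow> complex) \<Rightarrow> ('a list \<Rightarrow> complex) \<Rightarrow> 'a list \<Rightarrow> complex" where
  "conv f g x = (\<Sum>(u, v)\<in>splits x. f u * g v)"

definition finsupp :: "('a \<Rightarrow> complex) \<Rightarrow> bool" where
  "finsupp f \<longleftrightarrow> finite {x. f x \<noteq> 0}"

definition delta :: "'a \<Rightarrow> 'a \<Rightarrow> complex" where
  "delta a x = of_bool (x = a)"

definition lin_ext :: "('a \<Rightarrow> complex) \<Rightarrow> ('a \<Rightarrow> complex) \<Rightarrow> complex" where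
  "lin_ext h f = (\<Sum>x | f x \<noteq> 0. f x * h x)"

lemma lin_ext_eq: "finite S \<Longrightarrow> {x. f x \<noteq> 0} \<subseteq> S \<Longrightarrow> lin_ext h f = (\<Sum>x\<in>S. f x * h x)"
  unfolding lin_ext_def by (rule sum.mono_neutral_left) auto

lemma finsupp_add: "finsupp f \<Longrightarrow> finsupp g \<Longrightarrow> finsupp (\<lambda>x. f x + g x)"
  unfolding finsupp_def by (rule finite_subset[of _ "{x. f x \<noteq> 0} \<union> {x. g x \<noteq> 0}"]) auto

lemma finsupp_cmult: "finsupp f \<Longrightarrow> finsupp (\<lambda>x. c * f x)"
  unfolding finsupp_def by (rule finite_subset[of _ "{x. f x \<noteq> 0}"]) auto

lemma finsupp_delta [simp]: "finsupp (delta a)"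
  by (simp add: finsupp_def delta_def)

lemma conv_support: "{x. conv f g x \<noteq> 0} \<subseteq> (\<lambda>(u, v). u @ v) ` ({x. f x \<noteq> 0} \<times> {x. g x \<noteq> 0})"
proof
  fix x assume "x \<in> {x. conv f g x \<noteq> 0}"
  then have "(\<Sum>(u, v)\<in>splits x. f u * g v) \<noteq> 0" by (simp add: conv_def)
  then obtain s where "s \<in> splits x" "(case s of (u, v) \<Rightarrow> f u * g v) \<noteq> 0"
    by (meson sum.not_neutral_contains_not_neutral)
  then show "x \<in> (\<lambda>(u, v). u @ v) ` ({x. f x \<noteq> 0} \<times> {x. g x \<noteq> 0})"
    by (auto simp: splits_def)
qed

lemma finsupp_conv: "finsupp f \<Longrightarrow> finsupp g \<Longrightarrow> finsupp (conv f g)"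
  unfolding finsupp_def by (rule finite_subset[OF conv_support]) auto

lemma lin_ext_add:
  assumes "finsupp f" "finsupp g"
  shows "lin_ext h (\<lambda>x. f x + g x) = lin_ext h f + lin_ext h g"
proof -
  let ?S = "{x. f x \<noteq> 0} \<union> {x. g x \<noteq> 0}"
  have "finite ?S" using assms by (simp add: finsupp_def)
  then show ?thesis
    by (subst (1 2 3) lin_ext_eq[of ?S]) (auto simp: distrib_right sum.distrib)
qed

lemma lin_ext_cmult:
  assumes "finsupp f"
  shows "lin_ext h (\<lambda>x. c * f x) = c * lin_ext h f"
proof -
  have "finite {x. f x \<noteq> 0}" using assms by (simp add: finsupp_def)
  then show ?thesis
    by (subst (1 2) lin_ext_eq[of "{x. f x \<noteq> 0}"]) (auto simp: sum_distrib_left mult.assoc)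
qed

lemma lin_ext_delta [simp]: "lin_ext h (delta a) = h a"
  by (subst lin_ext_eq[of "{a}"]) (auto simp: delta_def)

lemma lin_ext_delta_left: "finsupp f \<Longrightarrow> lin_ext (delta a) f = f a"
proof -
  assume f: "finsupp f"
  then have "lin_ext (delta a) f = (\<Sum>x\<in>insert a {x. f x \<noteq> 0}. f x * delta a x)"
    by (intro lin_ext_eq) (auto simp: finsupp_def)
  also have "\<dots> = (\<Sum>x\<in>insert a {x. f x \<noteq> 0}. if x = a then f x else 0)"
    by (intro sum.cong) (auto simp: delta_def)
  also have "\<dots> = f a" using f by (simp add: finsupp_def)
  finally show ?thesis .
qed

lemma lin_ext_conv:
  assumes "finsupp f" "finsupp g"
  shows "lin_ext h (conv f g) = lin_ext (\<lambda>u. lin_ext (\<lambda>v. h (u @ v)) g) f"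
proof -
  let ?F = "{x. f x \<noteq> 0}" and ?G = "{x. g x \<noteq> 0}"
  let ?S = "(\<lambda>(u, v). u @ v) ` (?F \<times> ?G)"
  have fin: "finite ?F" "finite ?G" using assms by (auto simp: finsupp_def)
  have "lin_ext h (conv f g) = (\<Sum>x\<in>?S. conv f g x * h x)"
    using fin conv_support by (intro lin_ext_eq) auto
  also have "\<dots> = (\<Sum>x\<in>?S. \<Sum>(u, v)\<in>{s. s \<in> ?F \<times> ?G \<and> (case s of (u, v) \<Rightarrow> u @ v) = x}. f u * g v * h (u @ v))"
  proof (intro sum.cong refl)
    fix x
    have "conv f g x * h x = (\<Sum>(u, v)\<in>splits x. f u * g v * h (u @ v))"
      unfolding conv_def sum_distrib_right by (intro sum.cong) (auto simp: splits_def)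
    also have "\<dots> = (\<Sum>(u, v)\<in>{s. s \<in> ?F \<times> ?G \<and> (case s of (u, v) \<Rightarrow> u @ v) = x}. f u * g v * h (u @ v))"
      by (intro sum.mono_neutral_right finite_splits) (auto simp: splits_def)
    finally show "conv f g x * h x = (\<Sum>(u, v)\<in>{s. s \<in> ?F \<times> ?G \<and> (case s of (u, v) \<Rightarrow> u @ v) = x}. f u * g v * h (u @ v))" .
  qed
  also have "\<dots> = (\<Sum>(u, v)\<in>?F \<times> ?G. f u * g v * h (u @ v))"
    using fin by (subst sum.image_gen[of "?F \<times> ?G" _ "\<lambda>(u, v). u @ v"]) (auto simp: case_prod_unfold)
  also have "\<dots> = (\<Sum>u\<in>?F. \<Sum>v\<in>?G. f u * g v * h (u @ v))"
    by (simp add: sum.cartesian_product)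
  finally show ?thesis by (simp add: lin_ext_def sum_distrib_left mult.assoc)
qed

lemma lin_ext_swap: "lin_ext (\<lambda>u. lin_ext (\<lambda>v. h u v) g) f = lin_ext (\<lambda>v. lin_ext (\<lambda>u. h u v) f) g"
  unfolding lin_ext_def sum_distrib_left by (subst sum.swap) (simp add: mult.left_commute)

text \<open>Coefficients are read off by the functionals \<open>lin_ext (delta a)\<close>. On these,
  \<open>lin_ext_conv\<close> turns convolution into iterated evaluation, so associativity and the
  unit laws reduce to those of lists.\<close>

lemma finsupp_eqI: "finsupp f \<Longrightarrow> finsupp g \<Longrightarrow> (\<And>a. lin_ext (delta a) f = lin_ext (delta a) g) \<Longrightarrow> f = g"
  by (auto simp: lin_ext_delta_left)

lemma conv_assoc:
  "finsupp f \<Longrightarrow> finsupp g \<Longrightarrow> finsupp h \<Longrightarrow> conv (conv f g) h = conv f (conv g h)"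
  by (intro finsupp_eqI) (simp_all add: lin_ext_conv finsupp_conv)

lemma conv_delta: "conv (delta u) (delta v) = delta (u @ v)"
  by (intro finsupp_eqI) (simp_all add: lin_ext_conv finsupp_conv)

lemma conv_one: "finsupp f \<Longrightarrow> conv (delta []) f = f" "finsupp f \<Longrightarrow> conv f (delta []) = f"
  by (intro finsupp_eqI; simp add: lin_ext_conv finsupp_conv)+

definition adj_fun :: "(star_exp list \<Rightarrow> complex) \<Rightarrow> star_exp list \<Rightarrow> complex" where
  "adj_fun f x = cnj (f (adj_word x))"

lemma adj_fun_support: "{x. adj_fun f x \<noteq> 0} = adj_word ` {x. f x \<noteq> 0}"
  by (force simp: adj_fun_def image_iff intro: exI[of _ "adj_word _"])

lemma finsupp_adj_fun: "finsupp f \<Longrightarrow> finsupp (adj_fun f)"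
  by (simp add: finsupp_def adj_fun_support)

lemma conv_adj_fun: "adj_fun (conv f g) = conv (adj_fun g) (adj_fun f)"
proof
  fix x
  show "adj_fun (conv f g) x = conv (adj_fun g) (adj_fun f) x"
    unfolding adj_fun_def conv_def cnj_sum
  proof (rule sum.reindex_bij_witness[of _ "\<lambda>(u, v). (adj_word v, adj_word u)" "\<lambda>(u, v). (adj_word v, adj_word u)"])
    fix s assume "s \<in> splits (adj_word x)"
    then obtain u v where s: "s = (u, v)" "u @ v = adj_word x" by (auto simp: splits_def)
    have "adj_word v @ adj_word u = x" using arg_cong[OF s(2), of adj_word] by simp
    then show "(case s of (u, v) \<Rightarrow> (adj_word v, adj_word u)) \<in> splits x" by (simp add: s splits_def)
  next
    fix s assume "s \<in> splits x"
    then show "(case s of (u, v) \<Rightarrow> (adj_word v, adj_word u)) \<in> splits (adj_word x)"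
      by (auto simp: splits_def)
  qed auto
qed

text \<open>Noncommutative polynomials in one variable and its adjoint, stored as coefficient
  functions on words. A linear functional on them amounts to an arbitrary choice of *-moments, so
  the limit moments are realised without constructing an operator.\<close>

definition free_star_algebra :: "(star_exp list \<Rightarrow> complex) star_alg" where
  "free_star_algebra = \<lparr>carrier = {f. finsupp f}, mult = conv, one = delta [],
     zero = (\<lambda>x. 0), add = (\<lambda>f g x. f x + g x), smult = (\<lambda>c f x. c * f x), star = adj_fun\<rparr>"

lemma free_star_algebra_simps [simp]:
  "carrier free_star_algebra = {f. finsupp f}"
  "mult free_star_algebra = conv"
  "one free_star_algebra = delta []"
  "zero free_star_algebra = (\<lambda>x. 0)"
  "add free_star_algebra = (\<lambda>f g x. f x + g x)"
  "smult free_star_algebra = (\<lambda>c f x. c * f x)"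
  "star free_star_algebra = adj_fun"
  by (simp_all add: free_star_algebra_def)

lemma conv_distrib:
  "conv (\<lambda>x. f x + g x) h = (\<lambda>x. conv f h x + conv g h x)"
  "conv h (\<lambda>x. f x + g x) = (\<lambda>x. conv h f x + conv h g x)"
  "conv (\<lambda>x. c * f x) h = (\<lambda>x. c * conv f h x)"
  "conv h (\<lambda>x. c * f x) = (\<lambda>x. c * conv h f x)"
  by (auto simp: conv_def case_prod_unfold algebra_simps sum.distrib sum_distrib_left)

lemma free_star_algebra_abelian_group: "abelian_group free_star_algebra"
proof (rule abelian_groupI)
  fix f assume "f \<in> carrier free_star_algebra"
  then show "\<exists>g\<in>carrier free_star_algebra. g \<oplus>\<^bsub>free_star_algebra\<^esub> f = \<zero>\<^bsub>free_star_algebra\<^esub>"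
    using finsupp_cmult[of f "-1"] by (intro bexI[of _ "\<lambda>x. - 1 * f x"]) auto
qed (auto simp: finsupp_add add_ac, simp add: finsupp_def)

lemma unital_star_algebra_free: "unital_star_algebra free_star_algebra"
proof (intro unital_star_algebra.intro unital_star_algebra_axioms.intro)
  show "module class_ring free_star_algebra"
    by (rule moduleI[OF class_cring.cring_axioms free_star_algebra_abelian_group])
      (auto simp: finsupp_cmult algebra_simps)
  show "ring free_star_algebra"
  proof (rule ringI[OF free_star_algebra_abelian_group])
    show "monoid free_star_algebra"
      by (rule monoidI) (auto simp: finsupp_conv conv_assoc conv_one)
  qed (auto simp: conv_distrib)
qed (auto simp: conv_distrib conv_adj_fun finsupp_adj_fun, auto simp: adj_fun_def)

lemma tracial_star_probability_space_free:
  assumes one: "m [] = 1" and tracial: "\<And>x y. m (x @ y) = m (y @ x)"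
    and positive: "\<And>S f. finite S \<Longrightarrow> (\<Sum>x\<in>S. \<Sum>y\<in>S. cnj (f x) * f y * m (adj_word x @ y)) \<in> \<real>\<^sub>\<ge>\<^sub>0"
  shows "tracial_star_probability_space free_star_algebra (lin_ext m)"
proof (intro tracial_star_probability_space.intro unital_star_algebra_free tracial_star_probability_space_axioms.intro)
  fix f g assume "f \<in> carrier free_star_algebra" "g \<in> carrier free_star_algebra"
  then have fg: "finsupp f" "finsupp g" by auto
  show "lin_ext m (f \<oplus>\<^bsub>free_star_algebra\<^esub> g) = lin_ext m f + lin_ext m g"
    using fg by (simp add: lin_ext_add)
  show "lin_ext m (f \<otimes>\<^bsub>free_star_algebra\<^esub> g) = lin_ext m (g \<otimes>\<^bsub>free_star_algebra\<^esub> f)"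
    using fg lin_ext_swap[of "\<lambda>u v. m (u @ v)" g f] tracial by (simp add: lin_ext_conv)
next
  fix f c assume "f \<in> carrier free_star_algebra"
  then have f: "finsupp f" by simp
  show "lin_ext m (c \<odot>\<^bsub>free_star_algebra\<^esub> f) = c * lin_ext m f"
    using f by (simp add: lin_ext_cmult)
  let ?S = "{x. f x \<noteq> 0}"
  have fin: "finite ?S" using f by (simp add: finsupp_def)
  have inj: "inj_on adj_word ?S" by (metis adj_word_simps(2) inj_on_inverseI)
  have "lin_ext m (star free_star_algebra f \<otimes>\<^bsub>free_star_algebra\<^esub> f)
    = lin_ext (\<lambda>u. lin_ext (\<lambda>v. m (u @ v)) f) (adj_fun f)"
    using f by (simp add: lin_ext_conv finsupp_adj_fun)
  also have "\<dots> = (\<Sum>x\<in>adj_word ` ?S. adj_fun f x * (\<Sum>y\<in>?S. f y * m (x @ y)))"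
    by (simp add: lin_ext_def adj_fun_support)
  also have "\<dots> = (\<Sum>x\<in>?S. \<Sum>y\<in>?S. cnj (f x) * f y * m (adj_word x @ y))"
    by (simp add: sum.reindex[OF inj] adj_fun_def sum_distrib_left mult.assoc)
  finally show "lin_ext m (star free_star_algebra f \<otimes>\<^bsub>free_star_algebra\<^esub> f) \<in> \<real>\<^sub>\<ge>\<^sub>0"
    using positive[OF fin, of f] by simp
qed (use one in simp)

lemma adj_fun_delta: "adj_fun (delta x) = delta (adj_word x)"
proof
  fix y
  have "adj_word y = x \<longleftrightarrow> y = adj_word x" by auto
  then show "adj_fun (delta x) y = delta (adj_word x) y" by (simp add: adj_fun_def delta_def)
qed

lemma alg_prod_delta:
  "alg_prod free_star_algebra (map (star_power free_star_algebra (delta [Plain])) es) = delta es"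
proof (induction es)
  case Nil
  show ?case by (simp add: alg_prod_def)
next
  case (Cons e es)
  have "star_power free_star_algebra (delta [Plain]) e = delta [e]"
    by (cases e) (simp_all add: adj_fun_delta, simp add: adj_word_def)
  then show ?case using Cons by (simp add: alg_prod_def conv_delta)
qed

section \<open>Convergence to an R-diagonal element\<close>

lemma cut_sum_word:
  "cut_sum h (word es) = (\<Sum>a<length es. sign (es ! a) *
     h (word (take (cut_index (es ! a) a) es)) (word (drop (cut_index (es ! a) a) es)))"
proof (induction es arbitrary: h)
  case (Cons e es)
  have ci: "cut_index e (Suc a) = Suc (cut_index e a)" for e a
    by (simp add: cut_index_def split: star_exp.splits)
  have IH: "cut_sum (\<lambda>u v. h (letters e @ u) v) (word es) = (\<Sum>a<length es. sign (es ! a) *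
     h (letters e @ word (take (cut_index (es ! a) a) es)) (word (drop (cut_index (es ! a) a) es)))"
    by (rule Cons.IH)
  have "cut_sum h (word (e # es)) = sign e * h (word (take (cut_index e 0) (e # es))) (word (drop (cut_index e 0) (e # es)))
     + cut_sum (\<lambda>u v. h (letters e @ u) v) (word es)"
    by (cases e) (auto simp: sign_def cut_index_def)
  then show ?case unfolding IH
    by (simp add: sum.lessThan_Suc_shift ci del: sum.lessThan_Suc)
qed simp


section \<open>Positivity of the averaged traces\<close>

fun letter_adj :: "letter \<Rightarrow> letter" where
  "letter_adj Perm = PermInv"
| "letter_adj PermInv = Perm"
| "letter_adj Wish = Wish"

lemma word_adj_word: "word (adj_word es) = rev (map letter_adj (word es))"
proof (induction es)
  case (Cons e es)
  have "adj_word (e # es) = adj_word es @ [flip e]" by (simp add: adj_word_def)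
  then show ?case using Cons by (cases e) simp_all
qed simp

lemma entry_adj:
  assumes herm: "\<And>i j. f i j = cnj (f j i)" and "i < n" "j < n"
  shows "entry n \<sigma> f (rev (map letter_adj x)) i j = cnj (entry n \<sigma> f x j i)"
  using assms(2,3)
proof (induction x arbitrary: i j)
  case (Cons a x)
  have adj: "letter_entry \<sigma> f (letter_adj a) i j = cnj (letter_entry \<sigma> f a j i)" for i j
    using herm[of i j] by (cases a) auto
  have single: "entry n \<sigma> f [b] l j = letter_entry \<sigma> f b l j" if "j < n" for b l j
  proof -
    have "entry n \<sigma> f [b] l j = (\<Sum>r<n. if r = j then letter_entry \<sigma> f b l r else 0)"
      unfolding entry.simps by (intro sum.cong) auto
    then show ?thesis using that by simp
  qed
  have "entry n \<sigma> f (rev (map letter_adj (a # x))) i j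
      = (\<Sum>l<n. entry n \<sigma> f (rev (map letter_adj x)) i l * entry n \<sigma> f [letter_adj a] l j)"
    using Cons.prems by (simp add: entry_append del: entry.simps)
  also have "\<dots> = (\<Sum>l<n. cnj (entry n \<sigma> f x l i) * cnj (letter_entry \<sigma> f a j l))"
    using Cons by (intro sum.cong refl) (simp add: single adj del: entry.simps)
  finally show ?case by (simp add: mult.commute)
qed auto

text \<open>With \<open>A\<close> the linear combination of the words in \<open>S\<close> with
  coefficients \<open>f\<close>, the sum is the averaged trace of the adjoint of \<open>A\<close>
  times \<open>A\<close>. At fixed \<open>\<sigma>\<close> this is the expectation of
  \<open>r\<close>, the normalised squared Hilbert--Schmidt norm of \<open>A\<close>.\<close>

lemma (in gaussian_matrix) average_trace_positive:
  assumes "finite S"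
  shows "(\<Sum>x\<in>S. \<Sum>y\<in>S. cnj (f x) * f y * average_trace [word (adj_word x @ y)]) \<in> \<real>\<^sub>\<ge>\<^sub>0"
proof -
  let ?g = "\<lambda>\<omega>. gram m n (Z \<omega>)"
  define r where "r = (\<lambda>\<sigma> \<omega>. (\<Sum>i<n. \<Sum>l<n. (cmod (\<Sum>y\<in>S. f y * entry n \<sigma> (?g \<omega>) (word y) l i))\<^sup>2) / real n)"
  have square: "(\<Sum>x\<in>S. \<Sum>y\<in>S. cnj (f x) * f y * trace_prod n \<sigma> (?g \<omega>) [word (adj_word x @ y)])
      = of_real (r \<sigma> \<omega>)" for \<sigma> \<omega>
  proof -
    let ?e = "\<lambda>x. entry n \<sigma> (?g \<omega>) (word x)"
    have "trace_prod n \<sigma> (?g \<omega>) [word (adj_word x @ y)] = (\<Sum>i<n. \<Sum>l<n. cnj (?e x l i) * ?e y l i) / of_nat n" for x y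
      by (simp add: word_trace_def entry_append word_adj_word entry_adj[OF gram_hermitian])
    then have "(\<Sum>x\<in>S. \<Sum>y\<in>S. cnj (f x) * f y * trace_prod n \<sigma> (?g \<omega>) [word (adj_word x @ y)])
      = (\<Sum>x\<in>S. \<Sum>y\<in>S. \<Sum>i<n. \<Sum>l<n. (cnj (f x) * f y) * (cnj (?e x l i) * ?e y l i)) / of_nat n"
      by (simp only: times_divide_eq_right sum_distrib_left sum_divide_distrib)
    also have "(\<Sum>x\<in>S. \<Sum>y\<in>S. \<Sum>i<n. \<Sum>l<n. (cnj (f x) * f y) * (cnj (?e x l i) * ?e y l i))
      = (\<Sum>x\<in>S. \<Sum>i<n. \<Sum>y\<in>S. \<Sum>l<n. (cnj (f x) * f y) * (cnj (?e x l i) * ?e y l i))"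
      by (intro sum.cong refl sum.swap)
    also have "\<dots> = (\<Sum>i<n. \<Sum>x\<in>S. \<Sum>y\<in>S. \<Sum>l<n. (cnj (f x) * f y) * (cnj (?e x l i) * ?e y l i))"
      by (rule sum.swap)
    also have "\<dots> = (\<Sum>i<n. \<Sum>x\<in>S. \<Sum>l<n. \<Sum>y\<in>S. (cnj (f x) * f y) * (cnj (?e x l i) * ?e y l i))"
      by (intro sum.cong refl sum.swap)
    also have "\<dots> = (\<Sum>i<n. \<Sum>l<n. \<Sum>x\<in>S. \<Sum>y\<in>S. (cnj (f x) * f y) * (cnj (?e x l i) * ?e y l i))"
      by (intro sum.cong refl sum.swap)
    also have "\<dots> = (\<Sum>i<n. \<Sum>l<n. cnj (\<Sum>x\<in>S. f x * ?e x l i) * (\<Sum>y\<in>S. f y * ?e y l i))"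
      by (simp only: cnj_sum sum_product complex_cnj_mult) (simp add: mult_ac)
    also have "\<dots> = (\<Sum>i<n. \<Sum>l<n. of_real ((cmod (\<Sum>y\<in>S. f y * ?e y l i))\<^sup>2))"
      by (intro sum.cong refl) (simp only: complex_norm_square mult.commute)
    finally show ?thesis by (simp add: r_def)
  qed
  have mean: "(\<Sum>x\<in>S. \<Sum>y\<in>S. cnj (f x) * f y * mean_trace \<sigma> [word (adj_word x @ y)])
      = of_real (expectation (r \<sigma>))" for \<sigma>
  proof -
    have int: "integrable P (\<lambda>\<omega>. cnj (f x) * f y * trace_prod n \<sigma> (?g \<omega>) [word (adj_word x @ y)])" for x y
      by (intro integrable_mult_right integrable_trace_prod)
    have "of_real (expectation (r \<sigma>)) = expectation (\<lambda>\<omega>. \<Sum>x\<in>S. \<Sum>y\<in>S. cnj (f x) * f y * trace_prod n \<sigma> (?g \<omega>) [word (adj_word x @ y)])"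
      by (simp only: square integral_complex_of_real)
    also have "\<dots> = (\<Sum>x\<in>S. \<Sum>y\<in>S. expectation (\<lambda>\<omega>. cnj (f x) * f y * trace_prod n \<sigma> (?g \<omega>) [word (adj_word x @ y)]))"
    proof -
      have "expectation (\<lambda>\<omega>. \<Sum>x\<in>S. \<Sum>y\<in>S. cnj (f x) * f y * trace_prod n \<sigma> (?g \<omega>) [word (adj_word x @ y)])
        = (\<Sum>x\<in>S. expectation (\<lambda>\<omega>. \<Sum>y\<in>S. cnj (f x) * f y * trace_prod n \<sigma> (?g \<omega>) [word (adj_word x @ y)]))"
        by (intro Bochner_Integration.integral_sum Bochner_Integration.integrable_sum int)
      also have "\<dots> = (\<Sum>x\<in>S. \<Sum>y\<in>S. expectation (\<lambda>\<omega>. cnj (f x) * f y * trace_prod n \<sigma> (?g \<omega>) [word (adj_word x @ y)]))"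
        by (intro sum.cong refl Bochner_Integration.integral_sum int)
      finally show ?thesis .
    qed
    finally show ?thesis by (simp add: mean_trace_def del: trace_prod_simps)
  qed
  let ?S = "{\<sigma>. \<sigma> permutes {..<n}}"
  have "(\<Sum>x\<in>S. \<Sum>y\<in>S. cnj (f x) * f y * average_trace [word (adj_word x @ y)])
    = (\<Sum>x\<in>S. \<Sum>y\<in>S. \<Sum>\<sigma>\<in>?S. (1 / fact n) * (cnj (f x) * f y * mean_trace \<sigma> [word (adj_word x @ y)]))"
    by (simp add: average_trace_def sum_distrib_left)
  also have "\<dots> = (\<Sum>x\<in>S. \<Sum>\<sigma>\<in>?S. \<Sum>y\<in>S. (1 / fact n) * (cnj (f x) * f y * mean_trace \<sigma> [word (adj_word x @ y)]))"
    by (intro sum.cong refl sum.swap)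
  also have "\<dots> = (\<Sum>\<sigma>\<in>?S. \<Sum>x\<in>S. \<Sum>y\<in>S. (1 / fact n) * (cnj (f x) * f y * mean_trace \<sigma> [word (adj_word x @ y)]))"
    by (rule sum.swap)
  also have "\<dots> = (\<Sum>\<sigma>\<in>?S. (1 / fact n) * of_real (expectation (r \<sigma>)))"
    by (simp only: mean[symmetric] sum_distrib_left)
  also have "\<dots> = of_real (\<Sum>\<sigma>\<in>?S. (1 / fact n) * expectation (r \<sigma>))" by simp
  also have "\<dots> \<in> \<real>\<^sub>\<ge>\<^sub>0"
  proof -
    have "0 \<le> expectation (r \<sigma>)" for \<sigma>
      unfolding r_def by (intro Bochner_Integration.integral_nonneg divide_nonneg_nonneg sum_nonneg) auto
    then have "0 \<le> (\<Sum>\<sigma>\<in>?S. (1 / fact n) * expectation (r \<sigma>))" by (intro sum_nonneg) auto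
    then show ?thesis by (simp only: nonneg_Reals_of_real_iff)
  qed
  finally show ?thesis .
qed

definition limit_moment :: "real \<Rightarrow> star_exp list \<Rightarrow> complex" where
  "limit_moment c es = limit_trace c (word es)"

lemma limit_moment_tendsto:
  assumes "\<And>q. gaussian_matrix (P q) (m q) (n q) (Z q)"
    and "filterlim n at_top sequentially" and "(\<lambda>q. real (m q) / real (n q)) \<longlonglongrightarrow> c"
  shows "(\<lambda>q. gaussian_matrix.average_trace (P q) (m q) (n q) (Z q) [word es]) \<longlonglongrightarrow> limit_moment c es"
  using average_trace_tendsto[OF assms, of "[word es]"] by (simp add: limit_moment_def)

lemma limit_moment_gauge:
  "(\<Sum>a<length es. sign (es ! a) * (limit_moment c (take (cut_index (es ! a) a) es)
     * limit_moment c (drop (cut_index (es ! a) a) es))) = 0"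
  using cut_sum_word[of "\<lambda>u v. limit_trace c u * limit_trace c v" es] cut_sum_limit_trace[of c "word es"]
  by (simp add: limit_moment_def)

lemma R_diagonal_free:
  assumes one: "m [] = 1" and tracial: "\<And>x y. m (x @ y) = m (y @ x)"
    and gauge: "\<And>es. (\<Sum>a<length es. sign (es ! a) *
      (m (take (cut_index (es ! a) a) es) * m (drop (cut_index (es ! a) a) es))) = 0"
  shows "R_diagonal free_star_algebra (lin_ext m) (delta [Plain])"
proof -
  let ?p = "star_power free_star_algebra (delta [Plain])"
  define k where "k = (\<lambda>es. free_cumulant free_star_algebra (lin_ext m) (map ?p es))"
  interpret gauge_invariant_moments m k
  proof
    fix es
    show "m es = (\<Sum>\<pi>\<in>NC (length es). \<Prod>V\<in>\<pi>. k (nths es V))"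
    proof (cases "es = []")
      case True
      have "NC 0 = {{}}" by (auto simp: NC_def partition_on_empty noncrossing_def)
      then show ?thesis using True one by simp
    next
      case False
      then show ?thesis
        using moment_cumulant_formula[of "map ?p es" "lin_ext m" free_star_algebra]
        by (simp add: alg_prod_delta k_def nths_map)
    qed
  qed (use tracial gauge in auto)
  show ?thesis
    using cumulant_eq_0 by (auto simp: R_diagonal_def k_def)
qed

theorem mainTheorem4:
  fixes c :: real
    and P :: "nat \<Rightarrow> nat \<Rightarrow> 'w measure"
    and G U Y :: "nat \<Rightarrow> nat \<Rightarrow> 'w \<Rightarrow> complex mat"
  assumes "c > 0"
    and "permuted_wishart_model P G U"
    and "\<And>M N \<omega>. Y M N \<omega> = U M N \<omega> * wishart N (G M N \<omega>)"
  shows "\<exists>(A :: (star_exp list \<Rightarrow> complex) star_alg) \<phi> y.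
    tracial_star_probability_space A \<phi> \<and> R_diagonal A \<phi> y \<and>
    (\<forall>(Ms :: nat \<Rightarrow> nat) (Ns :: nat \<Rightarrow> nat).
       strict_mono Ms \<and> strict_mono Ns \<and> (\<forall>q. Ms q \<ge> 1) \<and> (\<forall>q. Ns q \<ge> 1) \<and>
       (\<lambda>q. real (Ms q) / real (Ns q)) \<longlonglongrightarrow> c \<longrightarrow>
       (\<forall>es. es \<noteq> [] \<longrightarrow>
          (\<lambda>q. integral\<^sup>L (P (Ms q) (Ns q))
             (\<lambda>\<omega>. norm_trace (mat_word (Ns q) (Y (Ms q) (Ns q) \<omega>) es)))
          \<longlonglongrightarrow> \<phi> (alg_prod A (map (star_power A y) es))))"
proof -
  let ?m = "limit_moment c"
  define a where "a M N = gaussian_matrix.average_trace (P M N) M N (\<lambda>\<omega> e. G M N \<omega> $$ e)" for M N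
  note gm = expectation_norm_trace(1)[OF assms(2)]
  have lim: "(\<lambda>q. a (Ms q) (Ns q) [word es]) \<longlonglongrightarrow> ?m es"
    if "\<forall>q. Ms q \<ge> 1" "\<forall>q. Ns q \<ge> 1" "filterlim Ns at_top sequentially"
      "(\<lambda>q. real (Ms q) / real (Ns q)) \<longlonglongrightarrow> c" for Ms Ns es
    unfolding a_def using that by (intro limit_moment_tendsto gm) auto
  \<comment> \<open>The algebra is fixed before any sequences are given, so its traciality and
    positivity are taken from one particular choice of sizes with ratio tending to \<open>c\<close>.
    As \<open>c > 0\<close>, the ceiling is at least 1.\<close>
  define Ms where "Ms q = nat \<lceil>c * real (Suc q)\<rceil>" for q
  have Ms1: "Ms q \<ge> 1" for q
    using assms(1) by (simp add: Ms_def Suc_le_eq)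
  have Suc_top: "filterlim Suc at_top sequentially" by (rule filterlim_Suc)
  have ratio: "(\<lambda>q. real (Ms q) / real (Suc q)) \<longlonglongrightarrow> c"
  proof (rule tendsto_sandwich)
    have *: "c * real (Suc q) \<le> real (Ms q)" "real (Ms q) \<le> c * real (Suc q) + 1" for q
      using assms(1) by (auto simp: Ms_def of_nat_nat)
    show "eventually (\<lambda>q. c \<le> real (Ms q) / real (Suc q)) sequentially"
      using * by (intro always_eventually allI) (simp add: le_divide_eq)
    have "real (Ms q) / real (Suc q) \<le> c + 1 / real (Suc q)" for q
    proof -
      have "real (Ms q) / real (Suc q) \<le> (c * real (Suc q) + 1) / real (Suc q)"
        by (intro divide_right_mono *) simp
      also have "\<dots> = c + 1 / real (Suc q)" by (simp add: add_divide_distrib del: of_nat_Suc)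
      finally show ?thesis .
    qed
    then show "eventually (\<lambda>q. real (Ms q) / real (Suc q) \<le> c + 1 / real (Suc q)) sequentially"
      by (intro always_eventually allI)
    show "(\<lambda>q. c + 1 / real (Suc q)) \<longlonglongrightarrow> c"
      using tendsto_add[OF tendsto_const LIMSEQ_inverse_real_of_nat, of c] by (simp add: inverse_eq_divide)
  qed auto
  have lim': "(\<lambda>q. a (Ms q) (Suc q) [word es]) \<longlonglongrightarrow> ?m es" for es
    using Ms1 Suc_top ratio by (intro lim) auto
  have one: "?m [] = 1" by (simp add: limit_moment_def limit_trace_unitary)
  \<comment> \<open>The recursion of \<open>limit_trace\<close> singles out the first
    \<open>Wish\<close> of a linear word, so cyclic invariance is not visible in it; for matrices it
    is exact.\<close>
  have tracial: "?m (x @ y) = ?m (y @ x)" for x y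
  proof (rule LIMSEQ_unique[OF lim'])
    have "a (Ms q) (Suc q) [word (x @ y)] = a (Ms q) (Suc q) [word (y @ x)]" for q
      unfolding a_def using Ms1
      by (intro gaussian_matrix.average_trace_cong gm) (auto intro: word_trace_commute)
    then show "(\<lambda>q. a (Ms q) (Suc q) [word (x @ y)]) \<longlonglongrightarrow> ?m (y @ x)"
      by (simp only: lim')
  qed
  have positive: "(\<Sum>x\<in>S. \<Sum>y\<in>S. cnj (f x) * f y * ?m (adj_word x @ y)) \<in> \<real>\<^sub>\<ge>\<^sub>0" if "finite S" for S f
  proof (rule Lim_in_closed_set[OF closed_nonneg_Reals_complex])
    show "eventually (\<lambda>q. (\<Sum>x\<in>S. \<Sum>y\<in>S. cnj (f x) * f y * a (Ms q) (Suc q) [word (adj_word x @ y)]) \<in> \<real>\<^sub>\<ge>\<^sub>0) sequentially"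
      unfolding a_def using Ms1 that
      by (intro always_eventually allI gaussian_matrix.average_trace_positive gm) auto
    show "(\<lambda>q. \<Sum>x\<in>S. \<Sum>y\<in>S. cnj (f x) * f y * a (Ms q) (Suc q) [word (adj_word x @ y)])
        \<longlonglongrightarrow> (\<Sum>x\<in>S. \<Sum>y\<in>S. cnj (f x) * f y * ?m (adj_word x @ y))"
      by (intro tendsto_sum tendsto_mult tendsto_const lim')
  qed simp
  show ?thesis
  proof (intro exI conjI allI impI)
    show "tracial_star_probability_space free_star_algebra (lin_ext ?m)"
      using one tracial positive by (rule tracial_star_probability_space_free)
    show "R_diagonal free_star_algebra (lin_ext ?m) (delta [Plain])"
      using one tracial limit_moment_gauge by (rule R_diagonal_free)
    fix Ms Ns :: "nat \<Rightarrow> nat" and es :: "star_exp list"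
    assume *: "strict_mono Ms \<and> strict_mono Ns \<and> (\<forall>q. Ms q \<ge> 1) \<and> (\<forall>q. Ns q \<ge> 1) \<and>
       (\<lambda>q. real (Ms q) / real (Ns q)) \<longlonglongrightarrow> c"
    then have "(\<lambda>q. a (Ms q) (Ns q) [word es]) \<longlonglongrightarrow> ?m es"
      by (intro lim) (auto intro: filterlim_subseq)
    moreover have "integral\<^sup>L (P (Ms q) (Ns q)) (\<lambda>\<omega>. norm_trace (mat_word (Ns q) (Y (Ms q) (Ns q) \<omega>) es))
        = a (Ms q) (Ns q) [word es]" for q
      unfolding assms(3) a_def using * by (intro expectation_norm_trace(2)[OF assms(2)]) auto
    ultimately show "(\<lambda>q. integral\<^sup>L (P (Ms q) (Ns q))
             (\<lambda>\<omega>. norm_trace (mat_word (Ns q) (Y (Ms q) (Ns q) \<omega>) es)))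
          \<longlonglongrightarrow> lin_ext ?m (alg_prod free_star_algebra (map (star_power free_star_algebra (delta [Plain])) es))"
      by (simp add: alg_prod_delta)
  qed
qed

end
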